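(* Suppose that Condition A and Condition B hold. Suppose the characteristic equation $L(j)=0$ has exactly $k$ roots $j_1,\dots,j_k$ among the natural numbers $j\in\{0,1,2,\dots\}$, and for each $j\in\{j_1,\dots,j_k\}$ let $r_j$ be the multiplicity of $\lambda=1$ as a root of the equation $\mathcal{P}_j(\lambda)=0$. Then the integral equation $$\int_0^t K(t,s)x(s)\,ds=f(t),\qquad 0<t\le T,$$ has in $\mathbb{C}_{(0,T]}$ a solution of the form $$x(t)=\sum_{i=0}^N x_i(\ln t)\,t^i+t^N u(t)$$ which depends on $p=r_{j_1}+\dots+r_{j_k}$ arbitrary real constants (for each root $j\in\{j_1,\dots,j_k\}$, the coefficients of $z^0,z^1,\dots,z^{r_j-1}$ in the polynomial $x_j(z)$ may be prescribed arbitrarily). Here the coefficients $x_i(\ln t)$ of the asymptotic approximation $x^N(t)=\sum_{i=0}^N x_i(\ln t)t^i$ are polynomials in $\ln t$, and the function $u\in\mathbb{C}_{[0,T]}$ can be constructed by the successive approximations $u_{m+1}=Au_m+L_0^{-1}h$, which converge uniformly on $[0,T]$.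
   Context: Setting. Let $T>0$, $n\ge1$, and $0=\alpha_0<\alpha_1<\dots<\alpha_{n-1}<\alpha_n=1$. For $i=1,\dots,n$ let $K_i(t,s)$ be a real function on $\{0\le s\le t\le T\}$, continuous together with its partial derivative $K_i'(t,s)=\partial K_i(t,s)/\partial t$, and put $K(t,s)=K_i(t,s)$ for $\alpha_{i-1}t\le s<\alpha_i t$, $i=1,\dots,n$ (with $s=t$ included for $i=n$). Let $f\in\mathbb{C}^{(1)}_{[0,T]}$ be real valued with $f(0)=0$. Condition A. $K_n(t,t)\ne0$ for all $t\in[0,T]$, and the integer $N\ge0$ is such that, for some $q<1$, $$\max_{0\le t\le T}|K_n(t,t)|^{-1}\sum_{i=1}^n\Big(\alpha_i^{1+N}|K_i(t,\alpha_it)|+\alpha_{i-1}^{1+N}|K_i(t,\alpha_{i-1}t)|\Big)\le 1+q .$$ Condition B. With this $N$, the functions $K_i(t,s)$, $i=1,\dots,n$, and $f(t)$ are $N+1$ times differentiable in a neighborhood of zero (a neighborhood of $(0,0)$, respectively of $0$, within their domains). Characteristic equation: $L(j)=0$, where $L(j)=\sum_{i=1}^n K_i(0,0)(\alpha_i^{1+j}-\alpha_{i-1}^{1+j})$. For $j=0,1,2,\dots$ and $\lambda>0$, with $a_i=\ln\alpha_i$, $$\mathcal{P}_j(\lambda)=K_n(0,0)+\sum_{i=1}^{n-1}\alpha_i^{1+j}\big(K_i(0,0)-K_{i+1}(0,0)\big)\lambda^{a_i}.$$ $\mathbb{C}_{[0,T]}$ is the space of continuous real functions on $[0,T]$; $\mathbb{C}_{(0,T]}$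 denotes here the continuous functions on $(0,T]$ (possibly unbounded as $t\to+0$). Successive approximations. Define on $\mathbb{C}_{[0,T]}$ the operator $$(L_0u)(t)=\frac{1}{K_n(t,t)}\sum_{i=1}^n\Big(\alpha_i^{1+N}K_i(t,\alpha_it)u(\alpha_it)-\alpha_{i-1}^{1+N}K_i(t,\alpha_{i-1}t)u(\alpha_{i-1}t)\Big),$$ which under Condition A has a bounded inverse, and $Au=-L_0^{-1}v$, where $v(t)=\sum_{i=1}^n\int_{\alpha_{i-1}t}^{\alpha_it}\frac{K_i'(t,s)}{K_n(t,t)}(s/t)^Nu(s)\,ds$ for $t>0$, $v(0)=0$. Given $x^N$, put $g(t)=f(t)-\int_0^tK(t,s)x^N(s)\,ds$ and $h(t)=t^{-N}g'(t)/K_n(t,t)$ for $t>0$, $h(0)=0$. The initial approximation $u_0\in\mathbb{C}_{[0,T]}$ is arbitrary. *)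

theory Defs
  imports "HOL-Analysis.Analysis" "HOL-Computational_Algebra.Polynomial" "HOL-Library.FuncSet"
begin

text \<open>
  Kernels are indexed by \<open>i \<in> {1..n}\<close> and breakpoints by \<open>i \<in> {0..n}\<close>; the values of \<open>K\<close> and \<open>\<alpha>\<close>
  at other indices, and of \<open>K i t s\<close> outside the triangle, play no role.
\<close>

definition triangle :: "real \<Rightarrow> (real \<times> real) set" where
  "triangle T = {(t, s). 0 \<le> s \<and> s \<le> t \<and> t \<le> T}"

text \<open>The space of continuous functions on \<open>[0, T]\<close>. Its elements are extensional (fixed outside
  \<open>[0, T]\<close>), so that equality in this set is equality on \<open>[0, T]\<close> and operators can be inverted.\<close>

definition cont_space :: "real \<Rightarrow> (real \<Rightarrow> real) set" where
  "cont_space T = {u \<in> extensional {0..T}. continuous_on {0..T} u}"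

definition sup_norm :: "real \<Rightarrow> (real \<Rightarrow> real) \<Rightarrow> real" where
  "sup_norm T u = (SUP t\<in>{0..T}. \<bar>u t\<bar>)"

text \<open>At the corner \<open>(T, T)\<close> the derivative along \<open>t\<close> within \<open>{s..T}\<close> is unconstrained; there \<open>K'\<close> is
  determined by continuity.\<close>

definition C1_in_t :: "real \<Rightarrow> (real \<Rightarrow> real \<Rightarrow> real) \<Rightarrow> (real \<Rightarrow> real \<Rightarrow> real) \<Rightarrow> bool" where
  "C1_in_t T k k' \<longleftrightarrow>
     continuous_on (triangle T) (\<lambda>(t, s). k t s) \<and>
     continuous_on (triangle T) (\<lambda>(t, s). k' t s) \<and>
     (\<forall>(t, s)\<in>triangle T. ((\<lambda>\<tau>. k \<tau> s) has_real_derivative k' t s) (at t within {s..T}))"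

definition C1_on :: "real \<Rightarrow> (real \<Rightarrow> real) \<Rightarrow> bool" where
  "C1_on T f \<longleftrightarrow> (\<exists>f'. continuous_on {0..T} f' \<and>
     (\<forall>t\<in>{0..T}. (f has_real_derivative f' t) (at t within {0..T})))"

text \<open>\<open>m + 1\<close> times (totally) differentiable relative to \<open>S\<close>: differentiable on \<open>S\<close>, with all
  partial derivatives \<open>m\<close> times differentiable on \<open>S\<close>. It is used only for relatively open
  subsets of an interval or of a triangle, where derivatives within the set are unique.\<close>

primrec times_differentiable_on ::
    "nat \<Rightarrow> ('a::euclidean_space \<Rightarrow> real) \<Rightarrow> 'a set \<Rightarrow> bool" where
  "times_differentiable_on 0 f S \<longleftrightarrow> True"
| "times_differentiable_on (Suc m) f S \<longleftrightarrow>
     (\<exists>f'. (\<forall>p\<in>S. (f has_derivative f' p) (at p within S)) \<and>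
           (\<forall>b\<in>Basis. times_differentiable_on m (\<lambda>p. f' p b) S))"

definition times_differentiable_near_0 ::
    "nat \<Rightarrow> ('a::euclidean_space \<Rightarrow> real) \<Rightarrow> 'a set \<Rightarrow> bool" where
  "times_differentiable_near_0 m f D \<longleftrightarrow>
     (\<exists>U. open U \<and> 0 \<in> U \<and> times_differentiable_on m f (D \<inter> U))"

definition pw_kernel ::
    "nat \<Rightarrow> (nat \<Rightarrow> real) \<Rightarrow> (nat \<Rightarrow> real \<Rightarrow> real \<Rightarrow> real) \<Rightarrow> real \<Rightarrow> real \<Rightarrow> real" where
  "pw_kernel n \<alpha> K t s =
     (if s = t then K n t t
      else K (THE i. i \<in> {1..n} \<and> \<alpha> (i - 1) * t \<le> s \<and> s < \<alpha> i * t) t s)"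

definition condition_A ::
    "real \<Rightarrow> nat \<Rightarrow> (nat \<Rightarrow> real) \<Rightarrow> (nat \<Rightarrow> real \<Rightarrow> real \<Rightarrow> real) \<Rightarrow> nat \<Rightarrow> bool" where
  "condition_A T n \<alpha> K N \<longleftrightarrow>
     (\<forall>t\<in>{0..T}. K n t t \<noteq> 0) \<and>
     (\<exists>q<1. \<forall>t\<in>{0..T}.
        inverse \<bar>K n t t\<bar> *
          (\<Sum>i=1..n. \<alpha> i ^ (1 + N) * \<bar>K i t (\<alpha> i * t)\<bar>
                    + \<alpha> (i - 1) ^ (1 + N) * \<bar>K i t (\<alpha> (i - 1) * t)\<bar>) \<le> 1 + q)"

definition condition_B ::
    "real \<Rightarrow> nat \<Rightarrow> (nat \<Rightarrow> real \<Rightarrow> real \<Rightarrow> real) \<Rightarrow> (real \<Rightarrow> real) \<Rightarrow> nat \<Rightarrow> bool" where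
  "condition_B T n K f N \<longleftrightarrow>
     (\<forall>i\<in>{1..n}. times_differentiable_near_0 (N + 1) (\<lambda>(t, s). K i t s) (triangle T)) \<and>
     times_differentiable_near_0 (N + 1) f {0..T}"

definition char_L ::
    "nat \<Rightarrow> (nat \<Rightarrow> real) \<Rightarrow> (nat \<Rightarrow> real \<Rightarrow> real \<Rightarrow> real) \<Rightarrow> nat \<Rightarrow> real" where
  "char_L n \<alpha> K j = (\<Sum>i=1..n. K i 0 0 * (\<alpha> i ^ (1 + j) - \<alpha> (i - 1) ^ (1 + j)))"

definition char_P ::
    "nat \<Rightarrow> (nat \<Rightarrow> real) \<Rightarrow> (nat \<Rightarrow> real \<Rightarrow> real \<Rightarrow> real) \<Rightarrow> nat \<Rightarrow> real \<Rightarrow> real" where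
  "char_P n \<alpha> K j z =
     K n 0 0 + (\<Sum>i=1..<n. \<alpha> i ^ (1 + j) * (K i 0 0 - K (i + 1) 0 0) * z powr ln (\<alpha> i))"

text \<open>The function \<open>char_P n \<alpha> K j\<close> is a generalised polynomial with real exponents, so the
  multiplicity of a root is its order of vanishing.\<close>

definition has_root_multiplicity :: "(real \<Rightarrow> real) \<Rightarrow> real \<Rightarrow> nat \<Rightarrow> bool" where
  "has_root_multiplicity P z r \<longleftrightarrow> (\<forall>m<r. (deriv ^^ m) P z = 0) \<and> (deriv ^^ r) P z \<noteq> 0"

definition log_asymp :: "nat \<Rightarrow> (nat \<Rightarrow> real poly) \<Rightarrow> real \<Rightarrow> real" where
  "log_asymp N X t = (\<Sum>i\<le>N. poly (X i) (ln t) * t ^ i)"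

definition op_L0 ::
    "real \<Rightarrow> nat \<Rightarrow> (nat \<Rightarrow> real) \<Rightarrow> (nat \<Rightarrow> real \<Rightarrow> real \<Rightarrow> real) \<Rightarrow> nat \<Rightarrow>
     (real \<Rightarrow> real) \<Rightarrow> (real \<Rightarrow> real)" where
  "op_L0 T n \<alpha> K N u = (\<lambda>t\<in>{0..T}. 1 / K n t t *
     (\<Sum>i=1..n. \<alpha> i ^ (1 + N) * K i t (\<alpha> i * t) * u (\<alpha> i * t)
               - \<alpha> (i - 1) ^ (1 + N) * K i t (\<alpha> (i - 1) * t) * u (\<alpha> (i - 1) * t)))"

definition op_L0_inv ::
    "real \<Rightarrow> nat \<Rightarrow> (nat \<Rightarrow> real) \<Rightarrow> (nat \<Rightarrow> real \<Rightarrow> real \<Rightarrow> real) \<Rightarrow> nat \<Rightarrow>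
     (real \<Rightarrow> real) \<Rightarrow> (real \<Rightarrow> real)" where
  "op_L0_inv T n \<alpha> K N = inv_into (cont_space T) (op_L0 T n \<alpha> K N)"

definition L0_boundedly_invertible ::
    "real \<Rightarrow> nat \<Rightarrow> (nat \<Rightarrow> real) \<Rightarrow> (nat \<Rightarrow> real \<Rightarrow> real \<Rightarrow> real) \<Rightarrow> nat \<Rightarrow> bool" where
  "L0_boundedly_invertible T n \<alpha> K N \<longleftrightarrow>
     bij_betw (op_L0 T n \<alpha> K N) (cont_space T) (cont_space T) \<and>
     (\<exists>B. \<forall>w\<in>cont_space T. sup_norm T (op_L0_inv T n \<alpha> K N w) \<le> B * sup_norm T w)"

definition op_V ::
    "real \<Rightarrow> nat \<Rightarrow> (nat \<Rightarrow> real) \<Rightarrow> (nat \<Rightarrow> real \<Rightarrow> real \<Rightarrow> real) \<Rightarrow>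
     (nat \<Rightarrow> real \<Rightarrow> real \<Rightarrow> real) \<Rightarrow> nat \<Rightarrow> (real \<Rightarrow> real) \<Rightarrow> (real \<Rightarrow> real)" where
  "op_V T n \<alpha> K K' N u = (\<lambda>t\<in>{0..T}. if t = 0 then 0 else
     (\<Sum>i=1..n. integral {\<alpha> (i - 1) * t..\<alpha> i * t}
                 (\<lambda>s. K' i t s / K n t t * (s / t) ^ N * u s)))"

definition op_A ::
    "real \<Rightarrow> nat \<Rightarrow> (nat \<Rightarrow> real) \<Rightarrow> (nat \<Rightarrow> real \<Rightarrow> real \<Rightarrow> real) \<Rightarrow>
     (nat \<Rightarrow> real \<Rightarrow> real \<Rightarrow> real) \<Rightarrow> nat \<Rightarrow> (real \<Rightarrow> real) \<Rightarrow> (real \<Rightarrow> real)" where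
  "op_A T n \<alpha> K K' N u =
     (\<lambda>t\<in>{0..T}. - op_L0_inv T n \<alpha> K N (op_V T n \<alpha> K K' N u) t)"

definition residual_g ::
    "nat \<Rightarrow> (nat \<Rightarrow> real) \<Rightarrow> (nat \<Rightarrow> real \<Rightarrow> real \<Rightarrow> real) \<Rightarrow> (real \<Rightarrow> real) \<Rightarrow>
     (real \<Rightarrow> real) \<Rightarrow> real \<Rightarrow> real" where
  "residual_g n \<alpha> K f xN t = f t - integral {0..t} (\<lambda>s. pw_kernel n \<alpha> K t s * xN s)"

text \<open>At \<open>t = T\<close> the derivative of \<open>g\<close> is one-sided, hence the derivative within \<open>[0, T]\<close>.\<close>

definition rhs_h ::
    "real \<Rightarrow> nat \<Rightarrow> (nat \<Rightarrow> real) \<Rightarrow> (nat \<Rightarrow> real \<Rightarrow> real \<Rightarrow> real) \<Rightarrow> (real \<Rightarrow> real) \<Rightarrow> nat \<Rightarrow>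
     (real \<Rightarrow> real) \<Rightarrow> (real \<Rightarrow> real)" where
  "rhs_h T n \<alpha> K f N xN = (\<lambda>t\<in>{0..T}. if t = 0 then 0 else
     vector_derivative (residual_g n \<alpha> K f xN) (at t within {0..T}) / (t ^ N * K n t t))"

definition successive_approximations ::
    "real \<Rightarrow> nat \<Rightarrow> (nat \<Rightarrow> real) \<Rightarrow> (nat \<Rightarrow> real \<Rightarrow> real \<Rightarrow> real) \<Rightarrow>
     (nat \<Rightarrow> real \<Rightarrow> real \<Rightarrow> real) \<Rightarrow> nat \<Rightarrow> (real \<Rightarrow> real) \<Rightarrow> (nat \<Rightarrow> real \<Rightarrow> real) \<Rightarrow> bool" where
  "successive_approximations T n \<alpha> K K' N h us \<longleftrightarrow>
     us 0 \<in> cont_space T \<and>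
     (\<forall>m. us (Suc m) = (\<lambda>t\<in>{0..T}. op_A T n \<alpha> K K' N (us m) t + op_L0_inv T n \<alpha> K N h t))"

definition solves_equation ::
    "real \<Rightarrow> nat \<Rightarrow> (nat \<Rightarrow> real) \<Rightarrow> (nat \<Rightarrow> real \<Rightarrow> real \<Rightarrow> real) \<Rightarrow> (real \<Rightarrow> real) \<Rightarrow>
     (real \<Rightarrow> real) \<Rightarrow> bool" where
  "solves_equation T n \<alpha> K f x \<longleftrightarrow>
     (\<forall>t\<in>{0<..T}. ((\<lambda>s. pw_kernel n \<alpha> K t s * x s) has_integral f t) {0..t})"

end

theory Submission
  imports Defs
begin

text \<open>
  Let \<open>pw_deriv\<close> denote the operator that arises when the integral equation is differentiated:
  \<open>pw_deriv x\<close> consists of boundary values of \<open>x\<close> at the points \<open>\<alpha> i * t\<close> and of integrals of \<open>x\<close> against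
  \<open>K'\<close>. Both sides of the integral equation vanish at \<open>t = 0\<close>, so that it is equivalent to
  \<open>pw_deriv x = f'\<close> on \<open>(0, T]\<close>. Leibniz' rule is needed for densities with a logarithmic singularity
  (\<open>kernel_int_has_derivative\<close>). The solution is a sum of two parts.

  \<^bold>\<open>The asymptotic part.\<close> Replacing \<open>t\<close> by \<open>\<alpha> i * t\<close> shifts \<open>ln t\<close> by \<open>a i = ln (\<alpha> i)\<close>. Therefore
  \<open>pw_deriv\<close> maps \<open>t ^ j * p (ln t)\<close> to \<open>t ^ j * q (ln t)\<close> plus terms of higher order, where
  \<open>q(z) = (\<Sum>i. b i * p(z + a i))\<close> and the numbers \<open>b i\<close> are the coefficients of \<open>char_P\<close>, that is,
  \<open>char_P(\<lambda>) = (\<Sum>i. b i * \<lambda> powr a i)\<close> (\<open>pw_deriv_leads\<close>). By Taylor's formula the map \<open>p \<mapsto> q\<close> is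
  \<open>\<Sum>m. c m / fact m * D ^ m\<close> with the moments \<open>c m = (\<Sum>i. b i * a i ^ m)\<close>. The first non-vanishing moment has
  the order \<open>r\<close> of the zero of \<open>char_P\<close> at \<open>1\<close> (\<open>root_multiplicity_moments\<close>), and \<open>c 0 = char_L\<close>.
  So the map is \<open>D ^ r\<close> times an invertible one: it is surjective, and the first \<open>r\<close> coefficients of
  a preimage are free (\<open>shift_op_surj\<close>). Consequently the polynomials \<open>x\<^sub>0, \<dots>, x\<^sub>N\<close> can be chosen one after
  the other, with exactly the prescribed coefficients free, until the residual of the
  differentiated equation is \<open>o(t ^ N)\<close> (\<open>log_asymp_exists\<close>). The expansions that this requires come
  from Taylor's theorem with Peano's remainder for kernels and right-hand side.

  \<^bold>\<open>The correction.\<close> For \<open>x = t ^ N * u\<close>, \<open>pw_deriv x\<close> is \<open>t ^ N * K n t t * (L0 u + V u)\<close>, where \<open>L0\<close> and \<open>V\<close>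
  stand for \<open>op_L0\<close> and \<open>op_V\<close>. So the correction has to solve \<open>L0 u + V u = h\<close>, where \<open>h\<close> is
  continuous with \<open>h 0 = 0\<close> by the choice of the asymptotic part. Condition A says that \<open>L0\<close> differs from the
  identity by an operator of norm at most \<open>q < 1\<close>. Because \<open>\<alpha> i * t \<le> t\<close>, this persists in the norm with weight
  \<open>exp (- lam * t)\<close> (\<open>L0_near_identity\<close>), in which the Volterra operator \<open>V\<close> has norm \<open>O(1 / lam)\<close>
  (\<open>V_difference_estimate\<close>). For large \<open>lam\<close> the successive approximations are thus iterates of a
  contraction (\<open>successive_approximations_converge\<close>).

  Condition A at \<open>t = 0\<close> also forces the roots of the characteristic equation to lie below \<open>N\<close>
  (\<open>char_L_root_less\<close>). Coefficients of order below \<open>N\<close> can be read off from a solution, because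
  the correction is \<open>O(t ^ N)\<close>; hence different parameters give different solutions.
\<close>

section \<open>Shift operators on polynomials\<close>

text \<open>Dividing by \<open>c\<close> solves the equation up to the derivative of the quotient, which has smaller
  degree, so the correction terms die out. With \<open>c = j + 1\<close> this produces the antiderivative
  \<open>t ^ (j + 1) * q (ln t)\<close> of \<open>t ^ j * p (ln t)\<close>.\<close>

lemma pderiv_plus_smult_surj:
  fixes p :: "real poly"
  assumes "c \<noteq> 0"
  shows "\<exists>q. smult c q + pderiv q = p"
proof (induction "degree p" arbitrary: p rule: less_induct)
  case less
  show ?case
  proof (cases "degree p = 0")
    case True
    then have "pderiv p = 0" by (simp add: pderiv_eq_0_iff)
    then show ?thesis
      using assms by (intro exI[of _ "smult (1 / c) p"]) (simp add: pderiv_smult)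
  next
    case False
    then have "degree (smult (- 1 / c) (pderiv p)) < degree p"
      by (simp add: degree_pderiv)
    from less[OF this] obtain q where q: "smult c q + pderiv q = smult (- 1 / c) (pderiv p)"
      by blast
    have "smult c (q + smult (1 / c) p) + pderiv (q + smult (1 / c) p) = p"
      using q assms by (simp add: pderiv_add pderiv_smult smult_add_right add_ac)
    then show ?thesis by blast
  qed
qed

text \<open>The action of the differentiated equation on the leading coefficient of a term
  \<open>t ^ j * p (ln t)\<close>: rescaling \<open>t\<close> to \<open>\<alpha> i * t\<close> shifts \<open>ln t\<close> by \<open>ln (\<alpha> i)\<close>.\<close>

definition shift_op :: "('i \<Rightarrow> real) \<Rightarrow> ('i \<Rightarrow> real) \<Rightarrow> 'i set \<Rightarrow> real poly \<Rightarrow> real poly" where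
  "shift_op \<beta> a I p = (\<Sum>i\<in>I. smult (\<beta> i) (p \<circ>\<^sub>p [:a i, 1:]))"

lemma shift_op_add: "shift_op \<beta> a I (p + q) = shift_op \<beta> a I p + shift_op \<beta> a I q"
  by (simp add: shift_op_def pcompose_add smult_add_right sum.distrib)

lemma smult_sum_right: "smult c (\<Sum>i\<in>I. g i) = (\<Sum>i\<in>I. smult c (g i))"
  by (induction I rule: infinite_finite_induct) (auto simp: smult_add_right)

lemma shift_op_smult: "shift_op \<beta> a I (smult c p) = smult c (shift_op \<beta> a I p)"
proof -
  have "smult x (smult c q) = smult c (smult x q)" for x :: real and q by (simp add: mult.commute)
  then show ?thesis
    by (simp add: shift_op_def pcompose_smult smult_sum_right)
qed

lemma shift_op_0: "shift_op \<beta> a I 0 = 0"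
  by (simp add: shift_op_def)

lemma shift_op_sum: "shift_op \<beta> a I (\<Sum>l\<in>L. g l) = (\<Sum>l\<in>L. shift_op \<beta> a I (g l))"
  by (induction L rule: infinite_finite_induct) (auto simp: shift_op_0 shift_op_add)

text \<open>By the binomial theorem the moments \<open>\<Sum>i\<in>I. \<beta> i * a i ^ m\<close> are all that matters: by Taylor's formula
  the operator is \<open>\<Sum>m. (\<Sum>i\<in>I. \<beta> i * a i ^ m) / fact m * D ^ m\<close>, where \<open>D\<close> is differentiation.\<close>

lemma coeff_shift_op_monom:
  "coeff (shift_op \<beta> a I (monom 1 m)) k
     = of_nat (m choose k) * (\<Sum>i\<in>I. \<beta> i * a i ^ (m - k))"
proof -
  have pow: "monom 1 m \<circ>\<^sub>p q = q ^ m" for q :: "real poly"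
    by (induction m) (auto simp: monom_Suc pcompose_pCons pcompose_1)
  have "coeff ([:a i, 1:] ^ m) k = of_nat (m choose k) * a i ^ (m - k)" for i
    by (cases "k \<le> m") (simp_all add: coeff_linear_poly_power coeff_eq_0 degree_linear_power)
  then show ?thesis
    by (simp add: shift_op_def coeff_sum pow sum_distrib_left mult.left_commute)
qed

text \<open>If the first non-vanishing moment is the one of order \<open>r\<close>, then the operator is \<open>D ^ r\<close> times an
  invertible operator. It therefore lowers degrees by exactly \<open>r\<close>, which gives surjectivity by
  eliminating leading coefficients, and it kills the monomials of degree below \<open>r\<close>, which makes
  the first \<open>r\<close> coefficients of a solution free.\<close>

lemma shift_op_surj:
  fixes \<beta> a :: "'i \<Rightarrow> real"
  assumes low: "\<And>m. m < r \<Longrightarrow> (\<Sum>i\<in>I. \<beta> i * a i ^ m) = 0"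
    and top: "(\<Sum>i\<in>I. \<beta> i * a i ^ r) \<noteq> 0"
  shows "\<exists>p. shift_op \<beta> a I p = q \<and> (\<forall>l<r. coeff p l = c l)"
proof -
  have vanish: "coeff (shift_op \<beta> a I (monom 1 m)) k = 0" if "m < k + r" for m k
    using that low[of "m - k"] by (cases "k \<le> m") (auto simp: coeff_shift_op_monom)
  define \<gamma> where "\<gamma> = (\<Sum>i\<in>I. \<beta> i * a i ^ r)"
  have lead: "coeff (shift_op \<beta> a I (monom 1 (d + r))) d = of_nat ((d + r) choose d) * \<gamma>" for d
    by (simp add: coeff_shift_op_monom \<gamma>_def)
  have *: "\<exists>p. shift_op \<beta> a I p = q \<and> (\<forall>l<r. coeff p l = 0)"
    if "\<forall>k\<ge>d. coeff q k = 0" for q d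
    using that
  proof (induction d arbitrary: q)
    case 0
    then have "q = 0" by (simp add: poly_eq_iff)
    then show ?case by (intro exI[of _ 0]) (simp add: shift_op_0)
  next
    case (Suc d)
    \<comment> \<open>With this factor the image of \<open>s\<close> agrees with \<open>q\<close> in degree \<open>d\<close> and vanishes above.\<close>
    define e where "e = coeff q d / (of_nat ((d + r) choose d) * \<gamma>)"
    have e: "e * (of_nat ((d + r) choose d) * \<gamma>) = coeff q d"
      using top by (simp add: e_def \<gamma>_def)
    define s where "s = smult e (monom 1 (d + r))"
    have "\<forall>k\<ge>d. coeff (q - shift_op \<beta> a I s) k = 0"
    proof (intro allI impI)
      fix k assume "d \<le> k"
      show "coeff (q - shift_op \<beta> a I s) k = 0"
      proof (cases "k = d")
        case True
        then show ?thesis by (simp add: s_def shift_op_smult lead e)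
      next
        case False
        then show ?thesis using \<open>d \<le> k\<close> Suc.prems vanish[of "d + r" k]
          by (simp add: s_def shift_op_smult)
      qed
    qed
    from Suc.IH[OF this] obtain p where
      p: "shift_op \<beta> a I p = q - shift_op \<beta> a I s" "\<forall>l<r. coeff p l = 0" by blast
    then show ?case
      by (intro exI[of _ "p + s"]) (auto simp: shift_op_add s_def)
  qed
  obtain p where p: "shift_op \<beta> a I p = q" "\<forall>l<r. coeff p l = 0"
    using *[of "Suc (degree q)" q] by (auto simp: coeff_eq_0)
  \<comment> \<open>Lies in the kernel and carries the prescribed coefficients.\<close>
  define s where "s = (\<Sum>l<r. smult (c l) (monom 1 l))"
  have "shift_op \<beta> a I (monom 1 l) = 0" if "l < r" for l
    using vanish that by (simp add: poly_eq_iff)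
  then have s0: "shift_op \<beta> a I s = 0"
    by (simp add: s_def shift_op_sum shift_op_smult)
  have "coeff s l = c l" if "l < r" for l
    using that by (simp add: s_def coeff_sum if_distrib sum.delta cong: if_cong)
  with p s0 show ?thesis
    by (intro exI[of _ "p + s"]) (simp add: shift_op_add)
qed

text \<open>The falling factorial of a real number: the factor that \<open>m\<close> differentiations of \<open>z powr a\<close>
  produce.\<close>

definition ffall :: "real \<Rightarrow> nat \<Rightarrow> real" where
  "ffall a m = (\<Prod>k<m. a - real k)"

lemma iterated_deriv_powr_sum:
  fixes \<beta> a :: "'i \<Rightarrow> real"
  assumes "\<And>z. z > 0 \<Longrightarrow> P z = (\<Sum>i\<in>I. \<beta> i * z powr a i)" and "z > 0"
  shows "(deriv ^^ m) P z = (\<Sum>i\<in>I. \<beta> i * (ffall (a i) m * z powr (a i - real m)))"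
  using assms(2)
proof (induction m arbitrary: z)
  case 0
  then show ?case using assms(1) by (simp add: ffall_def)
next
  case (Suc m)
  have "eventually (\<lambda>w. w > 0) (nhds z)"
    using Suc.prems eventually_nhds_in_open[of "{0<..}" z] by simp
  then have ev: "eventually (\<lambda>w. (deriv ^^ m) P w
      = (\<Sum>i\<in>I. \<beta> i * (ffall (a i) m * w powr (a i - real m)))) (nhds z)"
    by eventually_elim (use Suc.IH in blast)
  have "(deriv ^^ Suc m) P z = deriv ((deriv ^^ m) P) z" by simp
  also have "\<dots> = deriv (\<lambda>w. \<Sum>i\<in>I. \<beta> i * (ffall (a i) m * w powr (a i - real m))) z"
    by (rule deriv_cong_ev[OF ev refl])
  also have "\<dots> = (\<Sum>i\<in>I. \<beta> i * (ffall (a i) m * ((a i - real m) * z powr (a i - real m - 1))))"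
    using Suc.prems
    by (intro DERIV_imp_deriv DERIV_sum DERIV_cmult has_real_derivative_powr) auto
  finally show ?case
    by (simp add: ffall_def algebra_simps)
qed

text \<open>The passage from falling factorials to powers is unitriangular, because
  \<open>a * ffall a m = ffall a (m + 1) + m * ffall a m\<close>. The mixed moments make this an induction on \<open>l\<close>.\<close>

lemma ffall_moments_imp_power_moments:
  fixes \<beta> a :: "'i \<Rightarrow> real"
  assumes low: "\<And>m. m < r \<Longrightarrow> (\<Sum>i\<in>I. \<beta> i * ffall (a i) m) = 0"
  shows "l + m \<le> r \<Longrightarrow>
    (\<Sum>i\<in>I. \<beta> i * (a i ^ l * ffall (a i) m))
      = (if l + m = r then (\<Sum>i\<in>I. \<beta> i * ffall (a i) r) else 0)"
proof (induction l arbitrary: m)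
  case 0
  then show ?case using low by auto
next
  case (Suc l)
  have "a i ^ Suc l * ffall (a i) m
      = a i ^ l * ffall (a i) (Suc m) + real m * (a i ^ l * ffall (a i) m)" for i
    by (simp add: ffall_def algebra_simps)
  then have "(\<Sum>i\<in>I. \<beta> i * (a i ^ Suc l * ffall (a i) m))
      = (\<Sum>i\<in>I. \<beta> i * (a i ^ l * ffall (a i) (Suc m)))
        + real m * (\<Sum>i\<in>I. \<beta> i * (a i ^ l * ffall (a i) m))"
    by (simp only: distrib_left sum.distrib sum_distrib_left mult.left_commute)
  then show ?case using Suc.IH[of "Suc m"] Suc.IH[of m] Suc.prems by auto
qed

text \<open>The derivatives of \<open>P\<close> at \<open>1\<close> are the falling factorial moments, so the order of vanishing of \<open>P\<close>
  at \<open>1\<close> is the order of the first non-vanishing moment, as required by \<open>shift_op_surj\<close>.\<close>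

lemma root_multiplicity_moments:
  fixes \<beta> a :: "'i \<Rightarrow> real"
  assumes "\<And>z. z > 0 \<Longrightarrow> P z = (\<Sum>i\<in>I. \<beta> i * z powr a i)"
    and "has_root_multiplicity P 1 r"
  shows "m < r \<Longrightarrow> (\<Sum>i\<in>I. \<beta> i * a i ^ m) = 0"
    and "(\<Sum>i\<in>I. \<beta> i * a i ^ r) \<noteq> 0"
proof -
  have d: "(deriv ^^ m) P 1 = (\<Sum>i\<in>I. \<beta> i * ffall (a i) m)" for m
    using iterated_deriv_powr_sum[of P \<beta> a I 1 m] assms(1) by simp
  have low: "(\<Sum>i\<in>I. \<beta> i * ffall (a i) m) = 0" if "m < r" for m
    using assms(2) that d[of m] by (simp add: has_root_multiplicity_def)
  have "(\<Sum>i\<in>I. \<beta> i * ffall (a i) r) \<noteq> 0"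
    using assms(2) d[of r] by (simp add: has_root_multiplicity_def)
  then show "m < r \<Longrightarrow> (\<Sum>i\<in>I. \<beta> i * a i ^ m) = 0" "(\<Sum>i\<in>I. \<beta> i * a i ^ r) \<noteq> 0"
    using ffall_moments_imp_power_moments[where r = r and \<beta> = \<beta> and a = a and I = I and l = m and m = 0, OF low]
      ffall_moments_imp_power_moments[where r = r and \<beta> = \<beta> and a = a and I = I and l = r and m = 0, OF low]
    by (auto simp: ffall_def)
qed

text \<open>Each interior breakpoint is shared by two neighbouring pieces of the kernel; this collects the
  two contributions.\<close>

lemma telescoped_sum_by_parts:
  fixes g :: "nat \<Rightarrow> real" and \<kappa> :: "nat \<Rightarrow> real"
  assumes "n \<ge> 1" "g 0 = 0"
  shows "(\<Sum>i=1..n. \<kappa> i * g i - \<kappa> i * g (i - 1))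
    = \<kappa> n * g n + (\<Sum>i=1..<n. (\<kappa> i - \<kappa> (i + 1)) * g i)"
  using assms(1)
proof (induction n rule: nat_induct_at_least)
  case base
  then show ?case using assms(2) by simp
next
  case (Suc n)
  then show ?case by (simp add: algebra_simps)
qed

section \<open>Taylor expansions at the corner of the triangle\<close>

text \<open>Polynomials in two variables as functions. Everything needed about them is additive, so that an
  induction reduces it to monomials; neither a degree nor coefficients have to be tracked.\<close>

inductive bipoly :: "(real \<Rightarrow> real \<Rightarrow> real) \<Rightarrow> bool" where
  monomial: "bipoly (\<lambda>t s. c * t ^ a * s ^ b)"
| add: "bipoly P \<Longrightarrow> bipoly Q \<Longrightarrow> bipoly (\<lambda>t s. P t s + Q t s)"

lemma bipoly_const: "bipoly (\<lambda>t s. c)"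
  using bipoly.monomial[of c 0 0] by simp

lemma bipoly_mult_fst: "bipoly P \<Longrightarrow> bipoly (\<lambda>t s. t * P t s)"
proof (induction rule: bipoly.induct)
  case (monomial c a b)
  then show ?case using bipoly.monomial[of c "Suc a" b] by (simp add: mult_ac)
next
  case (add P Q)
  then show ?case using bipoly.add[of "\<lambda>t s. t * P t s" "\<lambda>t s. t * Q t s"]
    by (simp add: distrib_left)
qed

lemma bipoly_mult_snd: "bipoly P \<Longrightarrow> bipoly (\<lambda>t s. s * P t s)"
proof (induction rule: bipoly.induct)
  case (monomial c a b)
  then show ?case using bipoly.monomial[of c a "Suc b"] by (simp add: mult_ac)
next
  case (add P Q)
  then show ?case using bipoly.add[of "\<lambda>t s. s * P t s" "\<lambda>t s. s * Q t s"]
    by (simp add: distrib_left)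
qed

lemma bipoly_continuous: "bipoly P \<Longrightarrow> continuous_on A (\<lambda>(t, s). P t s)"
proof (induction rule: bipoly.induct)
  case (monomial c a b)
  show ?case unfolding case_prod_unfold by (intro continuous_intros)
next
  case (add P Q)
  then show ?case unfolding case_prod_unfold by (intro continuous_intros)
qed

text \<open>Integration of a polynomial along rays from the origin, which recovers a function from its
  gradient.\<close>

lemma bipoly_ray_antiderivative:
  "bipoly P \<Longrightarrow> \<exists>R. bipoly R \<and> (\<forall>t s \<tau> A.
     ((\<lambda>\<tau>. \<tau> * R (\<tau> * t) (\<tau> * s)) has_real_derivative P (\<tau> * t) (\<tau> * s)) (at \<tau> within A))"
proof (induction rule: bipoly.induct)
  case (monomial c a b)
  have "((\<lambda>\<tau>. \<tau> * (c / real (a + b + 1) * (\<tau> * t) ^ a * (\<tau> * s) ^ b)) has_real_derivative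
        c * (\<tau> * t) ^ a * (\<tau> * s) ^ b) (at \<tau> within A)" for t s \<tau> :: real and A
  proof -
    have eq: "(\<lambda>\<tau>. \<tau> * (c / real (a + b + 1) * (\<tau> * t) ^ a * (\<tau> * s) ^ b))
       = (\<lambda>\<tau>. c / real (a + b + 1) * t ^ a * s ^ b * \<tau> ^ Suc (a + b))"
      by (auto simp: power_mult_distrib power_add)
    have "((\<lambda>\<tau>. c / real (a + b + 1) * t ^ a * s ^ b * \<tau> ^ Suc (a + b)) has_real_derivative
       c / real (a + b + 1) * t ^ a * s ^ b * (real (a + b + 1) * \<tau> ^ (a + b))) (at \<tau> within A)"
      by (intro DERIV_cmult DERIV_cong[OF DERIV_pow]) simp
    moreover have "c / real (a + b + 1) * t ^ a * s ^ b * (real (a + b + 1) * \<tau> ^ (a + b))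
        = c * (\<tau> * t) ^ a * (\<tau> * s) ^ b"
      by (simp add: power_mult_distrib power_add divide_simps)
    ultimately show ?thesis unfolding eq by metis
  qed
  then show ?case using bipoly.monomial[of "c / real (a + b + 1)" a b]
    by (intro exI[of _ "\<lambda>t s. c / real (a + b + 1) * t ^ a * s ^ b"] conjI) blast+
next
  case (add P Q)
  from add.IH obtain R S where
    R: "bipoly R" "\<forall>t s \<tau> A. ((\<lambda>\<tau>. \<tau> * R (\<tau> * t) (\<tau> * s)) has_real_derivative P (\<tau> * t) (\<tau> * s)) (at \<tau> within A)"
    and S: "bipoly S" "\<forall>t s \<tau> A. ((\<lambda>\<tau>. \<tau> * S (\<tau> * t) (\<tau> * s)) has_real_derivative Q (\<tau> * t) (\<tau> * s)) (at \<tau> within A)"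
    by blast
  have "((\<lambda>\<tau>. \<tau> * (R (\<tau> * t) (\<tau> * s) + S (\<tau> * t) (\<tau> * s))) has_real_derivative
      P (\<tau> * t) (\<tau> * s) + Q (\<tau> * t) (\<tau> * s)) (at \<tau> within A)" for t s \<tau> A
    using DERIV_add[OF R(2)[rule_format, of t s \<tau> A] S(2)[rule_format, of t s \<tau> A]]
    by (simp add: distrib_left)
  then show ?case using bipoly.add[OF R(1) S(1)]
    by (intro exI[of _ "\<lambda>t s. R t s + S t s"] conjI) blast+
qed

text \<open>The part of the triangle near its vertex. It is star-shaped about \<open>0\<close>, and \<open>t\<close> is comparable to the
  norm of \<open>(t, s)\<close> on it.\<close>

definition corner :: "real \<Rightarrow> (real \<times> real) set" where
  "corner \<delta> = {(t, s). 0 \<le> s \<and> s \<le> t \<and> t < \<delta>}"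

lemma times_differentiable_on_subset:
  "times_differentiable_on m f S \<Longrightarrow> S' \<subseteq> S \<Longrightarrow> times_differentiable_on m f S'"
proof (induction m arbitrary: f)
  case (Suc m)
  then obtain f' where "\<forall>p\<in>S. (f has_derivative f' p) (at p within S)"
    "\<forall>b\<in>Basis. times_differentiable_on m (\<lambda>p. f' p b) S" by auto
  with Suc show ?case
    by (auto intro!: exI[of _ f'] intro: has_derivative_subset)
qed simp

lemma times_differentiable_on_zero: "times_differentiable_on m (\<lambda>_. 0) S"
  by (induction m) (auto intro!: exI[of _ "\<lambda>_ _. 0"])

text \<open>Regards a function of one variable as one of two variables, so that one Taylor theorem serves
  both the kernels and the right-hand side.\<close>

lemma times_differentiable_on_fst:
  "times_differentiable_on m f S \<Longrightarrow> fst ` S' \<subseteq> S \<Longrightarrow>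
     times_differentiable_on m (\<lambda>p :: real \<times> real. f (fst p)) S'"
proof (induction m arbitrary: f)
  case (Suc m)
  then obtain f' where f': "\<forall>p\<in>S. (f has_derivative f' p) (at p within S)"
    "times_differentiable_on m (\<lambda>p. f' p 1) S" by auto
  have scale: "f' x v = v * f' x 1" if "x \<in> S" for x v
  proof -
    interpret bounded_linear "f' x" using f'(1) that by (blast intro: has_derivative_bounded_linear)
    show ?thesis using scale[of v 1] by simp
  qed
  have "((\<lambda>p. f (fst p)) has_derivative (\<lambda>v. fst v * f' (fst p) 1)) (at p within S')"
    if "p \<in> S'" for p :: "real \<times> real"
  proof -
    have "((\<lambda>p. f (fst p)) has_derivative (\<lambda>v. f' (fst p) (fst v))) (at p within S')"
    proof (rule has_derivative_in_compose2[where g = f and t = S and g' = f' and f = fst and f' = fst])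
      show "(f has_derivative f' x) (at x within S)" if "x \<in> S" for x using f' that by blast
    qed (use that Suc.prems in \<open>auto intro: has_derivative_fst has_derivative_ident\<close>)
    moreover have "f' (fst p) (fst v) = fst v * f' (fst p) 1" for v :: "real \<times> real"
      using scale[of "fst p"] that Suc.prems(2) by blast
    ultimately show ?thesis by simp
  qed
  moreover have "times_differentiable_on m (\<lambda>p. fst b * f' (fst p) 1) S'"
    if b: "b \<in> Basis" for b :: "real \<times> real"
  proof -
    have "b = (1, 0) \<or> b = (0, 1)" using b by (auto simp: Basis_prod_def)
    then show ?thesis
      using Suc.IH[OF f'(2) Suc.prems(2)] by (auto simp: times_differentiable_on_zero)
  qed
  ultimately show ?case
    by (auto intro!: exI[of _ "\<lambda>p v. fst v * f' (fst p) 1"])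
qed simp

text \<open>Taylor's theorem with Peano's remainder. The induction expands the partial derivatives to one
  order less and integrates them along rays; the mean value inequality then turns a remainder
  \<open>\<epsilon> * t ^ m\<close> of the gradient into one of \<open>\<epsilon> * t ^ (m + 1)\<close>. The continuity hypothesis supplies the case
  \<open>m = 0\<close>. For \<open>m = 1\<close> the gradient need not be continuous, and differentiability at the origin is
  used directly.\<close>

lemma taylor_corner:
  assumes "times_differentiable_on m f (corner \<delta>)" "continuous_on (corner \<delta>) f" "\<delta> > 0"
  shows "\<exists>P. bipoly P \<and> (\<forall>\<epsilon>>0. \<exists>\<eta>>0. \<eta> \<le> \<delta> \<and> (\<forall>(t, s)\<in>corner \<eta>. \<bar>f (t, s) - P t s\<bar> \<le> \<epsilon> * t ^ m))"
  using assms
proof (induction m arbitrary: f)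
  case 0
  have 0: "(0, 0) \<in> corner \<delta>" using \<open>\<delta> > 0\<close> by (auto simp: corner_def)
  have "\<exists>\<eta>>0. \<eta> \<le> \<delta> \<and> (\<forall>(t, s)\<in>corner \<eta>. \<bar>f (t, s) - f (0, 0)\<bar> \<le> \<epsilon> * t ^ 0)" if "\<epsilon> > 0" for \<epsilon>
  proof -
    from 0 \<open>continuous_on (corner \<delta>) f\<close> that obtain d where d: "d > 0"
      "\<forall>x\<in>corner \<delta>. dist x (0, 0) < d \<longrightarrow> dist (f x) (f (0, 0)) < \<epsilon>"
      unfolding continuous_on_iff by blast
    have "dist (t, s) (0, 0) \<le> 2 * t" if "0 \<le> s" "s \<le> t" for t s :: real
      using that sqrt_sum_squares_le_sum_abs[of t s] by (simp add: dist_Pair_Pair)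
    then have "\<bar>f (t, s) - f (0, 0)\<bar> \<le> \<epsilon>" if "(t, s) \<in> corner (min (d / 2) \<delta>)" for t s
      using d(2)[rule_format, of "(t, s)"] that by (fastforce simp: corner_def dist_real_def)
    then show ?thesis using d(1) \<open>\<delta> > 0\<close> by (intro exI[of _ "min (d / 2) \<delta>"]) auto
  qed
  then show ?case using bipoly_const[of "f (0, 0)"]
    by (intro exI[of _ "\<lambda>t s. f (0, 0)"] conjI) blast+
next
  case (Suc m)
  obtain f' where f': "\<And>p. p \<in> corner \<delta> \<Longrightarrow> (f has_derivative f' p) (at p within corner \<delta>)"
    "times_differentiable_on m (\<lambda>p. f' p (1, 0)) (corner \<delta>)"
    "times_differentiable_on m (\<lambda>p. f' p (0, 1)) (corner \<delta>)"
    using Suc.prems(1) by (auto simp: Basis_prod_def)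
  have lin: "f' p (t, s) = t * f' p (1, 0) + s * f' p (0, 1)" if "p \<in> corner \<delta>" for p t s
  proof -
    interpret bounded_linear "f' p" using f'(1)[OF that] by (rule has_derivative_bounded_linear)
    have "f' p (t, s) = f' p (t *\<^sub>R (1, 0) + s *\<^sub>R (0, 1))" by simp
    also have "\<dots> = t * f' p (1, 0) + s * f' p (0, 1)" by (simp only: add scale) simp
    finally show ?thesis .
  qed
  have 0: "(0, 0) \<in> corner \<delta>" using \<open>\<delta> > 0\<close> by (auto simp: corner_def)
  show ?case
  proof (cases m)
    case m: 0
    define P where "P t s = f (0, 0) + (f' (0, 0) (1, 0) * t ^ 1 * s ^ 0 + f' (0, 0) (0, 1) * t ^ 0 * s ^ 1)" for t s
    have "bipoly P" unfolding P_def by (intro bipoly.intros bipoly_const)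
    moreover have "\<exists>\<eta>>0. \<eta> \<le> \<delta> \<and> (\<forall>(t, s)\<in>corner \<eta>. \<bar>f (t, s) - P t s\<bar> \<le> \<epsilon> * t ^ Suc m)" if "\<epsilon> > 0" for \<epsilon>
    proof -
      have "\<epsilon> / 2 > 0" using that by simp
      with f'(1)[OF 0] obtain d where d: "d > 0"
        "\<forall>y\<in>corner \<delta>. norm (y - (0, 0)) < d \<longrightarrow>
           norm (f y - f (0, 0) - f' (0, 0) (y - (0, 0))) \<le> \<epsilon> / 2 * norm (y - (0, 0))"
        unfolding has_derivative_within_alt by blast
      have nm: "norm (t, s) \<le> 2 * t" if "0 \<le> s" "s \<le> t" for t s :: real
        using that sqrt_sum_squares_le_sum_abs[of t s] by (simp add: norm_Pair)
      have "\<bar>f (t, s) - P t s\<bar> \<le> \<epsilon> * t" if ts: "(t, s) \<in> corner (min (d / 2) \<delta>)" for t s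
      proof -
        have *: "0 \<le> s" "s \<le> t" "t < d / 2" "t < \<delta>" using ts by (auto simp: corner_def)
        have "\<bar>f (t, s) - f (0, 0) - f' (0, 0) (t, s)\<bar> \<le> \<epsilon> / 2 * norm (t, s)"
          using d(2)[rule_format, of "(t, s)"] * nm[of s t] by (auto simp: corner_def)
        also have "\<dots> \<le> \<epsilon> / 2 * (2 * t)" using nm[of s t] * \<open>\<epsilon> > 0\<close> by (intro mult_left_mono) auto
        finally show ?thesis using lin[OF 0, of t s] by (simp add: P_def algebra_simps)
      qed
      then show ?thesis using d(1) \<open>\<delta> > 0\<close> m by (intro exI[of _ "min (d / 2) \<delta>"]) auto
    qed
    ultimately show ?thesis by blast
  next
    case m: (Suc m')
    have cont: "continuous_on (corner \<delta>) g" if "times_differentiable_on m g (corner \<delta>)" for g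
      unfolding continuous_on_eq_continuous_within
      using that m has_derivative_continuous by auto blast
    from Suc.IH[OF f'(2) cont[OF f'(2)] \<open>\<delta> > 0\<close>] obtain P1 where P1: "bipoly P1"
      "\<forall>\<epsilon>>0. \<exists>\<eta>>0. \<eta> \<le> \<delta> \<and> (\<forall>(t, s)\<in>corner \<eta>. \<bar>f' (t, s) (1, 0) - P1 t s\<bar> \<le> \<epsilon> * t ^ m)"
      by (elim exE conjE) (rule that)
    from Suc.IH[OF f'(3) cont[OF f'(3)] \<open>\<delta> > 0\<close>] obtain P2 where P2: "bipoly P2"
      "\<forall>\<epsilon>>0. \<exists>\<eta>>0. \<eta> \<le> \<delta> \<and> (\<forall>(t, s)\<in>corner \<eta>. \<bar>f' (t, s) (0, 1) - P2 t s\<bar> \<le> \<epsilon> * t ^ m)"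
      by (elim exE conjE) (rule that)
    obtain R1 where R1: "bipoly R1" "\<And>t s \<tau> A. ((\<lambda>\<tau>. \<tau> * R1 (\<tau> * t) (\<tau> * s)) has_real_derivative P1 (\<tau> * t) (\<tau> * s)) (at \<tau> within A)"
      using bipoly_ray_antiderivative[OF P1(1)] by blast
    obtain R2 where R2: "bipoly R2" "\<And>t s \<tau> A. ((\<lambda>\<tau>. \<tau> * R2 (\<tau> * t) (\<tau> * s)) has_real_derivative P2 (\<tau> * t) (\<tau> * s)) (at \<tau> within A)"
      using bipoly_ray_antiderivative[OF P2(1)] by blast
    define P where "P t s = f (0, 0) + (t * R1 t s + s * R2 t s)" for t s
    have "bipoly P" unfolding P_def
      using R1(1) R2(1) by (intro bipoly.add bipoly_const bipoly_mult_fst bipoly_mult_snd)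
    moreover have "\<exists>\<eta>>0. \<eta> \<le> \<delta> \<and> (\<forall>(t, s)\<in>corner \<eta>. \<bar>f (t, s) - P t s\<bar> \<le> \<epsilon> * t ^ Suc m)" if "\<epsilon> > 0" for \<epsilon>
    proof -
      have "\<epsilon> / 2 > 0" using that by simp
      from P1(2)[rule_format, OF this] P2(2)[rule_format, OF this] obtain \<eta>1 \<eta>2 where \<eta>: "\<eta>1 > 0" "\<eta>1 \<le> \<delta>" "\<eta>2 > 0" "\<eta>2 \<le> \<delta>"
        and e1: "\<And>t s. (t, s)\<in>corner \<eta>1 \<Longrightarrow> \<bar>f' (t, s) (1, 0) - P1 t s\<bar> \<le> \<epsilon> / 2 * t ^ m"
        and e2: "\<And>t s. (t, s)\<in>corner \<eta>2 \<Longrightarrow> \<bar>f' (t, s) (0, 1) - P2 t s\<bar> \<le> \<epsilon> / 2 * t ^ m"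
        by blast
      define \<eta> where "\<eta> = min \<eta>1 \<eta>2"
      have "\<bar>f (t, s) - P t s\<bar> \<le> \<epsilon> * t ^ Suc m" if ts: "(t, s) \<in> corner \<eta>" for t s
      proof -
        have *: "0 \<le> s" "s \<le> t" "t < \<eta>1" "t < \<eta>2" "t < \<delta>" using ts \<eta> by (auto simp: corner_def \<eta>_def)
        have ray: "(\<tau> * t, \<tau> * s) \<in> corner x" if "\<tau> \<in> {0..1}" "t < x" for \<tau> x
        proof -
          have "\<tau> * t \<le> t" using that * by (simp add: mult_left_le_one_le)
          then show ?thesis using that * by (auto simp: corner_def intro: mult_left_mono)
        qed
        \<comment> \<open>The error along the ray through \<open>(t, s)\<close>; its derivative collects the errors of the two partial derivatives.\<close>
        define \<phi> where "\<phi> \<tau> = f (\<tau> * t, \<tau> * s) - (t * (\<tau> * R1 (\<tau> * t) (\<tau> * s)) + s * (\<tau> * R2 (\<tau> * t) (\<tau> * s)))" for \<tau>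
        define \<phi>' where "\<phi>' \<tau> = t * (f' (\<tau> * t, \<tau> * s) (1, 0) - P1 (\<tau> * t) (\<tau> * s))
            + s * (f' (\<tau> * t, \<tau> * s) (0, 1) - P2 (\<tau> * t) (\<tau> * s))" for \<tau>
        have der: "(\<phi> has_real_derivative \<phi>' \<tau>) (at \<tau> within {0..1})" if \<tau>: "\<tau> \<in> {0..1}" for \<tau>
        proof -
          have "((\<lambda>\<tau>. f (\<tau> * t, \<tau> * s)) has_derivative (\<lambda>v. f' (\<tau> * t, \<tau> * s) (v * t, v * s))) (at \<tau> within {0..1})"
          proof (rule has_derivative_in_compose2[where g = f and t = "corner \<delta>" and g' = f'])
            show "(f has_derivative f' x) (at x within corner \<delta>)" if "x \<in> corner \<delta>" for x
              using f'(1)[OF that] .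
            show "((\<lambda>\<tau>. (\<tau> * t, \<tau> * s)) has_derivative (\<lambda>v. (v * t, v * s))) (at \<tau> within {0..1})"
              by (auto intro!: derivative_eq_intros)
          qed (use ray * \<tau> in auto)
          moreover have "f' (\<tau> * t, \<tau> * s) (v * t, v * s)
              = v * (t * f' (\<tau> * t, \<tau> * s) (1, 0) + s * f' (\<tau> * t, \<tau> * s) (0, 1))" for v
            using lin[OF ray[OF \<tau> *(5)], of "v * t" "v * s"] by (simp add: algebra_simps)
          ultimately have "((\<lambda>\<tau>. f (\<tau> * t, \<tau> * s)) has_real_derivative
              t * f' (\<tau> * t, \<tau> * s) (1, 0) + s * f' (\<tau> * t, \<tau> * s) (0, 1)) (at \<tau> within {0..1})"
            unfolding has_field_derivative_def
            by (elim has_derivative_eq_rhs) (simp add: fun_eq_iff mult.commute)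
          from DERIV_diff[OF this DERIV_add[OF DERIV_cmult[OF R1(2)] DERIV_cmult[OF R2(2)]]]
          show ?thesis
            unfolding \<phi>_def[abs_def] \<phi>'_def by (rule DERIV_cong) (simp add: algebra_simps)
        qed
        have bd: "norm (\<phi>' \<tau>) \<le> \<epsilon> * t ^ Suc m" if \<tau>: "\<tau> \<in> {0..1}" for \<tau>
        proof -
          have tt: "(\<tau> * t) ^ m \<le> t ^ m"
            using \<tau> * by (intro power_mono) (auto simp: mult_left_le_one_le)
          have "\<bar>f' (\<tau> * t, \<tau> * s) (1, 0) - P1 (\<tau> * t) (\<tau> * s)\<bar> \<le> \<epsilon> / 2 * t ^ m"
            using e1[OF ray[OF \<tau> *(3)]] mult_left_mono[OF tt, of "\<epsilon> / 2"] \<open>\<epsilon> > 0\<close> by linarith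
          then have 1: "\<bar>t * (f' (\<tau> * t, \<tau> * s) (1, 0) - P1 (\<tau> * t) (\<tau> * s))\<bar> \<le> t * (\<epsilon> / 2 * t ^ m)"
            using * unfolding abs_mult by (intro mult_mono) auto
          have "\<bar>f' (\<tau> * t, \<tau> * s) (0, 1) - P2 (\<tau> * t) (\<tau> * s)\<bar> \<le> \<epsilon> / 2 * t ^ m"
            using e2[OF ray[OF \<tau> *(4)]] mult_left_mono[OF tt, of "\<epsilon> / 2"] \<open>\<epsilon> > 0\<close> by linarith
          then have 2: "\<bar>s * (f' (\<tau> * t, \<tau> * s) (0, 1) - P2 (\<tau> * t) (\<tau> * s))\<bar> \<le> t * (\<epsilon> / 2 * t ^ m)"
            using * unfolding abs_mult by (intro mult_mono) auto
          show ?thesis using 1 2 unfolding \<phi>'_def real_norm_def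
            by (intro order_trans[OF abs_triangle_ineq]) (simp add: field_simps)
        qed
        have "norm (\<phi> 1 - \<phi> 0) \<le> \<epsilon> * t ^ Suc m * norm (1 - 0 :: real)"
          by (rule field_differentiable_bound[of "{0..1}" \<phi> \<phi>']) (use der bd in auto)
        then show ?thesis by (simp add: \<phi>_def P_def algebra_simps)
      qed
      then show ?thesis using \<eta> by (intro exI[of _ \<eta>]) (auto simp: \<eta>_def)
    qed
    ultimately show ?thesis by blast
  qed
qed

section \<open>Integral operators with moving limits\<close>

definition kernel_int :: "real \<Rightarrow> (real \<Rightarrow> real \<Rightarrow> real) \<Rightarrow> (real \<Rightarrow> real) \<Rightarrow> real \<Rightarrow> real" where
  "kernel_int \<beta> k \<phi> t = integral {0..\<beta> * t} (\<lambda>s. k t s * \<phi> s)"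

text \<open>Leibniz' formula for the derivative of \<open>kernel_int\<close> in \<open>t\<close>.\<close>

definition kernel_deriv :: "real \<Rightarrow> (real \<Rightarrow> real \<Rightarrow> real) \<Rightarrow> (real \<Rightarrow> real \<Rightarrow> real) \<Rightarrow>
    (real \<Rightarrow> real) \<Rightarrow> real \<Rightarrow> real" where
  "kernel_deriv \<beta> k k' \<phi> t = \<beta> * k t (\<beta> * t) * \<phi> (\<beta> * t) + kernel_int \<beta> k' \<phi> t"

lemma compact_triangle: "compact (triangle T)"
proof -
  have "triangle T = cbox (0, 0) (T, T) \<inter> {p. snd p \<le> fst p}"
    by (auto simp: triangle_def cbox_def Basis_prod_def)
  moreover have "closed {p :: real \<times> real. snd p \<le> fst p}"
    by (intro closed_Collect_le continuous_intros)
  ultimately show ?thesis by (simp add: compact_Int_closed)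
qed

lemma continuous_on_kernel_compose:
  fixes k :: "real \<Rightarrow> real \<Rightarrow> real"
  assumes "continuous_on (triangle T) (\<lambda>(t, s). k t s)" "continuous_on A x" "continuous_on A y"
    "\<And>a. a \<in> A \<Longrightarrow> (x a, y a) \<in> triangle T"
  shows "continuous_on A (\<lambda>a. k (x a) (y a))"
  using continuous_on_compose2[OF assms(1), of A "\<lambda>a. (x a, y a)"] assms(2-4)
  by (auto intro: continuous_on_Pair)

lemma kernel_bounded:
  fixes k :: "real \<Rightarrow> real \<Rightarrow> real"
  assumes "continuous_on (triangle T) (\<lambda>(t, s). k t s)"
  obtains C where "C \<ge> 0" "\<And>t s. (t, s) \<in> triangle T \<Longrightarrow> \<bar>k t s\<bar> \<le> C"
proof -
  have "bounded ((\<lambda>(t, s). k t s) ` triangle T)"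
    by (rule compact_imp_bounded[OF compact_continuous_image[OF assms compact_triangle]])
  then obtain C where "\<forall>x\<in>(\<lambda>(t, s). k t s) ` triangle T. norm x \<le> C"
    by (auto simp: bounded_iff)
  then have "\<bar>k t s\<bar> \<le> max C 0" if "(t, s) \<in> triangle T" for t s
    using that by (force intro: order_trans[OF _ max.cobounded1])
  then show ?thesis using that[of "max C 0"] by simp
qed

lemma kernel_slice_absolutely_integrable:
  fixes \<phi> :: "real \<Rightarrow> real"
  assumes "continuous_on (triangle T) (\<lambda>(t, s). k t s)" "\<phi> absolutely_integrable_on {0..T}"
    "0 \<le> t" "t \<le> T" "0 \<le> a" "b \<le> t"
  shows "(\<lambda>s. k t s * \<phi> s) absolutely_integrable_on {a..b}"
proof -
  have "\<phi> absolutely_integrable_on {a..b}"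
    using assms by (intro absolutely_integrable_on_subinterval[OF assms(2)]) auto
  moreover have c: "continuous_on {a..b} (k t)"
    using assms by (intro continuous_on_kernel_compose[OF assms(1)] continuous_intros) (auto simp: triangle_def)
  ultimately show ?thesis
    using compact_imp_bounded[OF compact_continuous_image[OF c]]
    by (intro absolutely_integrable_bounded_measurable_product_real
        continuous_imp_measurable_on_sets_lebesgue) auto
qed

lemmas kernel_slice_integrable =
  set_lebesgue_integral_eq_integral(1)[OF kernel_slice_absolutely_integrable]

text \<open>The continuity of this function of \<open>x\<close> replaces boundedness of \<open>\<phi>\<close>, which fails at
  \<open>0\<close> for powers of the logarithm.\<close>

definition abs_mass :: "(real \<Rightarrow> real) \<Rightarrow> real \<Rightarrow> real" where
  "abs_mass \<phi> x = integral {0..x} (\<lambda>s. \<bar>\<phi> s\<bar>)"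

lemma abs_integrable_subinterval:
  assumes "\<phi> absolutely_integrable_on {0..T}" "0 \<le> a" "b \<le> (T :: real)"
  shows "(\<lambda>s. \<bar>\<phi> s :: real\<bar>) integrable_on {a..b}"
  using absolutely_integrable_on_subinterval[OF assms(1), of a b] assms
  by (auto simp: absolutely_integrable_on_def)

lemma abs_mass_diff:
  assumes "\<phi> absolutely_integrable_on {0..T}" "0 \<le> a" "a \<le> b" "b \<le> T"
  shows "integral {a..b} (\<lambda>s. \<bar>\<phi> s\<bar>) = abs_mass \<phi> b - abs_mass \<phi> a"
  using Henstock_Kurzweil_Integration.integral_combine[of 0 a b "\<lambda>s. \<bar>\<phi> s\<bar>"]
    abs_integrable_subinterval[OF assms(1), of 0 b] assms by (simp add: abs_mass_def)

lemma abs_mass_mono: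
  assumes "\<phi> absolutely_integrable_on {0..T}" "0 \<le> a" "a \<le> b" "b \<le> T"
  shows "abs_mass \<phi> a \<le> abs_mass \<phi> b"
  using abs_mass_diff[OF assms] integral_nonneg[OF abs_integrable_subinterval[OF assms(1,2,4)]] by simp

lemma abs_mass_continuous:
  assumes "\<phi> absolutely_integrable_on {0..T}"
  shows "continuous_on {0..T} (abs_mass \<phi>)"
  unfolding abs_mass_def[abs_def]
  by (rule indefinite_integral_continuous_1) (use abs_integrable_subinterval[OF assms, of 0 T] in simp)

lemma integral_product_bound:
  assumes "\<phi> absolutely_integrable_on {0..T}" "0 \<le> a" "a \<le> b" "b \<le> T"
    and "(\<lambda>s. h s * \<phi> s) integrable_on {a..b}" "\<And>s. s \<in> {a..b} \<Longrightarrow> \<bar>h s\<bar> \<le> c"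
  shows "\<bar>integral {a..b} (\<lambda>s. h s * \<phi> s)\<bar> \<le> c * (abs_mass \<phi> b - abs_mass \<phi> a)"
proof -
  have "norm (integral {a..b} (\<lambda>s. h s * \<phi> s)) \<le> integral {a..b} (\<lambda>s. c * \<bar>\<phi> s\<bar>)"
    using integrable_on_mult_right[OF abs_integrable_subinterval[OF assms(1,2,4)], of c] assms(5,6)
    by (intro integral_norm_bound_integral) (auto simp: abs_mult mult_right_mono)
  then show ?thesis using abs_mass_diff[OF assms(1-4)] by simp
qed

text \<open>Separates the increment caused by the kernel from the one caused by the moving end point.\<close>

lemma kernel_int_increment:
  assumes k: "continuous_on (triangle T) (\<lambda>(t, s). k t s)" and \<phi>: "\<phi> absolutely_integrable_on {0..T}"
    and \<beta>: "0 \<le> \<beta>" "\<beta> \<le> 1" and ab: "0 \<le> a" "a \<le> b" "b \<le> T"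
  shows "kernel_int \<beta> k \<phi> b - kernel_int \<beta> k \<phi> a
    = integral {0..\<beta> * a} (\<lambda>s. (k b s - k a s) * \<phi> s) + integral {\<beta> * a..\<beta> * b} (\<lambda>s. k b s * \<phi> s)"
proof -
  have le: "\<beta> * a \<le> a" "\<beta> * b \<le> b" "0 \<le> \<beta> * a" "\<beta> * a \<le> \<beta> * b"
    using \<beta> ab by (auto simp: mult_left_le_one_le mult_left_mono)
  have "integral {0..\<beta> * a} (\<lambda>s. k b s * \<phi> s) + integral {\<beta> * a..\<beta> * b} (\<lambda>s. k b s * \<phi> s) = kernel_int \<beta> k \<phi> b"
    unfolding kernel_int_def using le ab
    by (intro Henstock_Kurzweil_Integration.integral_combine kernel_slice_integrable[OF k \<phi>]) auto
  moreover have "integral {0..\<beta> * a} (\<lambda>s. (k b s - k a s) * \<phi> s)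
      = integral {0..\<beta> * a} (\<lambda>s. k b s * \<phi> s) - kernel_int \<beta> k \<phi> a"
    unfolding kernel_int_def left_diff_distrib using le ab
    by (intro Henstock_Kurzweil_Integration.integral_diff kernel_slice_integrable[OF k \<phi>]) auto
  ultimately show ?thesis by simp
qed

lemma kernel_uniformly_continuous:
  fixes k :: "real \<Rightarrow> real \<Rightarrow> real"
  assumes "continuous_on (triangle T) (\<lambda>(t, s). k t s)" "e > 0"
  obtains d where "d > 0" "\<And>t t' s. (t, s) \<in> triangle T \<Longrightarrow> (t', s) \<in> triangle T \<Longrightarrow> \<bar>t - t'\<bar> < d \<Longrightarrow>
    \<bar>k t s - k t' s\<bar> < e"
proof -
  have "uniformly_continuous_on (triangle T) (\<lambda>(t, s). k t s)"
    by (rule compact_uniformly_continuous[OF assms(1) compact_triangle])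
  then obtain d where d: "d > 0" "\<forall>x\<in>triangle T. \<forall>x'\<in>triangle T. dist x' x < d \<longrightarrow>
      dist ((\<lambda>(t, s). k t s) x') ((\<lambda>(t, s). k t s) x) < e"
    using assms(2) unfolding uniformly_continuous_on_def by metis
  have "\<bar>k t s - k t' s\<bar> < e" if "(t, s) \<in> triangle T" "(t', s) \<in> triangle T" "\<bar>t - t'\<bar> < d" for t t' s
    using d(2)[rule_format, of "(t', s)" "(t, s)"] that by (simp add: dist_Pair_Pair dist_real_def)
  then show ?thesis using that d(1) by blast
qed

text \<open>In the increment, the change of the kernel is controlled by its uniform continuity and the new
  piece of the integral by the continuity of \<open>abs_mass\<close>.\<close>

lemma kernel_int_continuous:
  assumes k: "continuous_on (triangle T) (\<lambda>(t, s). k t s)" and \<phi>: "\<phi> absolutely_integrable_on {0..T}"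
    and \<beta>: "0 \<le> \<beta>" "\<beta> \<le> 1"
  shows "continuous_on {0..T} (kernel_int \<beta> k \<phi>)"
proof -
  obtain C where C: "C \<ge> 0" "\<And>t s. (t, s) \<in> triangle T \<Longrightarrow> \<bar>k t s\<bar> \<le> C"
    using kernel_bounded[OF k] by blast
  have step: "\<bar>kernel_int \<beta> k \<phi> b - kernel_int \<beta> k \<phi> a\<bar>
      \<le> e * abs_mass \<phi> T + C * (abs_mass \<phi> (\<beta> * b) - abs_mass \<phi> (\<beta> * a))"
    if ab: "0 \<le> a" "a \<le> b" "b \<le> T" and e: "\<And>s. s \<in> {0..a} \<Longrightarrow> \<bar>k b s - k a s\<bar> \<le> e" for a b e
  proof -
    have le: "\<beta> * a \<le> a" "\<beta> * b \<le> b" "0 \<le> \<beta> * a" "\<beta> * a \<le> \<beta> * b"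
      using \<beta> ab by (auto simp: mult_left_le_one_le mult_left_mono)
    have e0: "e \<ge> 0" using e[of 0] ab by auto
    have "\<bar>integral {0..\<beta> * a} (\<lambda>s. (k b s - k a s) * \<phi> s)\<bar> \<le> e * (abs_mass \<phi> (\<beta> * a) - abs_mass \<phi> 0)"
      using le ab e by (intro integral_product_bound[OF \<phi>])
        (auto simp: left_diff_distrib intro!: integrable_diff kernel_slice_integrable[OF k \<phi>])
    also have "\<dots> \<le> e * abs_mass \<phi> T"
      using e0 le ab abs_mass_mono[OF \<phi>, of "\<beta> * a" T] by (intro mult_left_mono) (auto simp: abs_mass_def)
    finally have 1: "\<bar>integral {0..\<beta> * a} (\<lambda>s. (k b s - k a s) * \<phi> s)\<bar> \<le> e * abs_mass \<phi> T" .
    have "\<bar>integral {\<beta> * a..\<beta> * b} (\<lambda>s. k b s * \<phi> s)\<bar> \<le> C * (abs_mass \<phi> (\<beta> * b) - abs_mass \<phi> (\<beta> * a))"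
      using le ab by (intro integral_product_bound[OF \<phi>] kernel_slice_integrable[OF k \<phi>] C)
        (auto simp: triangle_def)
    then show ?thesis using 1 kernel_int_increment[OF k \<phi> \<beta> ab] by linarith
  qed
  show ?thesis
    unfolding continuous_on_iff
  proof (intro ballI allI impI)
    fix x \<epsilon> :: real assume x: "x \<in> {0..T}" and \<epsilon>: "\<epsilon> > 0"
    have m0: "abs_mass \<phi> T \<ge> 0" using abs_mass_mono[OF \<phi>, of 0 T] x by (simp add: abs_mass_def)
    define e1 where "e1 = \<epsilon> / (2 * (abs_mass \<phi> T + 1))"
    have e1: "e1 > 0" "e1 * abs_mass \<phi> T \<le> \<epsilon> / 2"
      using \<epsilon> m0 by (auto simp: e1_def field_simps)
    obtain d1 where d1: "d1 > 0" "\<And>t t' s. (t, s) \<in> triangle T \<Longrightarrow> (t', s) \<in> triangle T \<Longrightarrow> \<bar>t - t'\<bar> < d1 \<Longrightarrow>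
        \<bar>k t s - k t' s\<bar> < e1" using kernel_uniformly_continuous[OF k e1(1)] by metis
    have "continuous_on {0..T} (\<lambda>t. abs_mass \<phi> (\<beta> * t))"
      using \<beta> by (intro continuous_on_compose2[OF abs_mass_continuous[OF \<phi>]] continuous_intros)
        (auto intro: mult_left_le_one_le[THEN order_trans])
    moreover have "\<epsilon> / (2 * (C + 1)) > 0" using C \<epsilon> by simp
    ultimately obtain d2 where d2: "d2 > 0" "\<And>y. y \<in> {0..T} \<Longrightarrow> dist y x < d2 \<Longrightarrow>
        dist (abs_mass \<phi> (\<beta> * y)) (abs_mass \<phi> (\<beta> * x)) < \<epsilon> / (2 * (C + 1))"
      using x unfolding continuous_on_iff by blast
    have "dist (kernel_int \<beta> k \<phi> y) (kernel_int \<beta> k \<phi> x) < \<epsilon>" if y: "y \<in> {0..T}" "dist y x < min d1 d2" for y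
    proof -
      define a b where "a = min x y" and "b = max x y"
      have ab: "0 \<le> a" "a \<le> b" "b \<le> T" using x y by (auto simp: a_def b_def)
      have "\<bar>k b s - k a s\<bar> \<le> e1" if "s \<in> {0..a}" for s
        using y that x by (intro less_imp_le d1) (auto simp: triangle_def a_def b_def dist_real_def)
      from step[OF ab this] have "\<bar>kernel_int \<beta> k \<phi> b - kernel_int \<beta> k \<phi> a\<bar>
          \<le> \<epsilon> / 2 + C * (abs_mass \<phi> (\<beta> * b) - abs_mass \<phi> (\<beta> * a))" using e1 by simp
      also have "C * (abs_mass \<phi> (\<beta> * b) - abs_mass \<phi> (\<beta> * a)) \<le> C * (\<epsilon> / (2 * (C + 1)))"
      proof (rule mult_left_mono[OF _ C(1)])
        have "\<bar>abs_mass \<phi> (\<beta> * y) - abs_mass \<phi> (\<beta> * x)\<bar> \<le> \<epsilon> / (2 * (C + 1))"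
          using d2(2)[of y] y by (simp add: dist_real_def)
        then show "abs_mass \<phi> (\<beta> * b) - abs_mass \<phi> (\<beta> * a) \<le> \<epsilon> / (2 * (C + 1))"
          by (cases "x \<le> y") (auto simp: a_def b_def abs_le_iff)
      qed
      also have "\<epsilon> / 2 + C * (\<epsilon> / (2 * (C + 1))) < \<epsilon>" using C \<epsilon> by (simp add: field_simps)
      finally show ?thesis
        by (cases "x \<le> y") (auto simp: a_def b_def dist_real_def abs_minus_commute)
    qed
    then show "\<exists>d>0. \<forall>y\<in>{0..T}. dist y x < d \<longrightarrow> dist (kernel_int \<beta> k \<phi> y) (kernel_int \<beta> k \<phi> x) < \<epsilon>"
      using d1(1) d2(1) by (intro exI[of _ "min d1 d2"]) auto
  qed
qed

lemma kernel_mean_value: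
  assumes "C1_in_t T k k'" "0 \<le> s" "s \<le> a" "a < b" "b \<le> T"
  obtains \<xi> where "a < \<xi>" "\<xi> < b" "k b s - k a s = (b - a) * k' \<xi> s"
proof -
  have d: "((\<lambda>\<tau>. k \<tau> s) has_real_derivative k' t s) (at t within {s..T})" if "t \<in> {a..b}" for t
    using assms that by (auto simp: C1_in_t_def triangle_def)
  have "continuous_on {a..b} (\<lambda>\<tau>. k \<tau> s)"
    using d assms
    by (intro DERIV_continuous_on[of _ _ "\<lambda>t. k' t s"] DERIV_subset[where t = "{a..b}" and s = "{s..T}"]) auto
  moreover have "((\<lambda>\<tau>. k \<tau> s) has_derivative (\<lambda>v. k' t s * v)) (at t)" if "a < t" "t < b" for t
  proof -
    have "t \<in> interior {s..T}" using that assms by auto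
    from at_within_interior[OF this] show ?thesis
      using d[of t] that unfolding has_field_derivative_def by auto
  qed
  ultimately obtain \<xi> where "a < \<xi>" "\<xi> < b" "k b s - k a s = k' \<xi> s * (b - a)"
    using mvt[OF \<open>a < b\<close>, of "\<lambda>\<tau>. k \<tau> s" "\<lambda>t v. k' t s * v"] by blast
  then show ?thesis by (intro that[of \<xi>]) (simp_all add: mult.commute)
qed

text \<open>Leibniz' rule with a density that may be unbounded at \<open>0\<close>. The difference quotient over an interval \<open>[a, b]\<close> with \<open>t0\<close> as one
  end is split into the mean value of \<open>k'\<close> minus \<open>k' t0\<close> (small by uniform continuity of \<open>k'\<close>), the
  missing piece of the integral of \<open>k' t0\<close> (small since \<open>abs_mass\<close> is continuous), and the
  average over the moving end, where \<open>\<phi>\<close> is continuous.\<close>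

lemma kernel_int_has_derivative:
  assumes C1: "C1_in_t T k k'" and \<phi>: "\<phi> absolutely_integrable_on {0..T}" "continuous_on {0<..T} \<phi>"
    and \<beta>: "0 \<le> \<beta>" "\<beta> \<le> 1" and t0: "0 < t0" "t0 \<le> T"
  shows "(kernel_int \<beta> k \<phi> has_real_derivative kernel_deriv \<beta> k k' \<phi> t0) (at t0 within {0..T})"
proof (cases "\<beta> = 0")
  \<comment> \<open>Here \<open>\<phi>\<close> is evaluated at the singularity \<open>0\<close>, but with the factor \<open>\<beta> = 0\<close>.\<close>
  case True
  then show ?thesis by (simp add: kernel_int_def[abs_def] kernel_deriv_def)
next
  case False
  then have \<beta>0: "\<beta> > 0" using \<beta> by simp
  have k: "continuous_on (triangle T) (\<lambda>(t, s). k t s)" and k': "continuous_on (triangle T) (\<lambda>(t, s). k' t s)"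
    using C1 by (auto simp: C1_in_t_def)
  obtain C where C: "C \<ge> 0" "\<And>t s. (t, s) \<in> triangle T \<Longrightarrow> \<bar>k' t s\<bar> \<le> C"
    using kernel_bounded[OF k'] by blast
  define L where "L = k t0 (\<beta> * t0) * \<phi> (\<beta> * t0)"
  define D where "D = kernel_deriv \<beta> k k' \<phi> t0"
  have m0: "abs_mass \<phi> T \<ge> 0" using abs_mass_mono[OF \<phi>(1), of 0 T] t0 by (simp add: abs_mass_def)
  have \<beta>t0: "0 < \<beta> * t0" "\<beta> * t0 \<le> t0" using \<beta> \<beta>0 t0 by (auto simp: mult_left_le_one_le)
  have "\<exists>d>0. \<forall>y\<in>{0..T}. norm (y - t0) < d \<longrightarrow>
      norm (kernel_int \<beta> k \<phi> y - kernel_int \<beta> k \<phi> t0 - D * (y - t0)) \<le> \<epsilon> * norm (y - t0)" if \<epsilon>: "\<epsilon> > 0" for \<epsilon>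
  proof -
    \<comment> \<open>A third of \<open>\<epsilon>\<close> for each part; the summand \<open>1\<close> covers the case that \<open>\<phi>\<close> has mass zero.\<close>
    define e1 where "e1 = \<epsilon> / (3 * (abs_mass \<phi> T + 1))"
    have e1: "e1 > 0" "e1 * abs_mass \<phi> T \<le> \<epsilon> / 3"
      using \<epsilon> m0 by (auto simp: e1_def field_simps)
    obtain d1 where d1: "d1 > 0" "\<And>t t' s. (t, s) \<in> triangle T \<Longrightarrow> (t', s) \<in> triangle T \<Longrightarrow> \<bar>t - t'\<bar> < d1 \<Longrightarrow>
        \<bar>k' t s - k' t' s\<bar> < e1" using kernel_uniformly_continuous[OF k' e1(1)] by metis
    have "continuous_on {0..T} (\<lambda>t. abs_mass \<phi> (\<beta> * t))"
      using \<beta> by (intro continuous_on_compose2[OF abs_mass_continuous[OF \<phi>(1)]] continuous_intros)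
        (auto intro: mult_left_le_one_le[THEN order_trans])
    moreover have "\<epsilon> / (3 * (C + 1)) > 0" using C \<epsilon> by simp
    ultimately obtain d2 where d2: "d2 > 0" "\<And>y. y \<in> {0..T} \<Longrightarrow> dist y t0 < d2 \<Longrightarrow>
        dist (abs_mass \<phi> (\<beta> * y)) (abs_mass \<phi> (\<beta> * t0)) < \<epsilon> / (3 * (C + 1))"
      using t0 unfolding continuous_on_iff by (metis atLeastAtMost_iff less_imp_le)
    have "continuous_on (triangle T \<inter> {p. 0 < snd p}) (\<lambda>p. k (fst p) (snd p) * \<phi> (snd p))"
      by (intro continuous_intros continuous_on_compose2[OF \<phi>(2)] continuous_on_kernel_compose[OF k])
        (auto simp: triangle_def)
    moreover have "(t0, \<beta> * t0) \<in> triangle T \<inter> {p. 0 < snd p}" using \<beta>t0 t0 by (auto simp: triangle_def)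
    moreover have "\<epsilon> / 3 > 0" using \<epsilon> by simp
    ultimately obtain d3 where d3: "d3 > 0" "\<And>p. p \<in> triangle T \<inter> {p. 0 < snd p} \<Longrightarrow> dist p (t0, \<beta> * t0) < d3 \<Longrightarrow>
        dist (k (fst p) (snd p) * \<phi> (snd p)) L < \<epsilon> / 3"
      unfolding continuous_on_iff L_def by (metis fst_conv snd_conv)
    define d where "d = Min {d1, d2, d3 / 2, t0}"
    have d: "d > 0" "d \<le> d1" "d \<le> d2" "d \<le> d3 / 2" "d \<le> t0"
      using d1 d2 d3 t0 by (auto simp: d_def)
    have main: "\<bar>kernel_int \<beta> k \<phi> b - kernel_int \<beta> k \<phi> a - (b - a) * D\<bar> \<le> \<epsilon> * (b - a)"
      if ab: "0 < a" "a < b" "b \<le> T" "a \<le> t0" "t0 \<le> b" "t0 - a < d" "b - t0 < d" for a b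
    proof -
      have le: "\<beta> * a \<le> a" "\<beta> * b \<le> b" "0 < \<beta> * a" "\<beta> * a \<le> \<beta> * b" "\<beta> * a \<le> \<beta> * t0" "\<beta> * t0 \<le> \<beta> * b"
        using \<beta> \<beta>0 ab by (auto simp: mult_left_le_one_le mult_left_mono)
      have ab': "\<beta> * a \<le> b" "\<beta> * a \<le> T" "\<beta> * b \<le> T" "\<beta> * t0 \<le> T"
        and sb: "\<And>s. s \<le> \<beta> * b \<Longrightarrow> s \<le> b" "\<And>s. s \<le> \<beta> * t0 \<Longrightarrow> s \<le> t0"
        using le(1,2) ab \<beta>t0 t0 by linarith+
      \<comment> \<open>The three parts of the increment: the variation of \<open>k\<close>, the missing piece of the integral of \<open>k' t0\<close>, and the moving end.\<close>
      define I1 where "I1 = integral {0..\<beta> * a} (\<lambda>s. (k b s - k a s - (b - a) * k' t0 s) * \<phi> s)"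
      define I2 where "I2 = integral {\<beta> * a..\<beta> * t0} (\<lambda>s. k' t0 s * \<phi> s)"
      define I3 where "I3 = integral {\<beta> * a..\<beta> * b} (\<lambda>s. k b s * \<phi> s - L)"
      have i1: "(\<lambda>s. (k b s - k a s) * \<phi> s) integrable_on {0..\<beta> * a}"
        unfolding left_diff_distrib using le ab ab'
        by (intro integrable_diff kernel_slice_integrable[OF k \<phi>(1)]) auto
      have i2: "(\<lambda>s. k' t0 s * \<phi> s) integrable_on {x..y}" if "0 \<le> x" "y \<le> t0" for x y
        using that t0 by (intro kernel_slice_integrable[OF k' \<phi>(1)]) auto
      have i2': "(\<lambda>s. (b - a) * (k' t0 s * \<phi> s)) integrable_on {0..\<beta> * a}"
        using integrable_on_mult_right[OF i2[of 0 "\<beta> * a"], of "b - a"] le ab by simp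
      have i3: "(\<lambda>s. k b s * \<phi> s) integrable_on {\<beta> * a..\<beta> * b}"
        using le ab by (intro kernel_slice_integrable[OF k \<phi>(1)]) auto
      have "\<bar>I1\<bar> \<le> ((b - a) * e1) * (abs_mass \<phi> (\<beta> * a) - abs_mass \<phi> 0)"
        unfolding I1_def
      proof (rule integral_product_bound[OF \<phi>(1)])
        show "(\<lambda>s. (k b s - k a s - (b - a) * k' t0 s) * \<phi> s) integrable_on {0..\<beta> * a}"
          using integrable_diff[OF i1 i2'] by (simp add: algebra_simps)
        fix s assume s: "s \<in> {0..\<beta> * a}"
        have sa: "0 \<le> s" "s \<le> a" using s le(1) by auto
        obtain \<xi> where \<xi>: "a < \<xi>" "\<xi> < b" "k b s - k a s = (b - a) * k' \<xi> s"
          using kernel_mean_value[OF C1 sa _ ab(3)] ab by blast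
        have "\<bar>k' \<xi> s - k' t0 s\<bar> < e1"
          using \<xi> sa ab d by (intro d1) (auto simp: triangle_def abs_if)
        moreover have "\<bar>k b s - k a s - (b - a) * k' t0 s\<bar> = (b - a) * \<bar>k' \<xi> s - k' t0 s\<bar>"
          using \<xi>(3) ab by (simp add: abs_mult right_diff_distrib[symmetric])
        ultimately show "\<bar>k b s - k a s - (b - a) * k' t0 s\<bar> \<le> (b - a) * e1"
          using ab by simp
      qed (use le ab ab' in auto)
      also have "\<dots> \<le> ((b - a) * e1) * abs_mass \<phi> T"
        using e1 le ab ab' abs_mass_mono[OF \<phi>(1), of "\<beta> * a" T]
        by (intro mult_left_mono) (auto simp: abs_mass_def)
      also have "\<dots> = (b - a) * (e1 * abs_mass \<phi> T)" by simp
      also have "\<dots> \<le> (b - a) * (\<epsilon> / 3)" using ab by (intro mult_left_mono e1) auto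
      finally have I1: "\<bar>I1\<bar> \<le> (b - a) * (\<epsilon> / 3)" .
      have "\<bar>I2\<bar> \<le> C * (abs_mass \<phi> (\<beta> * t0) - abs_mass \<phi> (\<beta> * a))"
        unfolding I2_def
      proof (rule integral_product_bound[OF \<phi>(1)])
        show "\<bar>k' t0 s\<bar> \<le> C" if "s \<in> {\<beta> * a..\<beta> * t0}" for s
          using that le(3) sb(2)[of s] t0 by (intro C) (simp add: triangle_def)
      qed (use le ab ab' \<beta>t0 in \<open>auto intro: i2\<close>)
      also have "\<dots> \<le> C * (\<epsilon> / (3 * (C + 1)))"
        using C d2(2)[of a] ab d by (intro mult_left_mono) (auto simp: dist_real_def)
      also have "\<dots> \<le> \<epsilon> / 3" using C \<epsilon> by (simp add: field_simps)
      finally have I2: "\<bar>(b - a) * I2\<bar> \<le> (b - a) * (\<epsilon> / 3)"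
        using ab by (simp add: abs_mult)
      have "norm I3 \<le> \<epsilon> / 3 * (\<beta> * b - \<beta> * a)"
      proof -
        have "\<bar>k b s * \<phi> s - L\<bar> \<le> \<epsilon> / 3" if s: "s \<in> {\<beta> * a..\<beta> * b}" for s
        proof -
          have "\<beta> * t0 - \<beta> * a \<le> t0 - a" "\<beta> * b - \<beta> * t0 \<le> b - t0"
            using \<beta> ab by (auto simp: right_diff_distrib[symmetric] mult_left_le_one_le)
          then have "\<bar>s - \<beta> * t0\<bar> < d" using s ab by auto
          moreover have "\<bar>b - t0\<bar> < d" using ab by auto
          ultimately have "dist (b, s) (t0, \<beta> * t0) < d3"
            using d(4) sqrt_sum_squares_le_sum_abs[of "b - t0" "s - \<beta> * t0"]
            by (simp add: dist_Pair_Pair dist_real_def)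
          then show ?thesis using d3(2)[of "(b, s)"] s le ab sb by (auto simp: triangle_def dist_real_def)
        qed
        then have "norm I3 \<le> integral {\<beta> * a..\<beta> * b} (\<lambda>s. \<epsilon> / 3)"
          unfolding I3_def using i3 by (intro integral_norm_bound_integral integrable_diff) auto
        then show ?thesis using le by (simp add: mult.commute)
      qed
      also have "\<dots> \<le> \<epsilon> / 3 * (b - a)"
        using \<epsilon> \<beta> ab by (intro mult_left_mono) (auto simp: right_diff_distrib[symmetric] mult_left_le_one_le)
      finally have I3: "\<bar>I3\<bar> \<le> (b - a) * (\<epsilon> / 3)" by (simp add: mult.commute)
      have eq1: "I1 = integral {0..\<beta> * a} (\<lambda>s. (k b s - k a s) * \<phi> s) - (b - a) * integral {0..\<beta> * a} (\<lambda>s. k' t0 s * \<phi> s)"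
      proof -
        have "(\<lambda>s. (k b s - k a s - (b - a) * k' t0 s) * \<phi> s)
            = (\<lambda>s. (k b s - k a s) * \<phi> s - (b - a) * (k' t0 s * \<phi> s))"
          by (simp add: fun_eq_iff algebra_simps)
        then show ?thesis
          using Henstock_Kurzweil_Integration.integral_diff[OF i1 i2'] by (simp add: I1_def)
      qed
      have eq2: "kernel_int \<beta> k' \<phi> t0 = integral {0..\<beta> * a} (\<lambda>s. k' t0 s * \<phi> s) + I2"
        unfolding I2_def kernel_int_def using le \<beta>t0
        by (intro Henstock_Kurzweil_Integration.integral_combine[symmetric] i2) auto
      have eq3: "I3 = integral {\<beta> * a..\<beta> * b} (\<lambda>s. k b s * \<phi> s) - \<beta> * (b - a) * L"
        using Henstock_Kurzweil_Integration.integral_diff[OF i3 integrable_const_ivl[of L]] le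
        by (simp add: I3_def algebra_simps)
      have "kernel_int \<beta> k \<phi> b - kernel_int \<beta> k \<phi> a - (b - a) * D = I1 - (b - a) * I2 + I3"
        using kernel_int_increment[OF k \<phi>(1) \<beta>, of a b] ab
        unfolding eq1 eq3 D_def kernel_deriv_def eq2 L_def by (simp add: algebra_simps)
      then have "\<bar>kernel_int \<beta> k \<phi> b - kernel_int \<beta> k \<phi> a - (b - a) * D\<bar> \<le> \<bar>I1\<bar> + \<bar>(b - a) * I2\<bar> + \<bar>I3\<bar>"
        by linarith
      also have "\<dots> \<le> \<epsilon> * (b - a)" using I1 I2 I3 by (simp add: algebra_simps)
      finally show ?thesis .
    qed
    have "norm (kernel_int \<beta> k \<phi> y - kernel_int \<beta> k \<phi> t0 - D * (y - t0)) \<le> \<epsilon> * norm (y - t0)"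
      if y: "y \<in> {0..T}" "norm (y - t0) < d" for y
    proof (cases y t0 rule: linorder_cases)
      case less
      have "0 < y" using y d(5) less by auto
      then show ?thesis using main[of y t0] less y t0 d by (simp add: algebra_simps abs_if split: if_splits)
    next
      case greater
      then show ?thesis using main[of t0 y] y t0 d by (simp add: algebra_simps)
    qed auto
    then show ?thesis using d(1) by blast
  qed
  then show ?thesis
    unfolding has_field_derivative_def has_derivative_within_alt D_def
    by (auto intro: bounded_linear_mult_right)
qed

lemma breakpoints_less:
  fixes \<alpha> :: "nat \<Rightarrow> real"
  assumes "\<forall>i<n. \<alpha> i < \<alpha> (Suc i)" "i < j" "j \<le> n"
  shows "\<alpha> i < \<alpha> j"
  using assms(2,3)
proof (induction j)
  case (Suc j)
  then show ?case using assms(1) by (cases "i = j") (auto intro: less_trans)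
qed simp

lemma breakpoints_le:
  fixes \<alpha> :: "nat \<Rightarrow> real"
  assumes "\<forall>i<n. \<alpha> i < \<alpha> (Suc i)" "i \<le> j" "j \<le> n"
  shows "\<alpha> i \<le> \<alpha> j"
  using breakpoints_less[OF assms(1), of i j] assms(2,3) by (cases "i = j") auto

lemma pw_kernel_eq:
  assumes \<alpha>: "\<forall>i<n. \<alpha> i < \<alpha> (Suc i)" "\<alpha> n = 1"
    and i: "i \<in> {1..n}" and t: "t > 0" and s: "\<alpha> (i - 1) * t \<le> s" "s < \<alpha> i * t"
  shows "pw_kernel n \<alpha> K t s = K i t s"
proof -
  have "\<alpha> i * t \<le> t" using breakpoints_le[OF \<alpha>(1), of i n] i \<alpha>(2) t by auto
  then have "s \<noteq> t" using s by auto
  have "(THE i. i \<in> {1..n} \<and> \<alpha> (i - 1) * t \<le> s \<and> s < \<alpha> i * t) = i"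
  proof (rule the_equality)
    fix j assume j: "j \<in> {1..n} \<and> \<alpha> (j - 1) * t \<le> s \<and> s < \<alpha> j * t"
    have "\<alpha> (j - 1) < \<alpha> i" "\<alpha> (i - 1) < \<alpha> j"
      using j s t by (meson le_less_trans mult_less_cancel_right_pos)+
    moreover have "j - 1 \<le> n" "i - 1 \<le> n" using i j by auto
    ultimately have "\<not> i \<le> j - 1" "\<not> j \<le> i - 1"
      using breakpoints_le[OF \<alpha>(1), of i "j - 1"] breakpoints_le[OF \<alpha>(1), of j "i - 1"] i j by auto
    then show "j = i" using i j by auto
  qed (use i s in auto)
  with \<open>s \<noteq> t\<close> show ?thesis by (simp add: pw_kernel_def)
qed

definition pw_integral ::
    "nat \<Rightarrow> (nat \<Rightarrow> real) \<Rightarrow> (nat \<Rightarrow> real \<Rightarrow> real \<Rightarrow> real) \<Rightarrow> (real \<Rightarrow> real) \<Rightarrow> real \<Rightarrow> real" where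
  "pw_integral n \<alpha> K \<phi> t = (\<Sum>i=1..n. kernel_int (\<alpha> i) (K i) \<phi> t - kernel_int (\<alpha> (i - 1)) (K i) \<phi> t)"

lemma kernel_piece_integral:
  assumes k: "continuous_on (triangle T) (\<lambda>(t, s). k t s)" and \<phi>: "\<phi> absolutely_integrable_on {0..T}"
    and ab: "0 \<le> a" "a \<le> b" "b \<le> 1" and t: "0 \<le> t" "t \<le> T"
  shows "((\<lambda>s. k t s * \<phi> s) has_integral kernel_int b k \<phi> t - kernel_int a k \<phi> t) {a * t..b * t}"
proof -
  have le: "0 \<le> a * t" "a * t \<le> b * t" "b * t \<le> t"
    using ab t by (auto simp: mult_right_mono mult_left_le_one_le)
  have "integral {0..a * t} (\<lambda>s. k t s * \<phi> s) + integral {a * t..b * t} (\<lambda>s. k t s * \<phi> s) = kernel_int b k \<phi> t"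
    unfolding kernel_int_def using le t
    by (intro Henstock_Kurzweil_Integration.integral_combine kernel_slice_integrable[OF k \<phi>]) auto
  moreover have "(\<lambda>s. k t s * \<phi> s) integrable_on {a * t..b * t}"
    using le t by (intro kernel_slice_integrable[OF k \<phi>]) auto
  ultimately show ?thesis by (simp add: has_integral_iff kernel_int_def)
qed

text \<open>The kernel agrees with \<open>K i\<close> on the \<open>i\<close>-th piece except possibly at its right end point, which is a
  null set.\<close>

lemma pw_kernel_has_integral:
  assumes \<alpha>: "\<forall>i<n. \<alpha> i < \<alpha> (Suc i)" "\<alpha> 0 = 0" "\<alpha> n = 1"
    and K: "\<forall>i\<in>{1..n}. continuous_on (triangle T) (\<lambda>(t, s). K i t s)"
    and \<phi>: "\<phi> absolutely_integrable_on {0..T}" and t: "0 < t" "t \<le> T"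
  shows "((\<lambda>s. pw_kernel n \<alpha> K t s * \<phi> s) has_integral pw_integral n \<alpha> K \<phi> t) {0..t}"
proof -
  have "((\<lambda>s. pw_kernel n \<alpha> K t s * \<phi> s) has_integral pw_integral m \<alpha> K \<phi> t) {0..\<alpha> m * t}" if "m \<le> n" for m
    using that
  proof (induction m)
    case 0
    then show ?case using \<alpha> by (simp add: pw_integral_def has_integral_refl)
  next
    case (Suc m)
    have le: "0 \<le> \<alpha> m" "\<alpha> m \<le> \<alpha> (Suc m)" "\<alpha> (Suc m) \<le> 1"
      using breakpoints_le[OF \<alpha>(1), of 0 m] breakpoints_le[OF \<alpha>(1), of m "Suc m"]
        breakpoints_le[OF \<alpha>(1), of "Suc m" n] Suc.prems \<alpha> by auto
    have "((\<lambda>s. K (Suc m) t s * \<phi> s) has_integral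
        kernel_int (\<alpha> (Suc m)) (K (Suc m)) \<phi> t - kernel_int (\<alpha> m) (K (Suc m)) \<phi> t) {\<alpha> m * t..\<alpha> (Suc m) * t}"
      using Suc.prems K t le by (intro kernel_piece_integral[OF _ \<phi>]) auto
    then have "((\<lambda>s. pw_kernel n \<alpha> K t s * \<phi> s) has_integral
        kernel_int (\<alpha> (Suc m)) (K (Suc m)) \<phi> t - kernel_int (\<alpha> m) (K (Suc m)) \<phi> t) {\<alpha> m * t..\<alpha> (Suc m) * t}"
    proof (rule has_integral_spike_finite[of "{\<alpha> (Suc m) * t}", rotated 2])
      fix s assume "s \<in> {\<alpha> m * t..\<alpha> (Suc m) * t} - {\<alpha> (Suc m) * t}"
      then show "pw_kernel n \<alpha> K t s * \<phi> s = K (Suc m) t s * \<phi> s"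
        using pw_kernel_eq[OF \<alpha>(1,3), of "Suc m" t s K] Suc.prems t by auto
    qed simp
    from has_integral_combine[OF _ _ Suc.IH this]
    show ?case using Suc.prems le t by (simp add: pw_integral_def mult_right_mono)
  qed
  from this[of n] show ?thesis using \<alpha> by simp
qed

section \<open>Expansions in powers and logarithms\<close>

definition logmono :: "nat \<Rightarrow> real poly \<Rightarrow> real \<Rightarrow> real" where
  "logmono j p t = t ^ j * poly p (ln t)"

lemma log_asymp_logmono: "log_asymp N X t = (\<Sum>i\<le>N. logmono i (X i) t)"
  by (simp add: log_asymp_def logmono_def mult.commute)

text \<open>With \<open>x = - ln t\<close> this is the fact that the exponential beats every polynomial.\<close>

lemma tendsto_id_mult_poly_ln: "((\<lambda>t::real. t * poly p (ln t)) \<longlongrightarrow> 0) (at_right 0)"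
proof -
  have lim: "filterlim (\<lambda>t::real. - ln t) at_top (at_right 0)"
    using ln_at_0 by (simp add: filterlim_uminus_at_top)
  have "((\<lambda>t::real. t * ln t ^ i) \<longlongrightarrow> 0) (at_right 0)" for i
  proof -
    have "((\<lambda>t::real. (- ln t) ^ i / exp (- ln t)) \<longlongrightarrow> 0) (at_right 0)"
      by (rule filterlim_compose[OF tendsto_power_div_exp_0 lim])
    then have "((\<lambda>t::real. (- 1) ^ i * ((- ln t) ^ i / exp (- ln t))) \<longlongrightarrow> 0) (at_right 0)"
      by (rule tendsto_mult_right_zero)
    moreover have "\<forall>\<^sub>F t :: real in at_right 0. (- 1) ^ i * ((- ln t) ^ i / exp (- ln t)) = t * ln t ^ i"
      using eventually_at_right_less[of "0::real"]
      by eventually_elim (simp add: exp_minus field_simps power_mult_distrib[symmetric])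
    ultimately show ?thesis by (rule Lim_transform_eventually)
  qed
  then have "((\<lambda>t. \<Sum>i\<le>degree p. coeff p i * (t * ln t ^ i)) \<longlongrightarrow> 0) (at_right 0)"
    by (intro tendsto_null_sum tendsto_mult_right_zero)
  then show ?thesis by (simp add: poly_altdef sum_distrib_left mult_ac)
qed

lemma tendsto_logmono:
  assumes "j > 0"
  shows "(logmono j p \<longlongrightarrow> 0) (at_right 0)"
proof -
  obtain i where i: "j = Suc i" using assms by (cases j) auto
  have "((\<lambda>t::real. t ^ i) \<longlongrightarrow> 0 ^ i) (at_right 0)"
    by (intro tendsto_intros)
  from tendsto_mult[OF this tendsto_id_mult_poly_ln[of p]] show ?thesis
    by (simp add: logmono_def[abs_def] i mult_ac)
qed

lemma logmono_continuous: "continuous_on {0<..T} (logmono j p)"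
  unfolding logmono_def[abs_def] by (intro continuous_intros) auto

text \<open>The antiderivative extends continuously by \<open>0\<close> to \<open>t = 0\<close>, so the fundamental theorem applies on the
  closed interval.\<close>

lemma logmono_integral:
  assumes q: "smult (real j + 1) q + pderiv q = p" and x: "x > 0"
  shows "(logmono j p has_integral logmono (Suc j) q x) {0..x}"
proof -
  have "continuous_on {0..x} (logmono (Suc j) q)"
    unfolding continuous_on_eq_continuous_within
  proof
    fix t assume t: "t \<in> {0..x}"
    show "continuous (at t within {0..x}) (logmono (Suc j) q)"
    proof (cases "t = 0")
      case True
      have "logmono (Suc j) q 0 = 0" by (simp add: logmono_def)
      then show ?thesis
        using tendsto_logmono[of "Suc j" q] x True
        by (simp add: continuous_within at_within_Icc_at_right)
    next
      case False
      then have "isCont (logmono (Suc j) q) t"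
        unfolding logmono_def[abs_def] using t by (intro continuous_intros) auto
      then show ?thesis by (rule continuous_at_imp_continuous_at_within)
    qed
  qed
  moreover have "(logmono (Suc j) q has_vector_derivative logmono j p t) (at t)" if "t \<in> {0<..<x}" for t
  proof -
    have "((\<lambda>t. t ^ Suc j * poly q (ln t)) has_real_derivative
        t ^ Suc j * (poly (pderiv q) (ln t) * (1 / t)) + real (Suc j) * t ^ j * poly q (ln t)) (at t)"
      using that by (intro DERIV_mult' DERIV_cong[OF DERIV_pow] DERIV_chain2[OF poly_DERIV] DERIV_ln_divide) auto
    moreover have "t ^ Suc j * (poly (pderiv q) (ln t) * (1 / t)) + real (Suc j) * t ^ j * poly q (ln t)
        = logmono j p t"
      using that by (simp add: logmono_def q[symmetric] field_simps)
    ultimately show ?thesis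
      by (simp add: logmono_def[abs_def] has_real_derivative_iff_has_vector_derivative)
  qed
  ultimately have "(logmono j p has_integral (logmono (Suc j) q x - logmono (Suc j) q 0)) {0..x}"
    using x by (intro fundamental_theorem_of_calculus_interior) auto
  then show ?thesis by (simp add: logmono_def)
qed

text \<open>The bound \<open>\<bar>p\<bar> \<le> 1 + p\<^sup>2\<close> dominates the function by one of the same shape, whose integrability is
  known from its antiderivative.\<close>

lemma logmono_absolutely_integrable:
  assumes "T > 0"
  shows "logmono j p absolutely_integrable_on {0..T}"
proof (rule absolutely_integrable_integrable_bound)
  have int: "logmono j r integrable_on {0..T}" for r
  proof -
    obtain q where "smult (real j + 1) q + pderiv q = r"
      using pderiv_plus_smult_surj[of "real j + 1" r] by auto
    from logmono_integral[OF this assms] show ?thesis by blast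
  qed
  show "logmono j p integrable_on {0..T}" "logmono j (1 + p * p) integrable_on {0..T}"
    by (rule int)+
  fix s assume s: "s \<in> {0..T}"
  have "\<bar>poly p (ln s)\<bar> \<le> 1 + (poly p (ln s))\<^sup>2"
    using zero_le_power2[of "\<bar>poly p (ln s)\<bar> - 1"] unfolding power2_diff
    by (simp add: power2_abs)
  then show "norm (logmono j p s) \<le> logmono j (1 + p * p) s"
    using s by (simp add: logmono_def abs_mult power2_eq_square mult_left_mono)
qed

text \<open>The function \<open>g\<close> has an expansion in terms \<open>t ^ i * Q i (ln t)\<close> up to an error \<open>o(t ^ N)\<close>, it starts at
  order \<open>j\<close>, and \<open>q\<close> (possibly zero) is its coefficient there. The coefficients of higher order
  are left unspecified, since only the leading one is needed to determine the next term of the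
  solution.\<close>

definition leads :: "nat \<Rightarrow> nat \<Rightarrow> real poly \<Rightarrow> (real \<Rightarrow> real) \<Rightarrow> bool" where
  "leads N j q g \<longleftrightarrow> (\<exists>Q. (\<forall>i<j. Q i = 0) \<and> Q j = q \<and>
     ((\<lambda>t. (g t - log_asymp N Q t) / t ^ N) \<longlongrightarrow> 0) (at_right 0))"

lemma leads_add:
  assumes "leads N j q g" "leads N j r h"
  shows "leads N j (q + r) (\<lambda>t. g t + h t)"
proof -
  obtain Q R where Q: "\<forall>i<j. Q i = 0" "Q j = q" "((\<lambda>t. (g t - log_asymp N Q t) / t ^ N) \<longlongrightarrow> 0) (at_right 0)"
    and R: "\<forall>i<j. R i = 0" "R j = r" "((\<lambda>t. (h t - log_asymp N R t) / t ^ N) \<longlongrightarrow> 0) (at_right 0)"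
    using assms unfolding leads_def by blast
  have "log_asymp N (\<lambda>i. Q i + R i) t = log_asymp N Q t + log_asymp N R t" for t
    by (simp add: log_asymp_def sum.distrib distrib_right)
  then have "((\<lambda>t. (g t + h t - log_asymp N (\<lambda>i. Q i + R i) t) / t ^ N) \<longlongrightarrow> 0) (at_right 0)"
    using tendsto_add[OF Q(3) R(3)] by (simp add: add_divide_distrib[symmetric] algebra_simps)
  then show ?thesis using Q R unfolding leads_def by (intro exI[of _ "\<lambda>i. Q i + R i"]) auto
qed

lemma leads_cmult:
  assumes "leads N j q g"
  shows "leads N j (smult c q) (\<lambda>t. c * g t)"
proof -
  obtain Q where Q: "\<forall>i<j. Q i = 0" "Q j = q" "((\<lambda>t. (g t - log_asymp N Q t) / t ^ N) \<longlongrightarrow> 0) (at_right 0)"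
    using assms unfolding leads_def by blast
  have "log_asymp N (\<lambda>i. smult c (Q i)) t = c * log_asymp N Q t" for t
    by (simp add: log_asymp_def sum_distrib_left mult.assoc)
  then have "((\<lambda>t. (c * g t - log_asymp N (\<lambda>i. smult c (Q i)) t) / t ^ N) \<longlongrightarrow> 0) (at_right 0)"
    using tendsto_mult_right_zero[OF Q(3), of c] by (simp add: algebra_simps)
  then show ?thesis using Q unfolding leads_def by (intro exI[of _ "\<lambda>i. smult c (Q i)"]) auto
qed

lemma leads_diff:
  assumes "leads N j q g" "leads N j r h"
  shows "leads N j (q - r) (\<lambda>t. g t - h t)"
  using leads_add[OF assms(1) leads_cmult[OF assms(2), of "-1"]] by simp

lemma leads_cong:
  assumes "leads N j q g" "\<forall>\<^sub>F t in at_right 0. g t = h t"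
  shows "leads N j q h"
proof -
  obtain Q where Q: "\<forall>i<j. Q i = 0" "Q j = q" "((\<lambda>t. (g t - log_asymp N Q t) / t ^ N) \<longlongrightarrow> 0) (at_right 0)"
    using assms unfolding leads_def by blast
  have "\<forall>\<^sub>F t in at_right 0. (g t - log_asymp N Q t) / t ^ N = (h t - log_asymp N Q t) / t ^ N"
    using assms(2) by eventually_elim simp
  from Lim_transform_eventually[OF Q(3) this] Q show ?thesis unfolding leads_def by blast
qed

lemma leads_negligible:
  assumes "((\<lambda>t. g t / t ^ N) \<longlongrightarrow> 0) (at_right 0)"
  shows "leads N j 0 g"
  using assms unfolding leads_def by (intro exI[of _ "\<lambda>_. 0"]) (simp add: log_asymp_def)

lemma leads_zero: "leads N j 0 (\<lambda>t. 0)"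
  by (rule leads_negligible) simp

lemma leads_sum:
  assumes "\<And>i. i \<in> I \<Longrightarrow> leads N j (q i) (g i)"
  shows "leads N j (\<Sum>i\<in>I. q i) (\<lambda>t. \<Sum>i\<in>I. g i t)"
  using assms
  by (induction I rule: infinite_finite_induct) (auto intro: leads_add leads_zero)

lemma leads_logmono:
  assumes "j \<le> i" "j \<le> N"
  shows "leads N j (if i = j then p else 0) (logmono i p)"
proof (cases "i \<le> N")
  case True
  have "log_asymp N (\<lambda>l. if l = i then p else 0) t = logmono i p t" for t
    using True by (simp add: log_asymp_logmono logmono_def if_distrib[of "\<lambda>p. poly p _"]
        if_distrib[of "\<lambda>x. _ * x"] cong: if_cong)
  then show ?thesis using assms unfolding leads_def
    by (intro exI[of _ "\<lambda>l. if l = i then p else 0"]) auto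
next
  case False
  have "\<forall>\<^sub>F t in at_right 0. logmono (i - N) p t = logmono i p t / t ^ N"
    using eventually_at_right_less[of "0::real"]
    by eventually_elim (use False in \<open>simp add: logmono_def power_diff\<close>)
  from Lim_transform_eventually[OF tendsto_logmono this] have "leads N j 0 (logmono i p)"
    using False by (intro leads_negligible) auto
  then show ?thesis using False assms by auto
qed

lemma logmono_scaled:
  assumes "\<beta> > 0" "t > 0"
  shows "logmono j p (\<beta> * t) = logmono j (smult (\<beta> ^ j) (p \<circ>\<^sub>p [:ln \<beta>, 1:])) t"
  using assms by (simp add: logmono_def ln_mult poly_pcompose power_mult_distrib mult_ac)

text \<open>A monomial \<open>t ^ a * s ^ b\<close> raises the order by \<open>a + b\<close>; only the constant term of \<open>P\<close> contributes to
  the order \<open>j\<close>.\<close>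

lemma leads_bipoly_boundary:
  assumes "bipoly P" "\<beta> > 0" "j \<le> N"
  shows "leads N j (smult (P 0 0 * \<beta> ^ j) (p \<circ>\<^sub>p [:ln \<beta>, 1:])) (\<lambda>t. P t (\<beta> * t) * logmono j p (\<beta> * t))"
  using assms(1)
proof (induction rule: bipoly.induct)
  case (monomial c a b)
  define p' where "p' = smult (c * \<beta> ^ b * \<beta> ^ j) (p \<circ>\<^sub>p [:ln \<beta>, 1:])"
  have "(if a + b + j = j then p' else 0) = smult (c * 0 ^ a * 0 ^ b * \<beta> ^ j) (p \<circ>\<^sub>p [:ln \<beta>, 1:])"
    by (auto simp: p'_def power_0_left)
  moreover have "\<forall>\<^sub>F t in at_right 0. logmono (a + b + j) p' t = c * t ^ a * (\<beta> * t) ^ b * logmono j p (\<beta> * t)"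
    using eventually_at_right_less[of "0::real"]
    by eventually_elim (subst logmono_scaled[OF assms(2)], assumption,
      simp add: logmono_def p'_def power_add power_mult_distrib mult_ac)
  ultimately show ?case
    using leads_cong[OF leads_logmono[of j "a + b + j" N p']] assms(3) by (simp add: mult_ac)
next
  case (add P Q)
  from leads_add[OF add.IH] show ?case by (simp add: distrib_right smult_add_left)
qed

text \<open>Integration raises the order by one, so nothing of order \<open>j\<close> remains.\<close>

lemma leads_bipoly_integral:
  assumes "bipoly P" "0 < \<beta>" "\<beta> \<le> 1" "j \<le> N"
  shows "leads N j 0 (kernel_int \<beta> P (logmono j p))"
  using assms(1)
proof (induction rule: bipoly.induct)
  case (monomial c a b)
  obtain q where q: "smult (real (b + j) + 1) q + pderiv q = p"
    using pderiv_plus_smult_surj[of "real (b + j) + 1" p] by auto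
  define q' where "q' = smult (c * \<beta> ^ Suc (b + j)) (q \<circ>\<^sub>p [:ln \<beta>, 1:])"
  have "logmono (a + Suc (b + j)) q' t = kernel_int \<beta> (\<lambda>t s. c * t ^ a * s ^ b) (logmono j p) t" if t: "t > 0" for t
  proof -
    have "(logmono (b + j) p has_integral logmono (Suc (b + j)) q (\<beta> * t)) {0..\<beta> * t}"
      using assms t by (intro logmono_integral[OF q]) auto
    from has_integral_mult_right[OF this, of "c * t ^ a"]
    have "kernel_int \<beta> (\<lambda>t s. c * t ^ a * s ^ b) (logmono j p) t = c * t ^ a * logmono (Suc (b + j)) q (\<beta> * t)"
      unfolding kernel_int_def by (intro integral_unique) (simp add: logmono_def power_add mult_ac)
    then show ?thesis
      unfolding logmono_scaled[OF assms(2) t] by (simp add: logmono_def q'_def power_add mult_ac)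
  qed
  then have "\<forall>\<^sub>F t in at_right 0. logmono (a + Suc (b + j)) q' t = kernel_int \<beta> (\<lambda>t s. c * t ^ a * s ^ b) (logmono j p) t"
    using eventually_at_right_less[of "0::real"] by (auto elim: eventually_mono)
  with leads_logmono[of j "a + Suc (b + j)" N q'] assms(4) show ?case
    using leads_cong by auto
next
  case (add P Q)
  have "kernel_int \<beta> P (logmono j p) t + kernel_int \<beta> Q (logmono j p) t
      = kernel_int \<beta> (\<lambda>t s. P t s + Q t s) (logmono j p) t" if t: "t \<in> {0<..<1}" for t
  proof -
    have "(\<lambda>s. R t s * logmono j p s) integrable_on {0..\<beta> * t}" if "bipoly R" for R
      using assms t
      by (intro kernel_slice_integrable[OF bipoly_continuous[OF that] logmono_absolutely_integrable[of 1]])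
        (auto simp: mult_left_le_one_le)
    then show ?thesis
      unfolding kernel_int_def using add.hyps
      by (subst Henstock_Kurzweil_Integration.integral_add[symmetric]) (auto simp: distrib_right)
  qed
  then have "\<forall>\<^sub>F t in at_right 0. kernel_int \<beta> P (logmono j p) t + kernel_int \<beta> Q (logmono j p) t
      = kernel_int \<beta> (\<lambda>t s. P t s + Q t s) (logmono j p) t"
    using eventually_at_right_real[of 0 "1::real"] by (auto elim: eventually_mono)
  from leads_cong[OF _ this] leads_add[OF add.IH] show ?case by simp
qed

text \<open>The remainder must be of order \<open>N + 1\<close>: for \<open>j = 0\<close> a remainder \<open>o(t ^ N)\<close> would not survive the
  multiplication by a power of the logarithm. This is where the last derivative of the kernel is
  spent.\<close>

lemma leads_kernel_boundary:
  assumes P: "bipoly P" and \<eta>: "\<eta> > 0" and C: "\<And>t s. (t, s) \<in> corner \<eta> \<Longrightarrow> \<bar>k t s - P t s\<bar> \<le> C * t ^ Suc N"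
    and \<beta>: "0 < \<beta>" "\<beta> \<le> 1" and j: "j \<le> N"
  shows "leads N j (smult (k 0 0 * \<beta> ^ j) (p \<circ>\<^sub>p [:ln \<beta>, 1:])) (\<lambda>t. k t (\<beta> * t) * logmono j p (\<beta> * t))"
proof -
  have k0: "k 0 0 = P 0 0" using C[of 0 0] \<eta> by (auto simp: corner_def)
  define p' where "p' = smult (\<beta> ^ j) (p \<circ>\<^sub>p [:ln \<beta>, 1:])"
  have "leads N j 0 (\<lambda>t. (k t (\<beta> * t) - P t (\<beta> * t)) * logmono j p (\<beta> * t))"
  proof (rule leads_negligible, rule Lim_null_comparison)
    show "\<forall>\<^sub>F t in at_right 0. norm ((k t (\<beta> * t) - P t (\<beta> * t)) * logmono j p (\<beta> * t) / t ^ N) \<le> C * \<bar>logmono (Suc j) p' t\<bar>"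
      using eventually_at_right_real[OF \<eta>]
    proof eventually_elim
      case (elim t)
      then have "\<bar>k t (\<beta> * t) - P t (\<beta> * t)\<bar> \<le> C * t ^ Suc N"
        using \<beta> by (intro C) (auto simp: corner_def mult_left_le_one_le)
      then have "\<bar>k t (\<beta> * t) - P t (\<beta> * t)\<bar> / t ^ N * \<bar>logmono j p' t\<bar> \<le> C * t * \<bar>logmono j p' t\<bar>"
        using elim by (intro mult_right_mono) (auto simp: field_simps)
      moreover have "logmono j p (\<beta> * t) = logmono j p' t"
        using logmono_scaled[of \<beta> t j p] elim \<beta> by (simp add: p'_def)
      moreover have "t * \<bar>logmono j p' t\<bar> = \<bar>logmono (Suc j) p' t\<bar>"
        using elim by (simp add: logmono_def abs_mult)
      ultimately show ?case
        using elim by (simp add: abs_mult mult.assoc)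
    qed
    show "((\<lambda>t. C * \<bar>logmono (Suc j) p' t\<bar>) \<longlongrightarrow> 0) (at_right 0)"
      using tendsto_logmono[of "Suc j" p'] by (intro tendsto_mult_right_zero tendsto_rabs_zero) auto
  qed
  from leads_add[OF leads_bipoly_boundary[OF P \<beta>(1) j, of p] this] show ?thesis
    by (simp add: k0 algebra_simps)
qed

text \<open>Here a remainder of order \<open>N\<close> suffices, because integration against \<open>\<phi>\<close> contributes the factor
  \<open>abs_mass \<phi> (\<beta> * t)\<close>, which tends to zero.\<close>

lemma leads_kernel_integral:
  assumes k: "continuous_on (triangle T) (\<lambda>(t, s). k t s)" and T: "T > 0"
    and P: "bipoly P" and \<eta>: "\<eta> > 0" and C: "\<And>t s. (t, s) \<in> corner \<eta> \<Longrightarrow> \<bar>k t s - P t s\<bar> \<le> C * t ^ N"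
    and \<beta>: "0 < \<beta>" "\<beta> \<le> 1" and j: "j \<le> N"
  shows "leads N j 0 (kernel_int \<beta> k (logmono j p))"
proof -
  define \<phi> where "\<phi> = logmono j p"
  have \<phi>: "\<phi> absolutely_integrable_on {0..T}"
    unfolding \<phi>_def by (rule logmono_absolutely_integrable[OF T])
  have "leads N j 0 (\<lambda>t. kernel_int \<beta> k \<phi> t - kernel_int \<beta> P \<phi> t)"
  proof (rule leads_negligible, rule Lim_null_comparison)
    have pos: "0 < min \<eta> T" using \<eta> T by simp
    show "\<forall>\<^sub>F t in at_right 0. norm ((kernel_int \<beta> k \<phi> t - kernel_int \<beta> P \<phi> t) / t ^ N) \<le> C * abs_mass \<phi> (\<beta> * t)"
      using eventually_at_right_real[OF pos]
    proof eventually_elim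
      case (elim t)
      have \<beta>t: "0 < \<beta> * t" "\<beta> * t \<le> t" using \<beta> elim by (auto simp: mult_left_le_one_le)
      have int: "(\<lambda>s. k t s * \<phi> s) integrable_on {0..\<beta> * t}" "(\<lambda>s. P t s * \<phi> s) integrable_on {0..\<beta> * t}"
        using \<beta>t elim by (auto intro: kernel_slice_integrable[OF k \<phi>]
          kernel_slice_integrable[OF bipoly_continuous[OF P] \<phi>])
      have "kernel_int \<beta> k \<phi> t - kernel_int \<beta> P \<phi> t = integral {0..\<beta> * t} (\<lambda>s. (k t s - P t s) * \<phi> s)"
        using Henstock_Kurzweil_Integration.integral_diff[OF int] by (simp add: kernel_int_def left_diff_distrib)
      also have "\<bar>\<dots>\<bar> \<le> (C * t ^ N) * (abs_mass \<phi> (\<beta> * t) - abs_mass \<phi> 0)"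
      proof (rule integral_product_bound[OF \<phi>])
        show "(\<lambda>s. (k t s - P t s) * \<phi> s) integrable_on {0..\<beta> * t}"
          using integrable_diff[OF int] by (simp add: left_diff_distrib)
        show "\<bar>k t s - P t s\<bar> \<le> C * t ^ N" if "s \<in> {0..\<beta> * t}" for s
        proof -
          have "0 \<le> s" "s \<le> t" using that \<beta>t(2) by auto
          then show ?thesis using elim by (intro C) (auto simp: corner_def)
        qed
      qed (use \<beta>t elim in auto)
      finally show ?case using elim by (simp add: abs_mass_def field_simps)
    qed
    have "continuous_on {0..T} (\<lambda>t. abs_mass \<phi> (\<beta> * t))"
      using \<beta> T by (intro continuous_on_compose2[OF abs_mass_continuous[OF \<phi>]] continuous_intros)
        (auto intro: mult_left_le_one_le mult_left_le_one_le[THEN order_trans])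
    then have "((\<lambda>t. abs_mass \<phi> (\<beta> * t)) \<longlongrightarrow> 0) (at_right 0)"
      using T by (auto simp: continuous_on_def abs_mass_def at_within_Icc_at_right dest!: bspec[of _ _ 0])
    then show "((\<lambda>t. C * abs_mass \<phi> (\<beta> * t)) \<longlongrightarrow> 0) (at_right 0)"
      by (rule tendsto_mult_right_zero)
  qed
  from leads_add[OF this leads_bipoly_integral[OF P \<beta> j, of p]] show ?thesis by (simp add: \<phi>_def)
qed

text \<open>A non-constant polynomial is unbounded along \<open>ln t \<rightarrow> -\<infinity>\<close>.\<close>

lemma poly_ln_tendsto_0:
  assumes "((\<lambda>t. poly p (ln t)) \<longlongrightarrow> 0) (at_right 0)"
  shows "p = (0 :: real poly)"
proof (cases "degree p = 0")
  case True
  then obtain c where "p = [:c:]" by (meson degree_eq_zeroE)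
  then show ?thesis using assms by (simp add: tendsto_const_iff)
next
  case False
  have "filterlim (ln :: real \<Rightarrow> real) at_infinity (at_right 0)"
    using ln_at_0 by (rule filterlim_mono) (auto simp: at_bot_le_at_infinity)
  then have "filterlim (\<lambda>t. poly p (ln t)) at_infinity (at_right (0 :: real))"
    using filterlim_compose[OF filterlim_poly_at_infinity] False by blast
  with assms show ?thesis
    using not_tendsto_and_filterlim_at_infinity trivial_limit_at_right_real by blast
qed

text \<open>Once the coefficients below \<open>i\<close> vanish, division by \<open>t ^ i\<close> leaves \<open>Y i (ln t)\<close> up to terms that tend to
  zero.\<close>

lemma log_asymp_coefficients_unique:
  assumes small: "\<And>i. i < N \<Longrightarrow> ((\<lambda>t. log_asymp N Y t / t ^ i) \<longlongrightarrow> 0) (at_right 0)"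
  shows "i < N \<Longrightarrow> Y i = 0"
proof (induction i rule: less_induct)
  case (less i)
  have "((\<lambda>t. log_asymp N Y t / t ^ i - (\<Sum>m\<in>{i<..N}. logmono (m - i) (Y m) t)) \<longlongrightarrow> 0 - 0) (at_right 0)"
    by (intro tendsto_diff small less.prems tendsto_null_sum tendsto_logmono) auto
  moreover have "log_asymp N Y t / t ^ i - (\<Sum>m\<in>{i<..N}. logmono (m - i) (Y m) t) = poly (Y i) (ln t)"
    if t: "t > 0" for t
  proof -
    have "{..N} = {..<i} \<union> insert i {i<..N}" using less.prems by auto
    then have "log_asymp N Y t = (\<Sum>m<i. logmono m (Y m) t) + (logmono i (Y i) t + (\<Sum>m\<in>{i<..N}. logmono m (Y m) t))"
      by (simp only: log_asymp_logmono, subst sum.union_disjoint) auto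
    also have "(\<Sum>m<i. logmono m (Y m) t) = 0"
      using less by (intro sum.neutral) (auto simp: logmono_def)
    also have "(\<Sum>m\<in>{i<..N}. logmono m (Y m) t) = t ^ i * (\<Sum>m\<in>{i<..N}. logmono (m - i) (Y m) t)"
      unfolding sum_distrib_left using t
      by (intro sum.cong) (auto simp: logmono_def power_add[symmetric] mult.assoc[symmetric])
    finally show ?thesis using t by (simp add: logmono_def field_simps)
  qed
  then have "\<forall>\<^sub>F t in at_right 0. log_asymp N Y t / t ^ i - (\<Sum>m\<in>{i<..N}. logmono (m - i) (Y m) t) = poly (Y i) (ln t)"
    using eventually_at_right_less[of "0::real"] by (auto elim: eventually_mono)
  ultimately show ?case
    using poly_ln_tendsto_0 Lim_transform_eventually by force
qed

section \<open>The correction by successive approximations\<close>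

lemma restrict_in_cont_space:
  assumes "continuous_on {0..T} g"
  shows "restrict g {0..T} \<in> cont_space T"
proof -
  have "continuous_on {0..T} (restrict g {0..T}) \<longleftrightarrow> continuous_on {0..T} g"
    by (rule continuous_on_cong) auto
  then show ?thesis using assms by (simp add: cont_space_def)
qed

lemma cont_space_bounded:
  assumes "u \<in> cont_space T" "v \<in> cont_space T"
  obtains M where "M \<ge> 0" "\<And>t. t \<in> {0..T} \<Longrightarrow> \<bar>u t - v t\<bar> \<le> M"
proof -
  have "continuous_on {0..T} (\<lambda>t. u t - v t)"
    using assms by (auto simp: cont_space_def intro: continuous_on_diff)
  from compact_imp_bounded[OF compact_continuous_image[OF this]] obtain M
    where M: "\<forall>x\<in>(\<lambda>t. u t - v t) ` {0..T}. norm x \<le> M"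
    by (auto simp: bounded_iff)
  have "\<bar>u t - v t\<bar> \<le> max M 0" if "t \<in> {0..T}" for t
    using M that by (force simp: le_max_iff_disj)
  then show ?thesis using that[of "max M 0"] by simp
qed

text \<open>Banach's theorem for the norm \<open>SUP t. \<bar>u t\<bar> * exp (- lam * t)\<close>, with convergence in the
  equivalent uniform sense. The norm enters only through its balls, given by
  the pointwise bounds \<open>M * exp (lam * t)\<close>.\<close>

lemma weighted_contraction_fixed_point:
  fixes \<Phi> :: "(real \<Rightarrow> real) \<Rightarrow> (real \<Rightarrow> real)"
  assumes maps: "\<And>u. u \<in> cont_space T \<Longrightarrow> \<Phi> u \<in> cont_space T"
    and contr: "\<And>u v M. u \<in> cont_space T \<Longrightarrow> v \<in> cont_space T \<Longrightarrow> M \<ge> 0 \<Longrightarrow>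
      (\<And>t. t \<in> {0..T} \<Longrightarrow> \<bar>u t - v t\<bar> \<le> M * exp (lam * t)) \<Longrightarrow>
      (\<And>t. t \<in> {0..T} \<Longrightarrow> \<bar>\<Phi> u t - \<Phi> v t\<bar> \<le> \<theta> * M * exp (lam * t))"
    and \<theta>: "0 \<le> \<theta>" "\<theta> < 1" and lam: "lam \<ge> 0"
  shows "\<exists>u\<in>cont_space T. \<Phi> u = u \<and> (\<forall>us. us 0 \<in> cont_space T \<and> (\<forall>m. us (Suc m) = \<Phi> (us m)) \<longrightarrow>
    uniform_limit {0..T} us u sequentially)"
proof -
  have iter_in: "us m \<in> cont_space T" if "us 0 \<in> cont_space T" "\<forall>m. us (Suc m) = \<Phi> (us m)" for us m
    by (induction m) (use that maps in auto)
  have geom: "\<bar>us m t - vs m t\<bar> \<le> M * exp (lam * T) * \<theta> ^ m"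
    if us: "us 0 \<in> cont_space T" "\<forall>m. us (Suc m) = \<Phi> (us m)"
      and vs: "vs 0 \<in> cont_space T" "\<forall>m. vs (Suc m) = \<Phi> (vs m)"
      and M: "M \<ge> 0" "\<And>t. t \<in> {0..T} \<Longrightarrow> \<bar>us 0 t - vs 0 t\<bar> \<le> M" and t: "t \<in> {0..T}" for us vs M m t
  proof -
    have "\<bar>us m t - vs m t\<bar> \<le> (\<theta> ^ m * M) * exp (lam * t)" if "t \<in> {0..T}" for t
      using that
    proof (induction m arbitrary: t)
      case 0
      then have "M * 1 \<le> M * exp (lam * t)" using M(1) lam by (intro mult_left_mono) auto
      then show ?case using M(2)[OF 0] by simp
    next
      case (Suc m)
      show ?case
        using contr[OF iter_in[OF us, of m] iter_in[OF vs, of m] _ Suc.IH Suc.prems] us vs M(1) \<theta>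
        by (simp add: mult.assoc)
    qed
    from this[OF t] have "\<bar>us m t - vs m t\<bar> \<le> (\<theta> ^ m * M) * exp (lam * t)" .
    also have "\<dots> \<le> (\<theta> ^ m * M) * exp (lam * T)"
      using t lam \<theta> M(1) by (intro mult_left_mono) (auto intro: mult_left_mono)
    finally show ?thesis by (simp add: mult_ac)
  qed
  define z where "z = restrict (\<lambda>t::real. 0::real) {0..T}"
  have z: "z \<in> cont_space T" unfolding z_def by (intro restrict_in_cont_space continuous_intros)
  define us where "us m = (\<Phi> ^^ m) z" for m
  have us: "us 0 \<in> cont_space T" "\<forall>m. us (Suc m) = \<Phi> (us m)" using z by (auto simp: us_def)
  obtain M where M: "M \<ge> 0" "\<And>t. t \<in> {0..T} \<Longrightarrow> \<bar>us (Suc 0) t - us 0 t\<bar> \<le> M"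
    using cont_space_bounded[OF iter_in[OF us, of "Suc 0"] us(1)] by blast
  have "uniform_limit {0..T} (\<lambda>m t. \<Sum>i<m. us (Suc i) t - us i t) (\<lambda>t. \<Sum>i. us (Suc i) t - us i t) sequentially"
  proof (rule Weierstrass_m_test)
    show "norm (us (Suc m) t - us m t) \<le> M * exp (lam * T) * \<theta> ^ m" if "t \<in> {0..T}" for m t
      using geom[of "\<lambda>m. us (Suc m)" us M t m] us iter_in[OF us, of "Suc 0"] M that by simp
    show "summable (\<lambda>m. M * exp (lam * T) * \<theta> ^ m)"
      using \<theta> by (intro summable_mult summable_geometric) auto
  qed
  then have "uniform_limit {0..T} (\<lambda>m t. us 0 t + (\<Sum>i<m. us (Suc i) t - us i t))
      (\<lambda>t. us 0 t + (\<Sum>i. us (Suc i) t - us i t)) sequentially"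
    by (intro uniform_limit_add uniform_limit_const)
  moreover define u where "u = restrict (\<lambda>t. us 0 t + (\<Sum>i. us (Suc i) t - us i t)) {0..T}"
  moreover have "us 0 t + (\<Sum>i<m. us (Suc i) t - us i t) = us m t" for m t
    using sum_lessThan_telescope[of "\<lambda>i. us i t" m] by simp
  ultimately have lim: "uniform_limit {0..T} us u sequentially"
    by (elim uniform_limit_cong'[THEN iffD1, rotated 2]) (auto simp: u_def)
  have "continuous_on {0..T} u"
    by (rule uniform_limit_theorem[OF _ lim]) (use iter_in[OF us] in \<open>auto simp: cont_space_def\<close>)
  then have u: "u \<in> cont_space T" by (simp add: cont_space_def u_def)
  have "\<Phi> u t = u t" if t: "t \<in> {0..T}" for t
  proof (rule LIMSEQ_unique)
    show "(\<lambda>m. us (Suc m) t) \<longlonglongrightarrow> u t"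
      using tendsto_uniform_limitI[OF lim t] by (rule LIMSEQ_Suc)
    show "(\<lambda>m. us (Suc m) t) \<longlonglongrightarrow> \<Phi> u t"
    proof (rule tendstoI)
      fix e :: real assume e: "e > 0"
      \<comment> \<open>Compensates for the largest value \<open>exp (lam * T)\<close> of the weight.\<close>
      define e' where "e' = e / (2 * exp (lam * T))"
      have e': "e' > 0" "e' * exp (lam * T) < e" using e by (auto simp: e'_def)
      from uniform_limitD[OF lim e'(1)]
      show "\<forall>\<^sub>F m in sequentially. dist (us (Suc m) t) (\<Phi> u t) < e"
      proof eventually_elim
        case (elim m)
        have "e' * 1 \<le> e' * exp (lam * s)" if "s \<in> {0..T}" for s
          using e' that lam by (intro mult_left_mono) auto
        then have "\<bar>us m s - u s\<bar> \<le> e' * exp (lam * s)" if "s \<in> {0..T}" for s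
          using elim that by (force simp: dist_real_def)
        from contr[OF iter_in[OF us, of m] u _ this t] e' have "\<bar>\<Phi> (us m) t - \<Phi> u t\<bar> \<le> \<theta> * (e' * exp (lam * t))"
          by (simp add: mult.assoc)
        also have "\<dots> \<le> 1 * (e' * exp (lam * T))"
          using \<theta> e' t lam by (intro mult_mono) (auto intro: mult_left_mono)
        finally show ?case using e' us(2) by (simp add: dist_real_def)
      qed
    qed
  qed
  then have fix_u: "\<Phi> u = u"
    using maps[OF u] u by (intro extensionalityI[of _ "{0..T}"]) (auto simp: cont_space_def)
  moreover have "uniform_limit {0..T} vs u sequentially"
    if vs: "vs 0 \<in> cont_space T" "\<forall>m. vs (Suc m) = \<Phi> (vs m)" for vs
  proof -
    obtain M where M: "M \<ge> 0" "\<And>t. t \<in> {0..T} \<Longrightarrow> \<bar>vs 0 t - u t\<bar> \<le> M"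
      using cont_space_bounded[OF vs(1) u] by blast
    have bd: "\<bar>vs m t - u t\<bar> \<le> M * exp (lam * T) * \<theta> ^ m" if "t \<in> {0..T}" for m t
      using geom[of vs "\<lambda>_. u" M t m] vs u fix_u M that by simp
    have "(\<lambda>m. M * exp (lam * T) * \<theta> ^ m) \<longlonglongrightarrow> 0"
      using \<theta> by (intro tendsto_mult_right_zero LIMSEQ_realpow_zero) auto
    show ?thesis
    proof (rule uniform_limitI)
      fix e :: real assume "e > 0"
      with \<open>(\<lambda>m. M * exp (lam * T) * \<theta> ^ m) \<longlonglongrightarrow> 0\<close>
      have "\<forall>\<^sub>F m in sequentially. M * exp (lam * T) * \<theta> ^ m < e" by (rule order_tendstoD(2))
      then show "\<forall>\<^sub>F m in sequentially. \<forall>t\<in>{0..T}. dist (vs m t) (u t) < e"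
        by eventually_elim (auto simp: dist_real_def intro: le_less_trans[OF bd])
    qed
  qed
  ultimately show ?thesis using u by blast
qed

locale kernel_setting =
  fixes T :: real and n N :: nat and \<alpha> :: "nat \<Rightarrow> real"
    and K K' :: "nat \<Rightarrow> real \<Rightarrow> real \<Rightarrow> real"
  assumes T: "T > 0" and n: "n \<ge> 1"
    and \<alpha>0: "\<alpha> 0 = 0" and \<alpha>n: "\<alpha> n = 1" and \<alpha>_Suc: "\<forall>i<n. \<alpha> i < \<alpha> (Suc i)"
    and C1: "\<forall>i\<in>{1..n}. C1_in_t T (K i) (K' i)"
    and cond_A: "condition_A T n \<alpha> K N"
begin

lemma K_cont: "i \<in> {1..n} \<Longrightarrow> continuous_on (triangle T) (\<lambda>(t, s). K i t s)"
  and K'_cont: "i \<in> {1..n} \<Longrightarrow> continuous_on (triangle T) (\<lambda>(t, s). K' i t s)"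
  using C1 by (auto simp: C1_in_t_def)

lemma \<alpha>_nonneg: "i \<le> n \<Longrightarrow> 0 \<le> \<alpha> i" and \<alpha>_le_1: "i \<le> n \<Longrightarrow> \<alpha> i \<le> 1"
  using breakpoints_le[OF \<alpha>_Suc, of 0 i] breakpoints_le[OF \<alpha>_Suc, of i n] \<alpha>0 \<alpha>n by auto

lemma \<alpha>_pos: "1 \<le> i \<Longrightarrow> i \<le> n \<Longrightarrow> 0 < \<alpha> i"
  using breakpoints_less[OF \<alpha>_Suc, of 0 i] \<alpha>0 by auto

lemma \<alpha>_mono: "i \<le> j \<Longrightarrow> j \<le> n \<Longrightarrow> \<alpha> i \<le> \<alpha> j"
  using breakpoints_le[OF \<alpha>_Suc] .

lemma scaled_le: "i \<le> n \<Longrightarrow> 0 \<le> t \<Longrightarrow> \<alpha> i * t \<le> t"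
  using \<alpha>_nonneg \<alpha>_le_1 by (intro mult_left_le_one_le) auto

lemma scaled_in: "i \<le> n \<Longrightarrow> t \<in> {0..T} \<Longrightarrow> \<alpha> i * t \<in> {0..T}"
  using scaled_le[of i t] \<alpha>_nonneg[of i] by auto

lemma scaled_triangle: "i \<le> n \<Longrightarrow> t \<in> {0..T} \<Longrightarrow> (t, \<alpha> i * t) \<in> triangle T"
  using scaled_le[of i t] \<alpha>_nonneg[of i] by (auto simp: triangle_def)

lemma diag_nonzero: "t \<in> {0..T} \<Longrightarrow> K n t t \<noteq> 0"
  using cond_A by (auto simp: condition_A_def)

lemma diag_continuous: "continuous_on {0..T} (\<lambda>t. K n t t)"
  using n by (intro continuous_on_kernel_compose[OF K_cont[of n]] continuous_intros) (auto simp: triangle_def)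

lemma boundary_continuous:
  "i \<in> {1..n} \<Longrightarrow> j \<le> n \<Longrightarrow> continuous_on {0..T} (\<lambda>t. K i t (\<alpha> j * t))"
  using scaled_triangle[of j]
  by (intro continuous_on_kernel_compose[OF K_cont[of i]] continuous_intros) auto

lemma scaled_continuous:
  assumes "j \<le> n" "continuous_on {0..T} u"
  shows "continuous_on {0..T} (\<lambda>t. u (\<alpha> j * t))"
proof (rule continuous_on_compose2[OF assms(2)])
  show "continuous_on {0..T} (\<lambda>t. \<alpha> j * t)" by (intro continuous_intros)
  show "(\<lambda>t. \<alpha> j * t) ` {0..T} \<subseteq> {0..T}" using scaled_in[OF assms(1)] by blast
qed

text \<open>The sum in Condition A without the term \<open>i = n\<close> at \<open>\<alpha> n = 1\<close>, which belongs to the diagonal and is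
  turned into the identity by the normalisation of \<open>op_L0\<close>.\<close>

definition off_diagonal :: "real \<Rightarrow> real" where
  "off_diagonal t = (\<Sum>i=1..<n. \<alpha> i ^ (1 + N) * \<bar>K i t (\<alpha> i * t)\<bar>)
     + (\<Sum>i=1..n. \<alpha> (i - 1) ^ (1 + N) * \<bar>K i t (\<alpha> (i - 1) * t)\<bar>)"

lemma sum_split_last: "(\<Sum>i=1..n. g i) = (\<Sum>i=1..<n. g i) + (g n :: real)"
proof -
  have "{1..n} = insert n {1..<n}" using n by auto
  then show ?thesis by simp
qed

lemma contraction_constant:
  obtains q where "0 \<le> q" "q < 1" "\<And>t. t \<in> {0..T} \<Longrightarrow> off_diagonal t \<le> q * \<bar>K n t t\<bar>"
proof -
  from cond_A obtain q where q: "q < 1" "\<And>t. t \<in> {0..T} \<Longrightarrow> inverse \<bar>K n t t\<bar> *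
          (\<Sum>i=1..n. \<alpha> i ^ (1 + N) * \<bar>K i t (\<alpha> i * t)\<bar>
                    + \<alpha> (i - 1) ^ (1 + N) * \<bar>K i t (\<alpha> (i - 1) * t)\<bar>) \<le> 1 + q"
    unfolding condition_A_def by blast
  have *: "off_diagonal t \<le> q * \<bar>K n t t\<bar>" if "t \<in> {0..T}" for t
  proof -
    have "(\<Sum>i=1..n. \<alpha> i ^ (1 + N) * \<bar>K i t (\<alpha> i * t)\<bar> + \<alpha> (i - 1) ^ (1 + N) * \<bar>K i t (\<alpha> (i - 1) * t)\<bar>)
        = off_diagonal t + \<bar>K n t t\<bar>"
      unfolding sum.distrib sum_split_last[of "\<lambda>i. \<alpha> i ^ (1 + N) * _ i"] off_diagonal_def
      by (simp add: \<alpha>n)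
    then show ?thesis using q(2)[OF that] diag_nonzero[OF that] by (simp add: field_simps)
  qed
  have "0 \<le> off_diagonal 0"
    unfolding off_diagonal_def
    by (intro add_nonneg_nonneg sum_nonneg mult_nonneg_nonneg zero_le_power) (use \<alpha>_nonneg in auto)
  with *[of 0] T have "0 \<le> q * \<bar>K n 0 0\<bar>" by simp
  then have "0 \<le> q" using diag_nonzero[of 0] T by (simp add: zero_le_mult_iff)
  with q(1) * show ?thesis using that by blast
qed

lemma L0_in_cont_space:
  assumes "u \<in> cont_space T"
  shows "op_L0 T n \<alpha> K N u \<in> cont_space T"
proof -
  have u: "continuous_on {0..T} u" using assms by (simp add: cont_space_def)
  have "continuous_on {0..T} (\<lambda>t. 1 / K n t t *
     (\<Sum>i=1..n. \<alpha> i ^ (1 + N) * K i t (\<alpha> i * t) * u (\<alpha> i * t)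
               - \<alpha> (i - 1) ^ (1 + N) * K i t (\<alpha> (i - 1) * t) * u (\<alpha> (i - 1) * t)))"
    using diag_nonzero
    by (intro continuous_intros diag_continuous boundary_continuous scaled_continuous u) auto
  then show ?thesis
    unfolding op_L0_def by (rule restrict_in_cont_space)
qed

lemma L0_diff:
  assumes w: "\<And>s. s \<in> {0..T} \<Longrightarrow> w s = u s - v s" and t: "t \<in> {0..T}"
  shows "op_L0 T n \<alpha> K N w t = op_L0 T n \<alpha> K N u t - op_L0 T n \<alpha> K N v t"
proof -
  define A where "A i = \<alpha> i ^ (1 + N) * K i t (\<alpha> i * t)" for i
  define B where "B i = \<alpha> (i - 1) ^ (1 + N) * K i t (\<alpha> (i - 1) * t)" for i
  have L: "op_L0 T n \<alpha> K N w t = 1 / K n t t * (\<Sum>i=1..n. A i * w (\<alpha> i * t) - B i * w (\<alpha> (i - 1) * t))" for w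
    using t by (simp add: op_L0_def A_def B_def)
  have "(\<Sum>i=1..n. A i * w (\<alpha> i * t) - B i * w (\<alpha> (i - 1) * t))
      = (\<Sum>i=1..n. (A i * u (\<alpha> i * t) - B i * u (\<alpha> (i - 1) * t)) - (A i * v (\<alpha> i * t) - B i * v (\<alpha> (i - 1) * t)))"
  proof (rule sum.cong[OF refl])
    fix i assume "i \<in> {1..n}"
    then have "w (\<alpha> i * t) = u (\<alpha> i * t) - v (\<alpha> i * t)" "w (\<alpha> (i - 1) * t) = u (\<alpha> (i - 1) * t) - v (\<alpha> (i - 1) * t)"
      using t by (intro w scaled_in; auto)+
    then show "A i * w (\<alpha> i * t) - B i * w (\<alpha> (i - 1) * t)
        = (A i * u (\<alpha> i * t) - B i * u (\<alpha> (i - 1) * t)) - (A i * v (\<alpha> i * t) - B i * v (\<alpha> (i - 1) * t))"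
      by (simp add: right_diff_distrib)
  qed
  also have "\<dots> = (\<Sum>i=1..n. A i * u (\<alpha> i * t) - B i * u (\<alpha> (i - 1) * t))
      - (\<Sum>i=1..n. A i * v (\<alpha> i * t) - B i * v (\<alpha> (i - 1) * t))"
    by (rule sum_subtractf)
  finally show ?thesis unfolding L by (simp only: right_diff_distrib)
qed

text \<open>Since \<open>\<alpha> i * t \<le> t\<close>, evaluation at \<open>\<alpha> i * t\<close> does not increase the increasing bound
  \<open>M * exp (lam * t)\<close>. Thus \<open>op_L0\<close> differs from the identity by an operator of norm at most \<open>q\<close> in
  every weighted norm, not only in the uniform one.\<close>

lemma L0_near_identity:
  assumes q: "0 \<le> q" "\<And>t. t \<in> {0..T} \<Longrightarrow> off_diagonal t \<le> q * \<bar>K n t t\<bar>"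
    and d: "\<And>t. t \<in> {0..T} \<Longrightarrow> \<bar>u t - v t\<bar> \<le> M * exp (lam * t)" and M: "M \<ge> 0" and lam: "lam \<ge> 0"
    and t: "t \<in> {0..T}"
  shows "\<bar>(u t - v t) - (op_L0 T n \<alpha> K N u t - op_L0 T n \<alpha> K N v t)\<bar> \<le> q * (M * exp (lam * t))"
proof -
  define d where "d t = u t - v t" for t
  define E where "E = M * exp (lam * t)"
  have dE: "\<bar>d (\<alpha> i * t)\<bar> \<le> E" if "i \<le> n" for i
  proof -
    have "\<bar>d (\<alpha> i * t)\<bar> \<le> M * exp (lam * (\<alpha> i * t))" using d scaled_in[OF that t] by (simp add: d_def)
    also have "\<dots> \<le> E" unfolding E_def
      using M lam scaled_le[OF that, of t] t by (intro mult_left_mono) (auto intro: mult_left_mono)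
    finally show ?thesis .
  qed
  define A where "A i = \<alpha> i ^ (1 + N) * K i t (\<alpha> i * t)" for i
  define B where "B i = \<alpha> (i - 1) ^ (1 + N) * K i t (\<alpha> (i - 1) * t)" for i
  define S where "S = (\<Sum>i=1..<n. A i * d (\<alpha> i * t)) - (\<Sum>i=1..n. B i * d (\<alpha> (i - 1) * t))"
  have "op_L0 T n \<alpha> K N u t - op_L0 T n \<alpha> K N v t
     = 1 / K n t t * (\<Sum>i=1..n. A i * d (\<alpha> i * t) - B i * d (\<alpha> (i - 1) * t))"
    using L0_diff[of d u v t] t by (simp add: d_def op_L0_def A_def B_def)
  also have "(\<Sum>i=1..n. A i * d (\<alpha> i * t) - B i * d (\<alpha> (i - 1) * t)) = S + K n t t * d t"
    unfolding sum_subtractf S_def sum_split_last[of "\<lambda>i. A i * d (\<alpha> i * t)"]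
    by (simp add: A_def \<alpha>n)
  finally have eq: "d t - (op_L0 T n \<alpha> K N u t - op_L0 T n \<alpha> K N v t) = - S / K n t t"
    using diag_nonzero[OF t] by (simp add: field_simps)
  have "\<bar>S\<bar> \<le> (\<Sum>i=1..<n. \<bar>A i * d (\<alpha> i * t)\<bar>) + (\<Sum>i=1..n. \<bar>B i * d (\<alpha> (i - 1) * t)\<bar>)"
    unfolding S_def by (intro order_trans[OF abs_triangle_ineq4] add_mono sum_abs)
  also have "\<dots> \<le> (\<Sum>i=1..<n. \<bar>A i\<bar> * E) + (\<Sum>i=1..n. \<bar>B i\<bar> * E)"
    unfolding abs_mult by (intro add_mono sum_mono mult_left_mono dE) auto
  also have "\<dots> = off_diagonal t * E"
    unfolding sum_distrib_right[symmetric] distrib_right[symmetric] off_diagonal_def A_def B_def abs_mult power_abs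
    using \<alpha>_nonneg by (intro arg_cong2[where f = "(*)"] arg_cong2[where f = "(+)"] sum.cong refl) auto
  also have "\<dots> \<le> q * \<bar>K n t t\<bar> * E"
    using M by (intro mult_right_mono q t) (simp add: E_def)
  finally show ?thesis
    using diag_nonzero[OF t] unfolding d_def[symmetric] eq E_def[symmetric] by (simp add: abs_divide field_simps)
qed

text \<open>At a point where the weighted difference is maximal, \<open>L0_near_identity\<close> bounds the maximum by \<open>M\<close>
  plus \<open>q\<close> times itself.\<close>

lemma L0_inverse_estimate:
  assumes q: "0 \<le> q" "q < 1" "\<And>t. t \<in> {0..T} \<Longrightarrow> off_diagonal t \<le> q * \<bar>K n t t\<bar>"
    and uv: "u \<in> cont_space T" "v \<in> cont_space T" and lam: "lam \<ge> 0"
    and L: "\<And>t. t \<in> {0..T} \<Longrightarrow> \<bar>op_L0 T n \<alpha> K N u t - op_L0 T n \<alpha> K N v t\<bar> \<le> M * exp (lam * t)"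
    and t: "t \<in> {0..T}"
  shows "\<bar>u t - v t\<bar> \<le> M / (1 - q) * exp (lam * t)"
proof -
  have "continuous_on {0..T} (\<lambda>t. \<bar>u t - v t\<bar> * exp (- lam * t))"
    using uv by (intro continuous_intros) (auto simp: cont_space_def)
  from continuous_attains_sup[OF compact_Icc _ this] t obtain t' where t': "t' \<in> {0..T}"
    "\<And>t. t \<in> {0..T} \<Longrightarrow> \<bar>u t - v t\<bar> * exp (- lam * t) \<le> \<bar>u t' - v t'\<bar> * exp (- lam * t')"
    by blast
  define S where "S = \<bar>u t' - v t'\<bar> * exp (- lam * t')"
  have S: "\<bar>u t - v t\<bar> \<le> S * exp (lam * t)" if "t \<in> {0..T}" for t
    using t'(2)[OF that] unfolding S_def[symmetric] by (simp add: exp_minus field_simps)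
  have "S \<ge> 0" by (simp add: S_def)
  from L0_near_identity[OF q(1,3) S this lam t'(1)] L[OF t'(1)]
  have "\<bar>u t' - v t'\<bar> \<le> (M + q * S) * exp (lam * t')" by (simp add: algebra_simps)
  moreover have "\<bar>u t' - v t'\<bar> = S * exp (lam * t')" by (simp add: S_def exp_minus)
  ultimately have "S \<le> M + q * S" by simp
  then have "S \<le> M / (1 - q)" using q by (simp add: field_simps)
  with S[OF t] show ?thesis by (meson exp_ge_zero mult_right_mono order_trans)
qed

lemma zero_in_cont_space: "restrict (\<lambda>_. 0 :: real) {0..T} \<in> cont_space T"
  by (intro restrict_in_cont_space continuous_intros)

text \<open>A preimage of \<open>w\<close> is a fixed point of the contraction \<open>u \<mapsto> w + u - op_L0 u\<close>.\<close>

lemma L0_bij: "bij_betw (op_L0 T n \<alpha> K N) (cont_space T) (cont_space T)"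
proof -
  obtain q where q: "0 \<le> q" "q < 1" "\<And>t. t \<in> {0..T} \<Longrightarrow> off_diagonal t \<le> q * \<bar>K n t t\<bar>"
    using contraction_constant by blast
  have "inj_on (op_L0 T n \<alpha> K N) (cont_space T)"
  proof (rule inj_onI)
    fix u v assume uv: "u \<in> cont_space T" "v \<in> cont_space T" "op_L0 T n \<alpha> K N u = op_L0 T n \<alpha> K N v"
    have "u t = v t" if "t \<in> {0..T}" for t
      using L0_inverse_estimate[OF q uv(1,2), of 0 0 t] uv(3) that by simp
    then show "u = v" using uv by (intro extensionalityI[of _ "{0..T}"]) (auto simp: cont_space_def)
  qed
  moreover have "w \<in> op_L0 T n \<alpha> K N ` cont_space T" if w: "w \<in> cont_space T" for w
  proof -
    define \<Phi> where "\<Phi> u = (\<lambda>t\<in>{0..T}. w t + u t - op_L0 T n \<alpha> K N u t)" for u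
    have "\<exists>u\<in>cont_space T. \<Phi> u = u \<and> (\<forall>us. us 0 \<in> cont_space T \<and> (\<forall>m. us (Suc m) = \<Phi> (us m)) \<longrightarrow>
        uniform_limit {0..T} us u sequentially)"
    proof (rule weighted_contraction_fixed_point[where lam = 0 and \<theta> = q])
      fix u assume u: "u \<in> cont_space T"
      have "continuous_on {0..T} (\<lambda>t. w t + u t - op_L0 T n \<alpha> K N u t)"
        using w u L0_in_cont_space[OF u] by (intro continuous_intros) (auto simp: cont_space_def)
      then show "\<Phi> u \<in> cont_space T" unfolding \<Phi>_def by (rule restrict_in_cont_space)
    next
      fix u v M t assume "u \<in> cont_space T" "v \<in> cont_space T" "0 \<le> M"
        and d: "\<And>t. t \<in> {0..T} \<Longrightarrow> \<bar>u t - v t\<bar> \<le> M * exp (0 * t)" and t: "t \<in> {0..T}"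
      from L0_near_identity[OF q(1,3) d _ _ t] \<open>0 \<le> M\<close> t
      show "\<bar>\<Phi> u t - \<Phi> v t\<bar> \<le> q * M * exp (0 * t)" by (simp add: \<Phi>_def algebra_simps)
    qed (use q in auto)
    then obtain u where u: "u \<in> cont_space T" "\<Phi> u = u" by blast
    have "op_L0 T n \<alpha> K N u t = w t" if "t \<in> {0..T}" for t
      using fun_cong[OF u(2), of t] that by (simp add: \<Phi>_def)
    then have "op_L0 T n \<alpha> K N u = w"
      using w L0_in_cont_space[OF u(1)] by (intro extensionalityI[of _ "{0..T}"]) (auto simp: cont_space_def)
    then show ?thesis using u by blast
  qed
  ultimately show ?thesis using L0_in_cont_space by (auto simp: bij_betw_def)
qed

lemma L0_inv_in_cont_space: "w \<in> cont_space T \<Longrightarrow> op_L0_inv T n \<alpha> K N w \<in> cont_space T"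
  and L0_L0_inv: "w \<in> cont_space T \<Longrightarrow> op_L0 T n \<alpha> K N (op_L0_inv T n \<alpha> K N w) = w"
  using L0_bij unfolding op_L0_inv_def
  by (auto simp: bij_betw_def inv_into_into f_inv_into_f)

lemma L0_inv_bounded: "L0_boundedly_invertible T n \<alpha> K N"
proof -
  obtain q where q: "0 \<le> q" "q < 1" "\<And>t. t \<in> {0..T} \<Longrightarrow> off_diagonal t \<le> q * \<bar>K n t t\<bar>"
    using contraction_constant by blast
  have "sup_norm T (op_L0_inv T n \<alpha> K N w) \<le> 1 / (1 - q) * sup_norm T w" if w: "w \<in> cont_space T" for w
  proof -
    obtain M where "\<And>t. t \<in> {0..T} \<Longrightarrow> \<bar>w t - restrict (\<lambda>_. 0) {0..T} t\<bar> \<le> M"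
      using cont_space_bounded[OF w zero_in_cont_space] by blast
    then have bdd: "bdd_above ((\<lambda>t. \<bar>w t\<bar>) ` {0..T})" by (intro bdd_aboveI2[where M = M]) simp
    have "\<bar>op_L0_inv T n \<alpha> K N w t\<bar> \<le> 1 / (1 - q) * sup_norm T w" if t: "t \<in> {0..T}" for t
    proof -
      have "\<bar>op_L0_inv T n \<alpha> K N w t - restrict (\<lambda>_. 0) {0..T} t\<bar> \<le> sup_norm T w / (1 - q) * exp (0 * t)"
      proof (rule L0_inverse_estimate[where lam = 0 and M = "sup_norm T w",
            OF q L0_inv_in_cont_space[OF w] zero_in_cont_space order_refl _ t])
        fix t assume t: "t \<in> {0..T}"
        have "op_L0 T n \<alpha> K N (restrict (\<lambda>_. 0) {0..T}) t = 0"
          using t scaled_in by (auto simp: op_L0_def intro!: sum.neutral)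
        then show "\<bar>op_L0 T n \<alpha> K N (op_L0_inv T n \<alpha> K N w) t - op_L0 T n \<alpha> K N (restrict (\<lambda>_. 0) {0..T}) t\<bar>
            \<le> sup_norm T w * exp (0 * t)"
          using cSUP_upper[OF t bdd] by (simp add: L0_L0_inv[OF w] sup_norm_def)
      qed
      then show ?thesis using t by simp
    qed
    then show ?thesis unfolding sup_norm_def using T by (intro cSUP_least) auto
  qed
  with L0_bij show ?thesis unfolding L0_boundedly_invertible_def by blast
qed

lemma scaled_kernel_bound:
  obtains D where "D \<ge> 0" "\<And>i t s. i \<in> {1..n} \<Longrightarrow> (t, s) \<in> triangle T \<Longrightarrow> \<bar>K' i t s / K n t t\<bar> \<le> D"
proof -
  have "\<exists>D\<ge>0. \<forall>(t, s)\<in>triangle T. \<bar>K' i t s / K n t t\<bar> \<le> D" if i: "i \<in> {1..n}" for i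
  proof -
    have "continuous_on (triangle T) (\<lambda>(t, s). K' i t s / K n t t)"
      unfolding case_prod_unfold
      using n diag_nonzero i
      by (intro continuous_on_divide continuous_on_kernel_compose[OF K'_cont[OF i]]
          continuous_on_kernel_compose[OF K_cont[of n]] continuous_intros) (auto simp: triangle_def)
    then obtain D where "D \<ge> 0" "\<And>t s. (t, s) \<in> triangle T \<Longrightarrow> \<bar>K' i t s / K n t t\<bar> \<le> D"
      using kernel_bounded[of T "\<lambda>t s. K' i t s / K n t t"] by blast
    then show ?thesis by blast
  qed
  then have "\<forall>i\<in>{1..n}. \<exists>D. D \<ge> 0 \<and> (\<forall>(t, s)\<in>triangle T. \<bar>K' i t s / K n t t\<bar> \<le> D)" by blast
  from bchoice[OF this] obtain D where
    D: "\<And>i. i \<in> {1..n} \<Longrightarrow> D i \<ge> 0 \<and> (\<forall>(t, s)\<in>triangle T. \<bar>K' i t s / K n t t\<bar> \<le> D i)"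
    by blast
  have "D i \<le> (\<Sum>i=1..n. D i)" if "i \<in> {1..n}" for i
    using D that by (intro member_le_sum) auto
  moreover have "(\<Sum>i=1..n. D i) \<ge> 0" using D by (intro sum_nonneg) auto
  ultimately show ?thesis using that[of "\<Sum>i=1..n. D i"] D by fastforce
qed

lemma V_interval:
  assumes "i \<in> {1..n}" "t \<ge> 0" "s \<in> {\<alpha> (i - 1) * t..\<alpha> i * t}"
  shows "0 \<le> s \<and> s \<le> t"
proof -
  have "0 \<le> \<alpha> (i - 1) * t" "\<alpha> i * t \<le> t"
    using assms(1,2) \<alpha>_nonneg[of "i - 1"] scaled_le[of i t] by auto
  with assms(3) show ?thesis by (meson atLeastAtMost_iff order_trans)
qed

lemma V_integrand_continuous:
  assumes "i \<in> {1..n}" "t \<in> {0<..T}" "continuous_on {0..T} u"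
  shows "continuous_on {\<alpha> (i - 1) * t..\<alpha> i * t} (\<lambda>s. K' i t s / K n t t * (s / t) ^ N * u s)"
proof -
  have sub: "s \<in> {0..t}" if "s \<in> {\<alpha> (i - 1) * t..\<alpha> i * t}" for s
    using V_interval[of i t s] that assms by auto
  then have sub': "{\<alpha> (i - 1) * t..\<alpha> i * t} \<subseteq> {0..T}" using assms(2) by fastforce
  have "continuous_on {\<alpha> (i - 1) * t..\<alpha> i * t} (K' i t)"
    using sub assms by (intro continuous_on_kernel_compose[OF K'_cont] continuous_intros) (auto simp: triangle_def)
  then show ?thesis
    using assms diag_nonzero[of t] by (intro continuous_intros continuous_on_subset[OF assms(3) sub']) auto
qed

text \<open>A Volterra estimate against an arbitrary weight \<open>w\<close> with antiderivative \<open>W\<close>. With \<open>w = 1\<close> it shows that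
  \<open>op_V u\<close> tends to zero at \<open>0\<close>; with \<open>w = exp (lam * t)\<close> it gains the factor \<open>1 / lam\<close>. The pieces
  telescope, because they partition \<open>[0, t]\<close>.\<close>

lemma V_difference_estimate:
  assumes D: "D \<ge> 0" "\<And>i t s. i \<in> {1..n} \<Longrightarrow> (t, s) \<in> triangle T \<Longrightarrow> \<bar>K' i t s / K n t t\<bar> \<le> D"
    and uv: "u \<in> cont_space T" "v \<in> cont_space T"
    and w: "\<And>s. s \<in> {0..T} \<Longrightarrow> \<bar>u s - v s\<bar> \<le> M * w s" and W: "\<And>s. s \<in> {0..T} \<Longrightarrow> (W has_real_derivative w s) (at s within {0..T})"
    and t: "t \<in> {0..T}"
  shows "\<bar>op_V T n \<alpha> K K' N u t - op_V T n \<alpha> K K' N v t\<bar> \<le> D * M * (W t - W 0)"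
proof (cases "t = 0")
  case True
  then show ?thesis using t by (simp add: op_V_def)
next
  case False
  then have t0: "t \<in> {0<..T}" using t by auto
  have cuv: "continuous_on {0..T} u" "continuous_on {0..T} v" using uv by (auto simp: cont_space_def)
  let ?I = "\<lambda>i. {\<alpha> (i - 1) * t..\<alpha> i * t}"
  let ?F = "\<lambda>u i s. K' i t s / K n t t * (s / t) ^ N * u s"
  have int: "(?F u i) integrable_on ?I i" "(?F v i) integrable_on ?I i" if "i \<in> {1..n}" for i
    using V_integrand_continuous[OF that t0] cuv by (auto intro: integrable_continuous_real)
  have piece: "\<bar>integral (?I i) (?F u i) - integral (?I i) (?F v i)\<bar> \<le> D * M * (W (\<alpha> i * t) - W (\<alpha> (i - 1) * t))"
    if i: "i \<in> {1..n}" for i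
  proof -
    have le: "\<alpha> (i - 1) * t \<le> \<alpha> i * t" using \<alpha>_mono[of "i - 1" i] i t by (intro mult_right_mono) auto
    have sub: "0 \<le> s \<and> s \<le> t" if "s \<in> ?I i" for s
      using V_interval[of i t s] that i t by auto
    have subT: "?I i \<subseteq> {0..T}" using sub t by fastforce
    have hasw: "(w has_integral W (\<alpha> i * t) - W (\<alpha> (i - 1) * t)) (?I i)"
      using le subT
      by (intro fundamental_theorem_of_calculus)
        (auto simp: has_real_derivative_iff_has_vector_derivative[symmetric] intro: DERIV_subset[OF W])
    have eq: "integral (?I i) (?F u i) - integral (?I i) (?F v i) = integral (?I i) (\<lambda>s. ?F u i s - ?F v i s)"
      using int[OF i] by (rule Henstock_Kurzweil_Integration.integral_diff[symmetric])
    have "norm (integral (?I i) (\<lambda>s. ?F u i s - ?F v i s)) \<le> integral (?I i) (\<lambda>s. D * M * w s)"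
    proof (rule integral_norm_bound_integral)
      show "(\<lambda>s. ?F u i s - ?F v i s) integrable_on ?I i" using int[OF i] by (rule integrable_diff)
      show "(\<lambda>s. D * M * w s) integrable_on ?I i" using hasw by (intro integrable_on_mult_right) blast
      fix s assume s: "s \<in> ?I i"
      have 1: "\<bar>K' i t s / K n t t\<bar> \<le> D" using sub[OF s] i t by (intro D) (auto simp: triangle_def)
      have 2: "\<bar>(s / t) ^ N\<bar> \<le> 1" using sub[OF s] t0 by (simp add: power_le_one)
      have 3: "\<bar>u s - v s\<bar> \<le> M * w s" using sub[OF s] t by (intro w) auto
      have "\<bar>K' i t s / K n t t * (s / t) ^ N * (u s - v s)\<bar> \<le> D * 1 * (M * w s)"
        unfolding abs_mult by (intro mult_mono 1 2 3) (use D in auto)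
      then show "norm (?F u i s - ?F v i s) \<le> D * M * w s"
        by (simp only: right_diff_distrib real_norm_def mult_1_right mult.assoc)
    qed
    moreover have "integral (?I i) (\<lambda>s. D * M * w s) = D * M * (W (\<alpha> i * t) - W (\<alpha> (i - 1) * t))"
      using hasw by (simp add: integral_unique)
    ultimately show ?thesis unfolding eq real_norm_def by (rule subst[rotated])
  qed
  have tele: "(\<Sum>i=1..n. W (\<alpha> i * t) - W (\<alpha> (i - 1) * t)) = W t - W 0"
    using sum_natinterval_diff[of "\<lambda>i. - W (\<alpha> (i - 1) * t)" 1 n] n \<alpha>0 \<alpha>n by (simp add: algebra_simps)
  have "op_V T n \<alpha> K K' N u t - op_V T n \<alpha> K K' N v t
      = (\<Sum>i=1..n. integral (?I i) (?F u i) - integral (?I i) (?F v i))"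
    using t False by (simp add: op_V_def sum_subtractf)
  moreover have "\<bar>\<Sum>i=1..n. integral (?I i) (?F u i) - integral (?I i) (?F v i)\<bar>
      \<le> (\<Sum>i=1..n. D * M * (W (\<alpha> i * t) - W (\<alpha> (i - 1) * t)))"
    by (rule order_trans[OF sum_abs]) (intro sum_mono piece)
  ultimately show ?thesis unfolding sum_distrib_left[symmetric] tele by (simp only:)
qed

text \<open>Expressed through \<open>kernel_int\<close>, \<open>op_V u\<close> inherits continuity away from \<open>0\<close>.\<close>

lemma V_eq:
  assumes u: "continuous_on {0..T} u" and t: "t \<in> {0<..T}"
  shows "op_V T n \<alpha> K K' N u t = pw_integral n \<alpha> K' (\<lambda>s. s ^ N * u s) t / (K n t t * t ^ N)"
proof -
  let ?\<phi> = "\<lambda>s. s ^ N * u s"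
  have \<phi>: "?\<phi> absolutely_integrable_on {0..T}"
    by (intro absolutely_integrable_continuous_real continuous_intros u)
  have "integral {\<alpha> (i - 1) * t..\<alpha> i * t} (\<lambda>s. K' i t s / K n t t * (s / t) ^ N * u s)
      = (kernel_int (\<alpha> i) (K' i) ?\<phi> t - kernel_int (\<alpha> (i - 1)) (K' i) ?\<phi> t) / (K n t t * t ^ N)"
    if i: "i \<in> {1..n}" for i
  proof -
    have "((\<lambda>s. K' i t s * ?\<phi> s) has_integral kernel_int (\<alpha> i) (K' i) ?\<phi> t - kernel_int (\<alpha> (i - 1)) (K' i) ?\<phi> t)
        {\<alpha> (i - 1) * t..\<alpha> i * t}"
      using i t \<alpha>_nonneg[of "i - 1"] \<alpha>_mono[of "i - 1" i] \<alpha>_le_1[of i]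
      by (intro kernel_piece_integral[OF K'_cont[OF i] \<phi>]) auto
    from has_integral_divide[OF this, of "K n t t * t ^ N"] show ?thesis
      by (intro integral_unique) (simp add: power_divide mult_ac)
  qed
  then show ?thesis
    using t by (simp add: op_V_def pw_integral_def sum_divide_distrib)
qed

lemma pw_integral_continuous:
  assumes k: "\<And>i. i \<in> {1..n} \<Longrightarrow> continuous_on (triangle T) (\<lambda>(t, s). k i t s)"
    and \<phi>: "\<phi> absolutely_integrable_on {0..T}"
  shows "continuous_on {0..T} (pw_integral n \<alpha> k \<phi>)"
  unfolding pw_integral_def[abs_def]
  using \<alpha>_nonneg \<alpha>_le_1 by (intro continuous_intros kernel_int_continuous[OF k \<phi>]) auto

lemma continuous_on_Icc_0I:
  assumes "continuous_on {0<..T} g" "(g \<longlongrightarrow> g 0) (at_right 0)"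
  shows "continuous_on {0..T} (g :: real \<Rightarrow> real)"
  unfolding continuous_on_eq_continuous_within
proof
  fix t assume t: "t \<in> {0..T}"
  show "continuous (at t within {0..T}) g"
  proof (cases "t = 0")
    case True
    then show ?thesis using assms(2) T by (simp add: continuous_within at_within_Icc_at_right)
  next
    case False
    then have "continuous (at t within {0<..T}) g"
      using assms(1) t by (auto simp: continuous_on_eq_continuous_within)
    moreover have "at t within {0<..T} = at t within {0..T}"
      using False t by (intro at_within_nhd[of _ "{0<..}"]) auto
    ultimately show ?thesis by simp
  qed
qed

lemma V_in_cont_space:
  assumes u: "u \<in> cont_space T"
  shows "op_V T n \<alpha> K K' N u \<in> cont_space T"
proof -
  have cu: "continuous_on {0..T} u" using u by (simp add: cont_space_def)
  have "(\<lambda>s. s ^ N * u s) absolutely_integrable_on {0..T}"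
    by (intro absolutely_integrable_continuous_real continuous_intros cu)
  from pw_integral_continuous[OF K'_cont this]
  have "continuous_on {0<..T} (pw_integral n \<alpha> K' (\<lambda>s. s ^ N * u s))"
    by (rule continuous_on_subset) auto
  moreover have "continuous_on {0<..T} (\<lambda>t. K n t t)"
    by (rule continuous_on_subset[OF diag_continuous]) auto
  ultimately have "continuous_on {0<..T} (\<lambda>t. pw_integral n \<alpha> K' (\<lambda>s. s ^ N * u s) t / (K n t t * t ^ N))"
    using diag_nonzero
    by (intro continuous_on_divide continuous_on_mult continuous_on_power continuous_on_id) auto
  then have c: "continuous_on {0<..T} (op_V T n \<alpha> K K' N u)"
    by (rule continuous_on_eq) (simp add: V_eq[OF cu])
  obtain D where D: "D \<ge> 0" "\<And>i t s. i \<in> {1..n} \<Longrightarrow> (t, s) \<in> triangle T \<Longrightarrow> \<bar>K' i t s / K n t t\<bar> \<le> D"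
    using scaled_kernel_bound by blast
  obtain M where M: "M \<ge> 0" "\<And>t. t \<in> {0..T} \<Longrightarrow> \<bar>u t - restrict (\<lambda>_. 0) {0..T} t\<bar> \<le> M"
    using cont_space_bounded[OF u zero_in_cont_space] by blast
  have V0: "op_V T n \<alpha> K K' N (restrict (\<lambda>_. 0) {0..T}) t = 0" if "t \<in> {0..T}" for t
  proof (cases "t = 0")
    case False
    have "kernel_int (\<alpha> j) k (\<lambda>s. s ^ N * restrict (\<lambda>_. 0) {0..T} s) t = 0" if "j \<le> n" for j k
      unfolding kernel_int_def
    proof (rule integral_unique, rule has_integral_is_0)
      fix s assume "s \<in> {0..\<alpha> j * t}"
      then show "k t s * (s ^ N * restrict (\<lambda>_. 0) {0..T} s) = 0"
        using scaled_in[OF \<open>j \<le> n\<close> \<open>t \<in> {0..T}\<close>] by auto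
    qed
    then have "pw_integral n \<alpha> K' (\<lambda>s. s ^ N * restrict (\<lambda>_. 0) {0..T} s) t = 0"
      unfolding pw_integral_def by (intro sum.neutral) auto
    then show ?thesis
      using V_eq[of "restrict (\<lambda>_. 0) {0..T}" t] zero_in_cont_space that False
      by (simp add: cont_space_def)
  qed (use T in \<open>simp add: op_V_def\<close>)
  have bd: "\<bar>op_V T n \<alpha> K K' N u t\<bar> \<le> D * M * t" if t: "t \<in> {0..T}" for t
  proof -
    have "\<bar>op_V T n \<alpha> K K' N u t - op_V T n \<alpha> K K' N (restrict (\<lambda>_. 0) {0..T}) t\<bar> \<le> D * M * (t - 0)"
      by (rule V_difference_estimate[OF D u zero_in_cont_space, where w = "\<lambda>_. 1" and W = "\<lambda>s. s"])
        (use M(2) t in \<open>auto intro: DERIV_ident\<close>)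
    then show ?thesis by (simp add: V0[OF t])
  qed
  have "(op_V T n \<alpha> K K' N u \<longlongrightarrow> 0) (at_right 0)"
  proof (rule Lim_null_comparison)
    show "\<forall>\<^sub>F t in at_right 0. norm (op_V T n \<alpha> K K' N u t) \<le> D * M * t"
      using eventually_at_right_real[OF T] by eventually_elim (use bd in auto)
    show "((\<lambda>t. D * M * t) \<longlongrightarrow> 0) (at_right 0)" by (intro tendsto_eq_intros) auto
  qed
  then have "continuous_on {0..T} (op_V T n \<alpha> K K' N u)"
    using T by (intro continuous_on_Icc_0I[OF c]) (simp add: op_V_def)
  then show ?thesis by (auto simp: cont_space_def op_V_def)
qed

text \<open>The constant \<open>lam\<close> is chosen such that the gain \<open>D / lam\<close> of \<open>op_V\<close> beats the bound \<open>1 / (1 - q)\<close> of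
  the inverse of \<open>op_L0\<close> with a factor \<open>1 / 2\<close> to spare. The limit satisfies \<open>op_L0 u + op_V u = h\<close>.\<close>

lemma successive_approximations_converge:
  assumes h: "h \<in> cont_space T"
  shows "\<exists>u\<in>cont_space T. (\<forall>t\<in>{0..T}. op_L0 T n \<alpha> K N u t + op_V T n \<alpha> K K' N u t = h t) \<and>
    (\<forall>us. successive_approximations T n \<alpha> K K' N h us \<longrightarrow>
       (\<forall>m. us m \<in> cont_space T) \<and> uniform_limit {0..T} us u sequentially)"
proof -
  obtain q where q: "0 \<le> q" "q < 1" "\<And>t. t \<in> {0..T} \<Longrightarrow> off_diagonal t \<le> q * \<bar>K n t t\<bar>"
    using contraction_constant by blast
  obtain D where D: "D \<ge> 0" "\<And>i t s. i \<in> {1..n} \<Longrightarrow> (t, s) \<in> triangle T \<Longrightarrow> \<bar>K' i t s / K n t t\<bar> \<le> D"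
    using scaled_kernel_bound by blast
  define lam where "lam = 2 * (D + 1) / (1 - q)"
  have lam: "lam > 0" using D q by (simp add: lam_def)
  define \<Phi> where "\<Phi> u = (\<lambda>t\<in>{0..T}. op_A T n \<alpha> K K' N u t + op_L0_inv T n \<alpha> K N h t)" for u
  have maps: "\<Phi> u \<in> cont_space T" if u: "u \<in> cont_space T" for u
  proof -
    have "continuous_on {0..T} (\<lambda>t. - op_L0_inv T n \<alpha> K N (op_V T n \<alpha> K K' N u) t + op_L0_inv T n \<alpha> K N h t)"
      using L0_inv_in_cont_space[OF V_in_cont_space[OF u]] L0_inv_in_cont_space[OF h]
      by (intro continuous_on_add continuous_on_minus) (auto simp: cont_space_def)
    then have "restrict (\<lambda>t. - op_L0_inv T n \<alpha> K N (op_V T n \<alpha> K K' N u) t + op_L0_inv T n \<alpha> K N h t) {0..T}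
        \<in> cont_space T" by (rule restrict_in_cont_space)
    moreover have "\<Phi> u = restrict (\<lambda>t. - op_L0_inv T n \<alpha> K N (op_V T n \<alpha> K K' N u) t + op_L0_inv T n \<alpha> K N h t) {0..T}"
      unfolding \<Phi>_def op_A_def by (intro restrict_ext) simp
    ultimately show ?thesis by simp
  qed
  have "\<exists>u\<in>cont_space T. \<Phi> u = u \<and> (\<forall>us. us 0 \<in> cont_space T \<and> (\<forall>m. us (Suc m) = \<Phi> (us m)) \<longrightarrow>
      uniform_limit {0..T} us u sequentially)"
  proof (rule weighted_contraction_fixed_point[where lam = lam and \<theta> = "1 / 2"])
    fix u v M t assume uv: "u \<in> cont_space T" "v \<in> cont_space T" "0 \<le> M"
      and d: "\<And>t. t \<in> {0..T} \<Longrightarrow> \<bar>u t - v t\<bar> \<le> M * exp (lam * t)" and t: "t \<in> {0..T}"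
    have V: "\<bar>op_V T n \<alpha> K K' N u s - op_V T n \<alpha> K K' N v s\<bar> \<le> D * M / lam * exp (lam * s)"
      if s: "s \<in> {0..T}" for s
    proof -
      have "\<bar>op_V T n \<alpha> K K' N u s - op_V T n \<alpha> K K' N v s\<bar>
          \<le> D * M * (exp (lam * s) / lam - exp (lam * 0) / lam)"
        using lam
        by (intro V_difference_estimate[OF D uv(1,2) d, where W = "\<lambda>s. exp (lam * s) / lam"] s)
          (auto intro!: derivative_eq_intros divide_right_mono)
      also have "\<dots> \<le> D * M * (exp (lam * s) / lam)"
        using lam D uv(3) by (intro mult_left_mono) auto
      finally show ?thesis by simp
    qed
    have "\<bar>op_L0_inv T n \<alpha> K N (op_V T n \<alpha> K K' N u) t - op_L0_inv T n \<alpha> K N (op_V T n \<alpha> K K' N v) t\<bar>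
        \<le> D * M / lam / (1 - q) * exp (lam * t)"
      using V lam V_in_cont_space uv
      by (intro L0_inverse_estimate[OF q _ _ _ _ t] L0_inv_in_cont_space) (auto simp: L0_L0_inv)
    also have "D * M / lam / (1 - q) = D / (D + 1) * (M / 2)"
      using q D by (simp add: lam_def)
    also have "\<dots> \<le> 1 / 2 * M" using D uv(3) by (simp add: field_simps)
    finally show "\<bar>\<Phi> u t - \<Phi> v t\<bar> \<le> 1 / 2 * M * exp (lam * t)"
      using t by (simp add: \<Phi>_def op_A_def mult_right_mono abs_minus_commute)
  qed (use maps lam in auto)
  then obtain u where u: "u \<in> cont_space T" "\<Phi> u = u"
    "\<And>us. us 0 \<in> cont_space T \<Longrightarrow> (\<forall>m. us (Suc m) = \<Phi> (us m)) \<Longrightarrow> uniform_limit {0..T} us u sequentially"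
    by blast
  have L: "op_L0 T n \<alpha> K N u t + op_V T n \<alpha> K K' N u t = h t" if t: "t \<in> {0..T}" for t
  proof -
    let ?y = "op_L0_inv T n \<alpha> K N (op_V T n \<alpha> K K' N u)" and ?z = "op_L0_inv T n \<alpha> K N h"
    have us: "u s = ?z s - ?y s" if "s \<in> {0..T}" for s
      using fun_cong[OF u(2), of s] that by (simp add: \<Phi>_def op_A_def)
    have "op_L0 T n \<alpha> K N u t = op_L0 T n \<alpha> K N ?z t - op_L0 T n \<alpha> K N ?y t"
      by (rule L0_diff[OF us t])
    then show ?thesis using L0_L0_inv[OF h] L0_L0_inv[OF V_in_cont_space[OF u(1)]] by simp
  qed
  have "(\<forall>m. us m \<in> cont_space T) \<and> uniform_limit {0..T} us u sequentially"
    if us: "successive_approximations T n \<alpha> K K' N h us" for us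
  proof -
    have *: "us 0 \<in> cont_space T" "\<forall>m. us (Suc m) = \<Phi> (us m)"
      using us by (auto simp: successive_approximations_def \<Phi>_def)
    have "us m \<in> cont_space T" for m by (induction m) (use * maps in auto)
    with u(3)[OF *] show ?thesis by blast
  qed
  with u(1) L show ?thesis by blast
qed

end

section \<open>The asymptotic expansion and the solution\<close>

text \<open>The derivative of \<open>pw_integral\<close> in \<open>t\<close>, that is, the operator on the left-hand side of the
  differentiated equation.\<close>

definition pw_deriv ::
    "nat \<Rightarrow> (nat \<Rightarrow> real) \<Rightarrow> (nat \<Rightarrow> real \<Rightarrow> real \<Rightarrow> real) \<Rightarrow> (nat \<Rightarrow> real \<Rightarrow> real \<Rightarrow> real) \<Rightarrow>
     (real \<Rightarrow> real) \<Rightarrow> real \<Rightarrow> real" where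
  "pw_deriv n \<alpha> K K' \<phi> t =
     (\<Sum>i=1..n. kernel_deriv (\<alpha> i) (K i) (K' i) \<phi> t - kernel_deriv (\<alpha> (i - 1)) (K i) (K' i) \<phi> t)"

lemma leads_Suc:
  assumes "leads N j 0 g"
  shows "\<exists>q. leads N (Suc j) q g"
  using assms unfolding leads_def less_Suc_eq by blast

lemma leads_beyond_order:
  assumes "leads N (Suc N) q g"
  shows "((\<lambda>t. g t / t ^ N) \<longlongrightarrow> 0) (at_right 0)"
proof -
  obtain Q where "\<forall>i<Suc N. Q i = 0" "((\<lambda>t. (g t - log_asymp N Q t) / t ^ N) \<longlongrightarrow> 0) (at_right 0)"
    using assms unfolding leads_def by blast
  moreover from this(1) have "log_asymp N Q t = 0" for t by (simp add: log_asymp_def)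
  ultimately show ?thesis by simp
qed

lemma at_within_Icc_nontrivial: "(t::real) < t' \<Longrightarrow> at t within {t..t'} \<noteq> bot"
  by (simp add: at_within_Icc_at_right)

text \<open>The second expansion applies Taylor's theorem to the partial derivative along \<open>t\<close> that
  the smoothness hypothesis provides; it is identified with \<open>k'\<close> on one-sided intervals,
  since at a point of the diagonal the triangle extends only towards larger \<open>t\<close>.\<close>

lemma kernel_corner_expansions:
  assumes T: "T > 0" and C1: "C1_in_t T k k'"
    and smooth: "times_differentiable_near_0 (Suc N) (\<lambda>(t, s). k t s) (triangle T)"
  shows "\<exists>P \<eta>. bipoly P \<and> \<eta> > 0 \<and> (\<forall>(t, s)\<in>corner \<eta>. \<bar>k t s - P t s\<bar> \<le> t ^ Suc N)"
    and "\<exists>P \<eta>. bipoly P \<and> \<eta> > 0 \<and> (\<forall>(t, s)\<in>corner \<eta>. \<bar>k' t s - P t s\<bar> \<le> t ^ N)"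
proof -
  obtain U where U: "open U" "(0, 0) \<in> U" "times_differentiable_on (Suc N) (\<lambda>(t, s). k t s) (triangle T \<inter> U)"
    using smooth by (auto simp: times_differentiable_near_0_def zero_prod_def)
  obtain e where e: "e > 0" "ball (0, 0) e \<subseteq> U" using U openE by blast
  define \<delta> where "\<delta> = min (e / 2) T"
  have \<delta>: "\<delta> > 0" "\<delta> \<le> T" using e T by (auto simp: \<delta>_def)
  have sub: "corner \<delta> \<subseteq> triangle T \<inter> U"
  proof safe
    fix t s assume "(t, s) \<in> corner \<delta>"
    then have *: "0 \<le> s" "s \<le> t" "t < \<delta>" by (auto simp: corner_def)
    then show "(t, s) \<in> triangle T" using \<delta> by (auto simp: triangle_def)
    have "dist (0, 0) (t, s) \<le> 2 * t"
      using * sqrt_sum_squares_le_sum_abs[of t s] by (simp add: dist_Pair_Pair)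
    then show "(t, s) \<in> U" using * e by (auto simp: \<delta>_def)
  qed
  have k: "continuous_on (triangle T) (\<lambda>(t, s). k t s)" and k': "continuous_on (triangle T) (\<lambda>(t, s). k' t s)"
    using C1 by (auto simp: C1_in_t_def)
  have td: "times_differentiable_on (Suc N) (\<lambda>(t, s). k t s) (corner \<delta>)"
    by (rule times_differentiable_on_subset[OF U(3) sub])
  have "continuous_on (corner \<delta>) (\<lambda>(t, s). k t s)" using sub by (intro continuous_on_subset[OF k]) auto
  from taylor_corner[OF td this \<delta>(1)] obtain P where P: "bipoly P"
    "\<forall>\<epsilon>>0. \<exists>\<eta>>0. \<eta> \<le> \<delta> \<and> (\<forall>(t, s)\<in>corner \<eta>. \<bar>(case (t, s) of (t, s) \<Rightarrow> k t s) - P t s\<bar> \<le> \<epsilon> * t ^ Suc N)"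
    by (elim exE conjE) (rule that)
  from P(2)[rule_format, of 1] P(1)
  show "\<exists>P \<eta>. bipoly P \<and> \<eta> > 0 \<and> (\<forall>(t, s)\<in>corner \<eta>. \<bar>k t s - P t s\<bar> \<le> t ^ Suc N)"
    by auto
  obtain F where F: "\<And>p. p \<in> corner \<delta> \<Longrightarrow> ((\<lambda>(t, s). k t s) has_derivative F p) (at p within corner \<delta>)"
    "times_differentiable_on N (\<lambda>p. F p (1, 0)) (corner \<delta>)"
    using td by (auto simp: Basis_prod_def)
  have F_eq: "F (t, s) (1, 0) = k' t s" if ts: "(t, s) \<in> corner \<delta>" for t s
  proof -
    have *: "0 \<le> s" "s \<le> t" "t < \<delta>" using ts by (auto simp: corner_def)
    define t' where "t' = (t + \<delta>) / 2"
    have t': "t < t'" "t' < \<delta>" using * by (auto simp: t'_def)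
    have "((\<lambda>\<tau>. case (\<tau>, s) of (t, s) \<Rightarrow> k t s) has_derivative (\<lambda>v. F (t, s) (v, 0))) (at t within {t..t'})"
      by (rule has_derivative_in_compose2[where t = "corner \<delta>" and g' = F, OF F(1)])
        (use * t' in \<open>auto simp: corner_def intro!: derivative_eq_intros\<close>)
    moreover have "(\<lambda>v. F (t, s) (v, 0)) = (\<lambda>v. v *\<^sub>R F (t, s) (1, 0))"
    proof
      fix v
      interpret bounded_linear "F (t, s)" using F(1)[OF ts] by (rule has_derivative_bounded_linear)
      show "F (t, s) (v, 0) = v *\<^sub>R F (t, s) (1, 0)" using scale[of v "(1, 0)"] by simp
    qed
    ultimately have "((\<lambda>\<tau>. k \<tau> s) has_vector_derivative F (t, s) (1, 0)) (at t within {t..t'})"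
      unfolding has_vector_derivative_def by (simp only: prod.case)
    moreover have "((\<lambda>\<tau>. k \<tau> s) has_real_derivative k' t s) (at t within {s..T})"
      using C1 * \<delta> by (auto simp: C1_in_t_def triangle_def)
    then have "((\<lambda>\<tau>. k \<tau> s) has_real_derivative k' t s) (at t within {t..t'})"
      by (rule DERIV_subset) (use * t' \<delta> in auto)
    ultimately show ?thesis
      using vector_derivative_unique_within[OF at_within_Icc_nontrivial[OF t'(1)]]
      by (simp add: has_real_derivative_iff_has_vector_derivative)
  qed
  have "continuous_on (corner \<delta>) (\<lambda>(t, s). k' t s)" using sub by (intro continuous_on_subset[OF k']) auto
  then have "continuous_on (corner \<delta>) (\<lambda>p. F p (1, 0))"
    by (rule continuous_on_eq) (auto simp: F_eq)
  from taylor_corner[OF F(2) this \<delta>(1)] obtain R where R: "bipoly R"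
    "\<forall>\<epsilon>>0. \<exists>\<eta>>0. \<eta> \<le> \<delta> \<and> (\<forall>(t, s)\<in>corner \<eta>. \<bar>F (t, s) (1, 0) - R t s\<bar> \<le> \<epsilon> * t ^ N)"
    by (elim exE conjE) (rule that)
  from R(2)[rule_format, of 1] obtain \<eta> where \<eta>: "\<eta> > 0" "\<eta> \<le> \<delta>"
    "\<And>t s. (t, s)\<in>corner \<eta> \<Longrightarrow> \<bar>F (t, s) (1, 0) - R t s\<bar> \<le> t ^ N"
    by auto
  have "\<bar>k' t s - R t s\<bar> \<le> t ^ N" if "(t, s) \<in> corner \<eta>" for t s
    using \<eta>(3)[OF that] F_eq[of t s] that \<eta>(2) by (auto simp: corner_def)
  with R(1) \<eta>(1)
  show "\<exists>P \<eta>. bipoly P \<and> \<eta> > 0 \<and> (\<forall>(t, s)\<in>corner \<eta>. \<bar>k' t s - P t s\<bar> \<le> t ^ N)" by blast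
qed

text \<open>Only \<open>N\<close> derivatives of \<open>f1\<close> are available, so the remainder has to be Peano's \<open>o(t ^ N)\<close>.\<close>

lemma derivative_leads:
  assumes T: "T > 0" and f1: "continuous_on {0..T} f1"
    "\<And>t. t \<in> {0..T} \<Longrightarrow> (f has_real_derivative f1 t) (at t within {0..T})"
    and smooth: "times_differentiable_near_0 (Suc N) f {0..T}"
  shows "\<exists>q. leads N 0 q f1"
proof -
  obtain U where U: "open U" "0 \<in> U" "times_differentiable_on (Suc N) f ({0..T} \<inter> U)"
    using smooth by (auto simp: times_differentiable_near_0_def)
  obtain e where e: "e > 0" "ball 0 e \<subseteq> U" using U openE by blast
  define \<delta> where "\<delta> = min e T"
  have \<delta>: "\<delta> > 0" "\<delta> \<le> T" using e T by (auto simp: \<delta>_def)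
  have "{0..<\<delta>} \<subseteq> {0..T} \<inter> U" using e by (auto simp: \<delta>_def)
  from times_differentiable_on_subset[OF U(3) this] obtain F where
    "\<forall>t\<in>{0..<\<delta>}. (f has_derivative F t) (at t within {0..<\<delta>})"
    "times_differentiable_on N (\<lambda>t. F t 1) {0..<\<delta>}" by auto
  then have F: "\<And>t. t \<in> {0..<\<delta>} \<Longrightarrow> (f has_derivative F t) (at t within {0..<\<delta>})"
    "times_differentiable_on N (\<lambda>t. F t 1) {0..<\<delta>}" by blast+
  have F_eq: "F t 1 = f1 t" if t: "t \<in> {0..<\<delta>}" for t
  proof -
    define t' where "t' = (t + \<delta>) / 2"
    have t': "t < t'" "t' < \<delta>" using t by (auto simp: t'_def)
    have "(f has_derivative F t) (at t within {t..t'})"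
      using t t' by (intro has_derivative_subset[OF F(1)]) auto
    moreover have "F t = (\<lambda>v. v *\<^sub>R F t 1)"
    proof
      fix v
      interpret bounded_linear "F t" using F(1)[OF t] by (rule has_derivative_bounded_linear)
      show "F t v = v *\<^sub>R F t 1" using scale[of v 1] by simp
    qed
    ultimately have "(f has_vector_derivative F t 1) (at t within {t..t'})"
      unfolding has_vector_derivative_def by (rule subst[rotated])
    moreover have "(f has_real_derivative f1 t) (at t within {t..t'})"
      by (rule DERIV_subset[OF f1(2)]) (use t t' \<delta> in auto)
    ultimately show ?thesis
      using vector_derivative_unique_within[OF at_within_Icc_nontrivial[OF t'(1)]]
      by (simp add: has_real_derivative_iff_has_vector_derivative)
  qed
  have img: "fst ` corner \<delta> \<subseteq> {0..<\<delta>}" by (auto simp: corner_def)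
  have "continuous_on (corner \<delta>) (\<lambda>p. f1 (fst p))"
    using \<delta> by (intro continuous_on_compose2[OF f1(1)] continuous_intros) (auto simp: corner_def)
  then have "continuous_on (corner \<delta>) (\<lambda>p. F (fst p) 1)"
    by (rule continuous_on_eq) (use F_eq img in auto)
  from taylor_corner[OF times_differentiable_on_fst[OF F(2) img] this \<delta>(1)] obtain P where P: "bipoly P"
    "\<forall>\<epsilon>>0. \<exists>\<eta>>0. \<eta> \<le> \<delta> \<and> (\<forall>(t, s)\<in>corner \<eta>. \<bar>F (fst (t, s)) 1 - P t s\<bar> \<le> \<epsilon> * t ^ N)"
    by (elim exE conjE) (rule that)
  have "leads N 0 0 (\<lambda>t. f1 t - P t t)"
  proof (rule leads_negligible, rule tendstoI)
    fix \<epsilon> :: real assume "\<epsilon> > 0"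
    then have "\<epsilon> / 2 > 0" by simp
    from P(2)[rule_format, OF this] obtain \<eta> where \<eta>: "\<eta> > 0" "\<eta> \<le> \<delta>"
      "\<And>t s. (t, s) \<in> corner \<eta> \<Longrightarrow> \<bar>F t 1 - P t s\<bar> \<le> \<epsilon> / 2 * t ^ N" by auto
    show "\<forall>\<^sub>F t in at_right 0. dist ((f1 t - P t t) / t ^ N) 0 < \<epsilon>"
      using eventually_at_right_real[OF \<eta>(1)]
    proof eventually_elim
      case (elim t)
      then have "\<bar>f1 t - P t t\<bar> \<le> \<epsilon> / 2 * t ^ N"
        using \<eta>(3)[of t t] F_eq[of t] \<eta>(2) by (auto simp: corner_def)
      also have "\<dots> < \<epsilon> * t ^ N" using elim \<open>\<epsilon> > 0\<close> by simp
      finally show ?case using elim by (simp add: field_simps)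
    qed
  qed
  moreover have "leads N 0 (smult (P 0 0 * 1 ^ 0) (1 \<circ>\<^sub>p [:ln 1, 1:])) (\<lambda>t. P t (1 * t) * logmono 0 1 (1 * t))"
    by (rule leads_bipoly_boundary[OF P(1)]) auto
  then have "leads N 0 [:P 0 0:] (\<lambda>t. P t t)"
    by (simp add: logmono_def pcompose_1 smult_one)
  ultimately have "leads N 0 (0 + [:P 0 0:]) (\<lambda>t. (f1 t - P t t) + P t t)" by (rule leads_add)
  then show ?thesis by auto
qed

lemma kernel_deriv_leads:
  assumes T: "T > 0" and C1: "C1_in_t T k k'"
    and smooth: "times_differentiable_near_0 (Suc N) (\<lambda>(t, s). k t s) (triangle T)"
    and \<beta>: "0 \<le> \<beta>" "\<beta> \<le> 1" and j: "j \<le> N"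
  shows "leads N j (smult (k 0 0 * \<beta> ^ Suc j) (p \<circ>\<^sub>p [:ln \<beta>, 1:])) (kernel_deriv \<beta> k k' (logmono j p))"
proof (cases "\<beta> = 0")
  case True
  then show ?thesis by (simp add: kernel_deriv_def[abs_def] kernel_int_def leads_zero)
next
  case False
  then have \<beta>0: "\<beta> > 0" using \<beta> by simp
  from kernel_corner_expansions(1)[OF T C1 smooth] obtain P \<eta> where
    P0: "bipoly P" "\<eta> > 0" "\<forall>(t, s)\<in>corner \<eta>. \<bar>k t s - P t s\<bar> \<le> t ^ Suc N" by blast
  from kernel_corner_expansions(2)[OF T C1 smooth] obtain R \<theta> where
    R0: "bipoly R" "\<theta> > 0" "\<forall>(t, s)\<in>corner \<theta>. \<bar>k' t s - R t s\<bar> \<le> t ^ N" by blast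
  have P: "bipoly P" "\<eta> > 0" "\<And>t s. (t, s) \<in> corner \<eta> \<Longrightarrow> \<bar>k t s - P t s\<bar> \<le> 1 * t ^ Suc N"
    and R: "bipoly R" "\<theta> > 0" "\<And>t s. (t, s) \<in> corner \<theta> \<Longrightarrow> \<bar>k' t s - R t s\<bar> \<le> 1 * t ^ N"
    using P0 R0 by auto
  have k': "continuous_on (triangle T) (\<lambda>(t, s). k' t s)" using C1 by (simp add: C1_in_t_def)
  have "leads N j (smult \<beta> (smult (k 0 0 * \<beta> ^ j) (p \<circ>\<^sub>p [:ln \<beta>, 1:])) + 0)
      (\<lambda>t. \<beta> * (k t (\<beta> * t) * logmono j p (\<beta> * t)) + kernel_int \<beta> k' (logmono j p) t)"
    by (intro leads_add leads_cmult leads_kernel_boundary[OF P \<beta>0 \<beta>(2) j]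
        leads_kernel_integral[OF k' T R \<beta>0 \<beta>(2) j])
  then show ?thesis by (simp add: kernel_deriv_def[abs_def] mult_ac)
qed

locale smooth_equation = kernel_setting +
  fixes f f1 :: "real \<Rightarrow> real"
  assumes f1_cont: "continuous_on {0..T} f1"
    and f_deriv: "\<And>t. t \<in> {0..T} \<Longrightarrow> (f has_real_derivative f1 t) (at t within {0..T})"
    and f0: "f 0 = 0" and cond_B: "condition_B T n K f N"
begin

text \<open>The coefficients of \<open>char_P\<close>, including the constant one at \<open>i = n\<close>, where \<open>ln (\<alpha> n) = 0\<close>.\<close>

definition exponent_coeff :: "nat \<Rightarrow> nat \<Rightarrow> real" where
  "exponent_coeff j i = (if i = n then K n 0 0 else \<alpha> i ^ (1 + j) * (K i 0 0 - K (i + 1) 0 0))"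

abbreviation coefficient_map :: "nat \<Rightarrow> real poly \<Rightarrow> real poly" where
  "coefficient_map j \<equiv> shift_op (exponent_coeff j) (\<lambda>i. ln (\<alpha> i)) {1..n}"

text \<open>The assumption on \<open>g\<close> settles the default value \<open>ln 0\<close> at the breakpoint \<open>\<alpha> 0 = 0\<close>.\<close>

lemma sum_exponent_coeff:
  assumes "g 0 = 0"
  shows "(\<Sum>i=1..n. K i 0 0 * (\<alpha> i ^ (1 + j) * g i) - K i 0 0 * (\<alpha> (i - 1) ^ (1 + j) * g (i - 1)))
    = (\<Sum>i=1..n. exponent_coeff j i * g i)"
  using telescoped_sum_by_parts[of n "\<lambda>i. \<alpha> i ^ (1 + j) * g i" "\<lambda>i. K i 0 0"] n \<alpha>0 \<alpha>n
  unfolding sum_split_last[of "\<lambda>i. exponent_coeff j i * g i"]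
  by (simp add: exponent_coeff_def mult_ac)

text \<open>Only the boundary terms contribute to the leading order, and they do so through the values of the
  kernels at the origin.\<close>

lemma pw_deriv_leads:
  assumes j: "j \<le> N"
  shows "leads N j (coefficient_map j p) (pw_deriv n \<alpha> K K' (logmono j p))"
proof -
  have "leads N j (\<Sum>i=1..n. smult (K i 0 0 * \<alpha> i ^ Suc j) (p \<circ>\<^sub>p [:ln (\<alpha> i), 1:])
        - smult (K i 0 0 * \<alpha> (i - 1) ^ Suc j) (p \<circ>\<^sub>p [:ln (\<alpha> (i - 1)), 1:]))
      (\<lambda>t. \<Sum>i=1..n. kernel_deriv (\<alpha> i) (K i) (K' i) (logmono j p) t
        - kernel_deriv (\<alpha> (i - 1)) (K i) (K' i) (logmono j p) t)"
  proof (intro leads_sum leads_diff kernel_deriv_leads[OF T _ _ _ _ j])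
    fix i assume i: "i \<in> {1..n}"
    then show "C1_in_t T (K i) (K' i)" "C1_in_t T (K i) (K' i)" using C1 by auto
    show "times_differentiable_near_0 (Suc N) (\<lambda>(t, s). K i t s) (triangle T)"
      "times_differentiable_near_0 (Suc N) (\<lambda>(t, s). K i t s) (triangle T)"
      using cond_B i by (auto simp: condition_B_def)
  qed (use \<alpha>_nonneg \<alpha>_le_1 in auto)
  moreover have "(\<Sum>i=1..n. smult (K i 0 0 * \<alpha> i ^ Suc j) (p \<circ>\<^sub>p [:ln (\<alpha> i), 1:])
        - smult (K i 0 0 * \<alpha> (i - 1) ^ Suc j) (p \<circ>\<^sub>p [:ln (\<alpha> (i - 1)), 1:])) = coefficient_map j p"
  proof (rule poly_eqI)
    fix l
    \<comment> \<open>The value at \<open>0\<close> is arbitrary, because it is multiplied by a power of \<open>\<alpha> 0 = 0\<close>.\<close>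
    define g where "g i = (if i = 0 then 0 else coeff (p \<circ>\<^sub>p [:ln (\<alpha> i), 1:]) l)" for i
    have "coeff (\<Sum>i=1..n. smult (K i 0 0 * \<alpha> i ^ Suc j) (p \<circ>\<^sub>p [:ln (\<alpha> i), 1:])
        - smult (K i 0 0 * \<alpha> (i - 1) ^ Suc j) (p \<circ>\<^sub>p [:ln (\<alpha> (i - 1)), 1:])) l
      = (\<Sum>i=1..n. K i 0 0 * (\<alpha> i ^ (1 + j) * g i) - K i 0 0 * (\<alpha> (i - 1) ^ (1 + j) * g (i - 1)))"
      unfolding coeff_sum using \<alpha>0 by (intro sum.cong) (auto simp: g_def)
    also have "\<dots> = (\<Sum>i=1..n. exponent_coeff j i * g i)"
      by (rule sum_exponent_coeff) (simp add: g_def)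
    also have "\<dots> = coeff (coefficient_map j p) l"
      unfolding shift_op_def coeff_sum by (intro sum.cong) (auto simp: g_def)
    finally show "coeff (\<Sum>i=1..n. smult (K i 0 0 * \<alpha> i ^ Suc j) (p \<circ>\<^sub>p [:ln (\<alpha> i), 1:])
        - smult (K i 0 0 * \<alpha> (i - 1) ^ Suc j) (p \<circ>\<^sub>p [:ln (\<alpha> (i - 1)), 1:])) l = coeff (coefficient_map j p) l" .
  qed
  ultimately show ?thesis by (simp add: pw_deriv_def[abs_def])
qed

lemma char_L_eq: "char_L n \<alpha> K j = (\<Sum>i=1..n. exponent_coeff j i)"
proof -
  have "char_L n \<alpha> K j = (\<Sum>i=1..n. K i 0 0 * (\<alpha> i ^ (1 + j) * (if i = 0 then 0 else 1))
      - K i 0 0 * (\<alpha> (i - 1) ^ (1 + j) * (if i - 1 = 0 then 0 else 1)))"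
    unfolding char_L_def using \<alpha>0 by (intro sum.cong) (auto simp: right_diff_distrib)
  also have "\<dots> = (\<Sum>i=1..n. exponent_coeff j i * (if i = 0 then 0 else 1))"
    by (rule sum_exponent_coeff) simp
  also have "\<dots> = (\<Sum>i=1..n. exponent_coeff j i)" by (intro sum.cong) auto
  finally show ?thesis .
qed

lemma char_P_eq:
  assumes "z > 0"
  shows "char_P n \<alpha> K j z = (\<Sum>i=1..n. exponent_coeff j i * z powr ln (\<alpha> i))"
  using assms unfolding char_P_def sum_split_last[of "\<lambda>i. exponent_coeff j i * z powr ln (\<alpha> i)"]
  by (simp add: exponent_coeff_def \<alpha>n)

text \<open>At \<open>t = 0\<close>, Condition A says that the off-diagonal part of \<open>L(N)\<close> is smaller in absolute value than \<open>K n 0 0\<close>. For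
  larger exponents it shrinks further, because the breakpoints are at most \<open>1\<close>. Hence a root
  cannot reach \<open>N\<close>.\<close>

lemma char_L_root_less:
  assumes "char_L n \<alpha> K j = 0"
  shows "j < N"
proof (rule ccontr)
  assume "\<not> j < N"
  then have j: "1 + N \<le> 1 + j" by simp
  obtain q where q: "0 \<le> q" "q < 1" "\<And>t. t \<in> {0..T} \<Longrightarrow> off_diagonal t \<le> q * \<bar>K n t t\<bar>"
    using contraction_constant by blast
  have "char_L n \<alpha> K j = (\<Sum>i=1..<n. K i 0 0 * \<alpha> i ^ (1 + j)) + K n 0 0 - (\<Sum>i=1..n. K i 0 0 * \<alpha> (i - 1) ^ (1 + j))"
    unfolding char_L_def right_diff_distrib sum_subtractf sum_split_last[of "\<lambda>i. K i 0 0 * \<alpha> i ^ (1 + j)"]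
    by (simp add: \<alpha>n)
  then have "\<bar>K n 0 0\<bar> = \<bar>(\<Sum>i=1..<n. K i 0 0 * \<alpha> i ^ (1 + j)) - (\<Sum>i=1..n. K i 0 0 * \<alpha> (i - 1) ^ (1 + j))\<bar>"
    using assms by linarith
  also have "\<dots> \<le> (\<Sum>i=1..<n. \<bar>K i 0 0 * \<alpha> i ^ (1 + j)\<bar>) + (\<Sum>i=1..n. \<bar>K i 0 0 * \<alpha> (i - 1) ^ (1 + j)\<bar>)"
    by (intro order_trans[OF abs_triangle_ineq4] add_mono sum_abs)
  also have "\<dots> \<le> off_diagonal 0"
  proof -
    have "\<bar>K i 0 0 * \<alpha> l ^ (1 + j)\<bar> \<le> \<alpha> l ^ (1 + N) * \<bar>K i 0 (\<alpha> l * 0)\<bar>" if "l \<le> n" for i l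
    proof -
      have "\<alpha> l ^ (1 + j) \<le> \<alpha> l ^ (1 + N)" using \<alpha>_nonneg \<alpha>_le_1 that j by (intro power_decreasing) auto
      then have "\<bar>K i 0 0\<bar> * \<alpha> l ^ (1 + j) \<le> \<bar>K i 0 0\<bar> * \<alpha> l ^ (1 + N)" by (rule mult_left_mono) simp
      then show ?thesis using \<alpha>_nonneg[OF that] by (simp add: abs_mult mult.commute)
    qed
    then show ?thesis unfolding off_diagonal_def by (intro add_mono sum_mono) auto
  qed
  also have "\<dots> \<le> q * \<bar>K n 0 0\<bar>" using q(3)[of 0] T by simp
  finally show False using q(2) diag_nonzero[of 0] T by (simp add: mult_le_cancel_right1)
qed

text \<open>Away from the roots of \<open>char_L\<close> the moment of order zero is non-zero and nothing is free.\<close>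

lemma coefficient_map_surj:
  assumes r: "char_L n \<alpha> K j = 0 \<Longrightarrow> has_root_multiplicity (char_P n \<alpha> K j) 1 r"
  shows "\<exists>p. coefficient_map j p = q \<and> (char_L n \<alpha> K j = 0 \<longrightarrow> (\<forall>l<r. coeff p l = c l))"
proof (cases "char_L n \<alpha> K j = 0")
  case True
  show ?thesis
    using shift_op_surj[of r "exponent_coeff j" "\<lambda>i. ln (\<alpha> i)" "{1..n}" q c]
      root_multiplicity_moments[OF char_P_eq r[OF True]] by blast
next
  case False
  then have "(\<Sum>i=1..n. exponent_coeff j i * ln (\<alpha> i) ^ 0) \<noteq> 0" by (simp add: char_L_eq)
  from shift_op_surj[of 0, OF _ this, of q c] show ?thesis using False by auto
qed

lemma pw_deriv_add:
  assumes "\<phi> absolutely_integrable_on {0..T}" "\<psi> absolutely_integrable_on {0..T}" "t \<in> {0..T}"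
  shows "pw_deriv n \<alpha> K K' (\<lambda>s. \<phi> s + \<psi> s) t = pw_deriv n \<alpha> K K' \<phi> t + pw_deriv n \<alpha> K K' \<psi> t"
proof -
  have "kernel_int (\<alpha> l) (K' i) (\<lambda>s. \<phi> s + \<psi> s) t = kernel_int (\<alpha> l) (K' i) \<phi> t + kernel_int (\<alpha> l) (K' i) \<psi> t"
    if "i \<in> {1..n}" "l \<le> n" for i l
  proof -
    have "(\<lambda>s. K' i t s * \<omega> s) integrable_on {0..\<alpha> l * t}" if "\<omega> absolutely_integrable_on {0..T}" for \<omega>
      using assms(3) scaled_le[OF \<open>l \<le> n\<close>, of t]
      by (intro kernel_slice_integrable[OF K'_cont[OF \<open>i \<in> {1..n}\<close>] that]) auto
    from Henstock_Kurzweil_Integration.integral_add[OF this[OF assms(1)] this[OF assms(2)]]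
    show ?thesis by (simp add: kernel_int_def distrib_left)
  qed
  then have "kernel_deriv (\<alpha> l) (K i) (K' i) (\<lambda>s. \<phi> s + \<psi> s) t
      = kernel_deriv (\<alpha> l) (K i) (K' i) \<phi> t + kernel_deriv (\<alpha> l) (K i) (K' i) \<psi> t"
    if "i \<in> {1..n}" "l \<le> n" for i l
    using that by (simp add: kernel_deriv_def distrib_left)
  then show ?thesis
    unfolding pw_deriv_def sum.distrib[symmetric] by (intro sum.cong) auto
qed

lemma log_asymp_absolutely_integrable: "log_asymp N X absolutely_integrable_on {0..T}"
  unfolding log_asymp_logmono[abs_def]
  by (intro absolutely_integrable_sum logmono_absolutely_integrable T) auto

lemma log_asymp_continuous: "continuous_on {0<..T} (log_asymp N X)"
  unfolding log_asymp_logmono[abs_def] by (intro continuous_on_sum logmono_continuous)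

text \<open>The coefficients are determined one after the other: adding \<open>t ^ m * p (ln t)\<close> subtracts
  \<open>coefficient_map m p\<close> from the leading coefficient of the residual, which can be cancelled by
  surjectivity. After \<open>N + 1\<close> steps the residual is \<open>o(t ^ N)\<close>.\<close>

lemma log_asymp_exists:
  assumes r: "\<And>j. char_L n \<alpha> K j = 0 \<Longrightarrow> has_root_multiplicity (char_P n \<alpha> K j) 1 (r j)"
  shows "\<exists>X. (\<forall>j. char_L n \<alpha> K j = 0 \<longrightarrow> (\<forall>l<r j. coeff (X j) l = c (j, l))) \<and>
    ((\<lambda>t. (f1 t - pw_deriv n \<alpha> K K' (log_asymp N X) t) / t ^ N) \<longlongrightarrow> 0) (at_right 0)"
proof -
  have "\<exists>X. (\<forall>i\<ge>m. X i = 0) \<and> (\<forall>j<m. char_L n \<alpha> K j = 0 \<longrightarrow> (\<forall>l<r j. coeff (X j) l = c (j, l))) \<and>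
      (\<exists>q. leads N m q (\<lambda>t. f1 t - pw_deriv n \<alpha> K K' (log_asymp N X) t))" if "m \<le> Suc N" for m
    using that
  proof (induction m)
    case 0
    have "times_differentiable_near_0 (Suc N) f {0..T}" using cond_B by (simp add: condition_B_def)
    from derivative_leads[OF T f1_cont f_deriv this] obtain q where "leads N 0 q f1" by blast
    moreover have "pw_deriv n \<alpha> K K' (log_asymp N (\<lambda>_. 0)) t = 0" for t
      by (simp add: pw_deriv_def kernel_deriv_def kernel_int_def log_asymp_def)
    ultimately show ?case by (intro exI[of _ "\<lambda>_. 0"]) auto
  next
    case (Suc m)
    then have m: "m \<le> N" by simp
    from Suc obtain X q where X: "\<forall>i\<ge>m. X i = 0"
      "\<forall>j<m. char_L n \<alpha> K j = 0 \<longrightarrow> (\<forall>l<r j. coeff (X j) l = c (j, l))"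
      "leads N m q (\<lambda>t. f1 t - pw_deriv n \<alpha> K K' (log_asymp N X) t)" by auto
    obtain p where p: "coefficient_map m p = q" "char_L n \<alpha> K m = 0 \<longrightarrow> (\<forall>l<r m. coeff p l = c (m, l))"
      using coefficient_map_surj[OF r, of m q "\<lambda>l. c (m, l)"] by blast
    have eq: "log_asymp N (X(m := p)) = (\<lambda>t. log_asymp N X t + logmono m p t)"
    proof
      fix t
      have "log_asymp N (X(m := p)) t = (\<Sum>i\<le>N. logmono i (X i) t + (if i = m then logmono m p t else 0))"
        unfolding log_asymp_logmono using X(1) by (intro sum.cong) (auto simp: logmono_def)
      then show "log_asymp N (X(m := p)) t = log_asymp N X t + logmono m p t"
        using m by (simp add: sum.distrib log_asymp_logmono)
    qed
    have "\<forall>\<^sub>F t in at_right 0. f1 t - pw_deriv n \<alpha> K K' (log_asymp N X) t - pw_deriv n \<alpha> K K' (logmono m p) t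
        = f1 t - pw_deriv n \<alpha> K K' (log_asymp N (X(m := p))) t"
      using eventually_at_right_real[OF T]
    proof eventually_elim
      case (elim t)
      then have "t \<in> {0..T}" by auto
      from pw_deriv_add[OF log_asymp_absolutely_integrable logmono_absolutely_integrable[OF T] this]
      show ?case by (simp add: eq)
    qed
    from leads_cong[OF leads_diff[OF X(3) pw_deriv_leads[OF m, of p]] this]
    have "leads N m 0 (\<lambda>t. f1 t - pw_deriv n \<alpha> K K' (log_asymp N (X(m := p))) t)" unfolding p(1) by simp
    from leads_Suc[OF this]
    have "\<exists>q. leads N (Suc m) q (\<lambda>t. f1 t - pw_deriv n \<alpha> K K' (log_asymp N (X(m := p))) t)" .
    moreover have "\<forall>i\<ge>Suc m. (X(m := p)) i = 0" using X(1) by simp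
    moreover have "\<forall>j<Suc m. char_L n \<alpha> K j = 0 \<longrightarrow> (\<forall>l<r j. coeff ((X(m := p)) j) l = c (j, l))"
      using X(2) p(2) by (simp add: less_Suc_eq)
    ultimately show ?case by blast
  qed
  from this[of "Suc N"] obtain X q where X:
    "\<forall>j<Suc N. char_L n \<alpha> K j = 0 \<longrightarrow> (\<forall>l<r j. coeff (X j) l = c (j, l))"
    "leads N (Suc N) q (\<lambda>t. f1 t - pw_deriv n \<alpha> K K' (log_asymp N X) t)" by auto
  from leads_beyond_order[OF X(2)] X(1) char_L_root_less show ?thesis
    by (intro exI[of _ X]) (auto simp: less_Suc_eq)
qed

lemma pw_integral_has_derivative:
  assumes "\<phi> absolutely_integrable_on {0..T}" "continuous_on {0<..T} \<phi>" "0 < t" "t \<le> T"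
  shows "(pw_integral n \<alpha> K \<phi> has_real_derivative pw_deriv n \<alpha> K K' \<phi> t) (at t within {0..T})"
  unfolding pw_integral_def[abs_def] pw_deriv_def
  using C1 \<alpha>_nonneg \<alpha>_le_1
  by (intro DERIV_sum DERIV_diff kernel_int_has_derivative assms) auto

lemma pw_deriv_continuous:
  assumes "\<phi> absolutely_integrable_on {0..T}" "continuous_on {0<..T} \<phi>"
  shows "continuous_on {0<..T} (pw_deriv n \<alpha> K K' \<phi>)"
proof -
  have "continuous_on {0<..T} (kernel_deriv (\<alpha> l) (K i) (K' i) \<phi>)" if il: "i \<in> {1..n}" "l \<le> n" for i l
  proof (cases "l = 0")
    case True
    then show ?thesis using \<alpha>0 by (simp add: kernel_deriv_def[abs_def] kernel_int_def)
  next
    case False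
    have "continuous_on {0<..T} (\<lambda>t. \<phi> (\<alpha> l * t))"
    proof (rule continuous_on_compose2[OF assms(2)])
      show "continuous_on {0<..T} (\<lambda>t. \<alpha> l * t)" by (intro continuous_intros)
      show "(\<lambda>t. \<alpha> l * t) ` {0<..T} \<subseteq> {0<..T}"
        using scaled_in[OF il(2)] \<alpha>_pos[of l] il False by force
    qed
    moreover have "continuous_on {0<..T} (\<lambda>t. K i t (\<alpha> l * t))"
      by (rule continuous_on_subset[OF boundary_continuous[OF il]]) auto
    moreover have "continuous_on {0<..T} (kernel_int (\<alpha> l) (K' i) \<phi>)"
      by (rule continuous_on_subset[OF kernel_int_continuous[OF K'_cont[OF il(1)] assms(1)]])
        (use il \<alpha>_nonneg \<alpha>_le_1 in auto)
    ultimately show ?thesis unfolding kernel_deriv_def[abs_def]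
      by (intro continuous_on_add continuous_on_mult continuous_on_const)
  qed
  then show ?thesis unfolding pw_deriv_def[abs_def]
    by (intro continuous_on_sum continuous_on_diff) auto
qed

text \<open>Shows that \<open>op_L0\<close> and \<open>op_V\<close> are the boundary part and the integral part of the differentiated
  equation for a density with the factor \<open>t ^ N\<close>.\<close>

lemma pw_deriv_power_times:
  assumes u: "continuous_on {0..T} u" and t: "t \<in> {0<..T}"
  shows "pw_deriv n \<alpha> K K' (\<lambda>s. s ^ N * u s) t
    = t ^ N * K n t t * (op_L0 T n \<alpha> K N u t + op_V T n \<alpha> K K' N u t)"
proof -
  have nz: "K n t t \<noteq> 0" "t \<noteq> 0" using diag_nonzero t by auto
  define A where "A i = \<alpha> i ^ (1 + N) * K i t (\<alpha> i * t) * u (\<alpha> i * t)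
               - \<alpha> (i - 1) ^ (1 + N) * K i t (\<alpha> (i - 1) * t) * u (\<alpha> (i - 1) * t)" for i
  have "pw_deriv n \<alpha> K K' (\<lambda>s. s ^ N * u s) t
    = (\<Sum>i=1..n. t ^ N * A i + (kernel_int (\<alpha> i) (K' i) (\<lambda>s. s ^ N * u s) t
        - kernel_int (\<alpha> (i - 1)) (K' i) (\<lambda>s. s ^ N * u s) t))"
    unfolding pw_deriv_def
    by (intro sum.cong refl) (simp add: kernel_deriv_def A_def power_mult_distrib algebra_simps)
  also have "\<dots> = t ^ N * (\<Sum>i=1..n. A i) + pw_integral n \<alpha> K' (\<lambda>s. s ^ N * u s) t"
    by (simp add: sum.distrib sum_distrib_left pw_integral_def)
  also have "pw_integral n \<alpha> K' (\<lambda>s. s ^ N * u s) t = t ^ N * K n t t * op_V T n \<alpha> K K' N u t"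
    using V_eq[OF u t] nz by simp
  also have "(\<Sum>i=1..n. A i) = K n t t * op_L0 T n \<alpha> K N u t"
    using t nz by (simp add: op_L0_def A_def)
  finally show ?thesis by (simp add: algebra_simps)
qed

lemma residual_g_eq:
  assumes "\<phi> absolutely_integrable_on {0..T}" "t \<in> {0..T}"
  shows "residual_g n \<alpha> K f \<phi> t = f t - pw_integral n \<alpha> K \<phi> t"
proof (cases "t = 0")
  case True
  then show ?thesis by (simp add: residual_g_def pw_integral_def kernel_int_def)
next
  case False
  have "((\<lambda>s. pw_kernel n \<alpha> K t s * \<phi> s) has_integral pw_integral n \<alpha> K \<phi> t) {0..t}"
    using assms False K_cont by (intro pw_kernel_has_integral[OF \<alpha>_Suc \<alpha>0 \<alpha>n]) auto
  then show ?thesis by (simp add: residual_g_def integral_unique)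
qed

lemma rhs_h_eq:
  assumes \<phi>: "\<phi> absolutely_integrable_on {0..T}" "continuous_on {0<..T} \<phi>" and t: "0 < t" "t \<le> T"
  shows "rhs_h T n \<alpha> K f N \<phi> t = (f1 t - pw_deriv n \<alpha> K K' \<phi> t) / (t ^ N * K n t t)"
proof -
  have "((\<lambda>t. f t - pw_integral n \<alpha> K \<phi> t) has_real_derivative f1 t - pw_deriv n \<alpha> K K' \<phi> t) (at t within {0..T})"
    using t by (intro DERIV_diff f_deriv pw_integral_has_derivative \<phi>) auto
  then have "(residual_g n \<alpha> K f \<phi> has_real_derivative f1 t - pw_deriv n \<alpha> K K' \<phi> t) (at t within {0..T})"
    by (rule has_field_derivative_transform_within[OF _ zero_less_one])
      (use t residual_g_eq[OF \<phi>(1)] in auto)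
  then have "vector_derivative (residual_g n \<alpha> K f \<phi>) (at t within {0..T}) = f1 t - pw_deriv n \<alpha> K K' \<phi> t"
    using t T by (intro vector_derivative_within_closed_interval)
      (auto simp: has_real_derivative_iff_has_vector_derivative)
  then show ?thesis using t by (simp add: rhs_h_def)
qed

lemma rhs_h_in_cont_space:
  assumes \<phi>: "\<phi> absolutely_integrable_on {0..T}" "continuous_on {0<..T} \<phi>"
    and lim: "((\<lambda>t. (f1 t - pw_deriv n \<alpha> K K' \<phi> t) / t ^ N) \<longlongrightarrow> 0) (at_right 0)"
  shows "rhs_h T n \<alpha> K f N \<phi> \<in> cont_space T"
proof -
  let ?h = "rhs_h T n \<alpha> K f N \<phi>"
  have "continuous_on {0<..T} (\<lambda>t. K n t t)" "continuous_on {0<..T} f1"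
    by (rule continuous_on_subset[OF diag_continuous] continuous_on_subset[OF f1_cont]; auto)+
  then have "continuous_on {0<..T} (\<lambda>t. (f1 t - pw_deriv n \<alpha> K K' \<phi> t) / (t ^ N * K n t t))"
    using diag_nonzero
    by (intro continuous_on_divide continuous_on_diff continuous_on_mult continuous_on_power continuous_on_id
        pw_deriv_continuous \<phi>) auto
  then have c: "continuous_on {0<..T} ?h"
    by (rule continuous_on_eq) (simp add: rhs_h_eq[OF \<phi>])
  have "((\<lambda>t. K n t t) \<longlongrightarrow> K n 0 0) (at_right 0)"
    using diag_continuous T by (auto simp: continuous_on_def at_within_Icc_at_right dest!: bspec[of _ _ 0])
  then have "((\<lambda>t. (f1 t - pw_deriv n \<alpha> K K' \<phi> t) / t ^ N / K n t t) \<longlongrightarrow> 0 / K n 0 0) (at_right 0)"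
    using diag_nonzero[of 0] T by (intro tendsto_divide lim) auto
  moreover have "\<forall>\<^sub>F t in at_right 0. (f1 t - pw_deriv n \<alpha> K K' \<phi> t) / t ^ N / K n t t = ?h t"
    using eventually_at_right_real[OF T] by eventually_elim (simp add: rhs_h_eq[OF \<phi>])
  ultimately have "(?h \<longlongrightarrow> 0) (at_right 0)" using Lim_transform_eventually by force
  moreover have "?h 0 = 0" using T by (simp add: rhs_h_def)
  ultimately have "continuous_on {0..T} ?h" by (intro continuous_on_Icc_0I[OF c]) simp
  then show ?thesis by (auto simp: cont_space_def rhs_h_def)
qed

text \<open>The equation for \<open>u\<close> says that both sides of the integral equation have the same derivative on
  \<open>(0, T]\<close>; both are continuous on \<open>[0, T]\<close> and vanish at \<open>0\<close>.\<close>

lemma correction_solves_equation: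
  assumes \<phi>: "\<phi> absolutely_integrable_on {0..T}" "continuous_on {0<..T} \<phi>"
    and u: "u \<in> cont_space T"
    and Lu: "\<And>t. t \<in> {0..T} \<Longrightarrow> op_L0 T n \<alpha> K N u t + op_V T n \<alpha> K K' N u t = rhs_h T n \<alpha> K f N \<phi> t"
  shows "solves_equation T n \<alpha> K f (\<lambda>t. \<phi> t + t ^ N * u t)"
  unfolding solves_equation_def
proof
  fix t assume t: "t \<in> {0<..T}"
  have cu: "continuous_on {0..T} u" using u by (simp add: cont_space_def)
  have cu': "continuous_on {0..T} (\<lambda>t. t ^ N * u t)" by (intro continuous_intros cu)
  have \<psi>: "(\<lambda>t. t ^ N * u t) absolutely_integrable_on {0..T}"
    by (rule absolutely_integrable_continuous_real[OF cu'])
  define x where "x t = \<phi> t + t ^ N * u t" for t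
  have x: "x absolutely_integrable_on {0..T}"
    unfolding x_def[abs_def] by (rule set_integral_add(1)[OF \<phi>(1) \<psi>])
  have cx: "continuous_on {0<..T} x"
    unfolding x_def[abs_def] by (intro continuous_on_add \<phi>(2) continuous_on_subset[OF cu']) auto
  define G where "G t = f t - pw_integral n \<alpha> K x t" for t
  have G': "(G has_real_derivative 0) (at s within {0..T})" if s: "0 < s" "s \<le> T" for s
  proof -
    have "f1 s - pw_deriv n \<alpha> K K' \<phi> s = s ^ N * K n s s * rhs_h T n \<alpha> K f N \<phi> s"
      using s diag_nonzero[of s] by (simp add: rhs_h_eq[OF \<phi> s])
    moreover have "pw_deriv n \<alpha> K K' x s = pw_deriv n \<alpha> K K' \<phi> s + s ^ N * K n s s * rhs_h T n \<alpha> K f N \<phi> s"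
      using pw_deriv_add[OF \<phi>(1) \<psi>, of s] pw_deriv_power_times[OF cu, of s] Lu[of s] s
      by (simp add: x_def[abs_def])
    ultimately have "f1 s - pw_deriv n \<alpha> K K' x s = 0" by simp
    moreover have "(G has_real_derivative f1 s - pw_deriv n \<alpha> K K' x s) (at s within {0..T})"
      unfolding G_def[abs_def] using s by (intro DERIV_diff f_deriv pw_integral_has_derivative x cx) auto
    ultimately show ?thesis by simp
  qed
  have "continuous_on {0..T} f" using f_deriv by (rule DERIV_continuous_on)
  then have "continuous_on {0..T} G"
    unfolding G_def[abs_def] by (intro continuous_on_diff pw_integral_continuous K_cont x)
  then have "continuous_on {0..t} G" by (rule continuous_on_subset) (use t in auto)
  moreover have "(G has_real_derivative 0) (at s)" if "0 < s" "s < t" for s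
  proof -
    have "s \<in> interior {0..T}" using that t by simp
    from at_within_interior[OF this] show ?thesis using G'[of s] that t by simp
  qed
  ultimately have "G t = G 0" using t by (intro DERIV_isconst_end) auto
  also have "G 0 = 0" by (simp add: G_def f0 pw_integral_def kernel_int_def)
  finally have "pw_integral n \<alpha> K x t = f t" by (simp add: G_def)
  moreover have "((\<lambda>s. pw_kernel n \<alpha> K t s * x s) has_integral pw_integral n \<alpha> K x t) {0..t}"
    using t K_cont by (intro pw_kernel_has_integral[OF \<alpha>_Suc \<alpha>0 \<alpha>n _ x]) auto
  ultimately show "((\<lambda>s. pw_kernel n \<alpha> K t s * (\<phi> s + s ^ N * u s)) has_integral f t) {0..t}"
    by (simp add: x_def)
qed

lemma solution_with_prescribed_coefficients:
  assumes r: "\<And>j. char_L n \<alpha> K j = 0 \<Longrightarrow> has_root_multiplicity (char_P n \<alpha> K j) 1 (r j)"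
  shows "\<exists>X u. (\<forall>j. char_L n \<alpha> K j = 0 \<longrightarrow> (\<forall>l<r j. coeff (X j) l = c (j, l))) \<and>
    u \<in> cont_space T \<and>
    continuous_on {0<..T} (\<lambda>t. log_asymp N X t + t ^ N * u t) \<and>
    solves_equation T n \<alpha> K f (\<lambda>t. log_asymp N X t + t ^ N * u t) \<and>
    rhs_h T n \<alpha> K f N (log_asymp N X) \<in> cont_space T \<and>
    (\<forall>us. successive_approximations T n \<alpha> K K' N (rhs_h T n \<alpha> K f N (log_asymp N X)) us \<longrightarrow>
       (\<forall>m. us m \<in> cont_space T) \<and> uniform_limit {0..T} us u sequentially)"
proof -
  obtain X where X: "\<forall>j. char_L n \<alpha> K j = 0 \<longrightarrow> (\<forall>l<r j. coeff (X j) l = c (j, l))"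
    "((\<lambda>t. (f1 t - pw_deriv n \<alpha> K K' (log_asymp N X) t) / t ^ N) \<longlongrightarrow> 0) (at_right 0)"
    using log_asymp_exists[OF r, of c] by blast
  define h where "h = rhs_h T n \<alpha> K f N (log_asymp N X)"
  have h: "h \<in> cont_space T"
    unfolding h_def by (rule rhs_h_in_cont_space[OF log_asymp_absolutely_integrable log_asymp_continuous X(2)])
  obtain u where u: "u \<in> cont_space T"
    "\<And>t. t \<in> {0..T} \<Longrightarrow> op_L0 T n \<alpha> K N u t + op_V T n \<alpha> K K' N u t = h t"
    "\<forall>us. successive_approximations T n \<alpha> K K' N h us \<longrightarrow>
       (\<forall>m. us m \<in> cont_space T) \<and> uniform_limit {0..T} us u sequentially"
    using successive_approximations_converge[OF h] by blast
  have "solves_equation T n \<alpha> K f (\<lambda>t. log_asymp N X t + t ^ N * u t)"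
    using u(2) unfolding h_def
    by (rule correction_solves_equation[OF log_asymp_absolutely_integrable log_asymp_continuous u(1)])
  moreover have "continuous_on {0<..T} u"
    using u(1) by (auto simp: cont_space_def intro: continuous_on_subset)
  then have "continuous_on {0<..T} (\<lambda>t. log_asymp N X t + t ^ N * u t)"
    by (intro continuous_on_add continuous_on_mult continuous_on_power continuous_on_id log_asymp_continuous)
  ultimately show ?thesis
    using X(1) h u(1,3) unfolding h_def by (intro exI[of _ X] exI[of _ u]) blast
qed

text \<open>Two expansions of the same solution differ by \<open>O(t ^ N)\<close>, which determines all coefficients below
  order \<open>N\<close>. By \<open>char_L_root_less\<close> these include all that carry free parameters.\<close>

lemma log_asymp_determined_by_solution:
  assumes uv: "u \<in> cont_space T" "v \<in> cont_space T"
    and eq: "\<And>t. t \<in> {0<..T} \<Longrightarrow> log_asymp N X t + t ^ N * u t = log_asymp N Y t + t ^ N * v t"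
    and i: "i < N"
  shows "X i = Y i"
proof -
  obtain M where M: "\<And>t. t \<in> {0..T} \<Longrightarrow> \<bar>v t - u t\<bar> \<le> M"
    using cont_space_bounded[OF uv(2,1)] by blast
  have "((\<lambda>t. log_asymp N (\<lambda>l. X l - Y l) t / t ^ m) \<longlongrightarrow> 0) (at_right 0)" if m: "m < N" for m
  proof (rule Lim_null_comparison)
    show "\<forall>\<^sub>F t in at_right 0. norm (log_asymp N (\<lambda>l. X l - Y l) t / t ^ m) \<le> t ^ (N - m) * M"
      using eventually_at_right_real[OF T]
    proof eventually_elim
      case (elim t)
      have "log_asymp N (\<lambda>l. X l - Y l) t = log_asymp N X t - log_asymp N Y t"
        by (simp add: log_asymp_def sum_subtractf left_diff_distrib)
      also have "\<dots> = t ^ N * (v t - u t)" using eq[of t] elim by (simp add: algebra_simps)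
      finally have "log_asymp N (\<lambda>l. X l - Y l) t / t ^ m = t ^ (N - m) * (v t - u t)"
        using elim m by (simp add: power_diff)
      then show ?case using M[of t] elim by (simp add: abs_mult)
    qed
    have "((\<lambda>t::real. t ^ (N - m) * M) \<longlongrightarrow> 0 ^ (N - m) * M) (at_right 0)" by (intro tendsto_intros)
    then show "((\<lambda>t::real. t ^ (N - m) * M) \<longlongrightarrow> 0) (at_right 0)" using m by (simp only: power_0_left) simp
  qed
  from log_asymp_coefficients_unique[OF this i] show ?thesis by simp
qed

end

theorem theorem2p2:
  fixes T :: real and n N k p :: nat and \<alpha> :: "nat \<Rightarrow> real"
    and K K' :: "nat \<Rightarrow> real \<Rightarrow> real \<Rightarrow> real" and f :: "real \<Rightarrow> real"
    and J :: "nat set" and r :: "nat \<Rightarrow> nat"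
  assumes "T > 0" and "n \<ge> 1"
    and "\<alpha> 0 = 0" and "\<alpha> n = 1" and "\<forall>i<n. \<alpha> i < \<alpha> (Suc i)"
    and "\<forall>i\<in>{1..n}. C1_in_t T (K i) (K' i)"
    and "C1_on T f" and "f 0 = 0"
    and "condition_A T n \<alpha> K N"
    and "condition_B T n K f N"
    and "J = {j. char_L n \<alpha> K j = 0}" and "finite J" and "card J = k"
    and "\<forall>j\<in>J. has_root_multiplicity (char_P n \<alpha> K j) 1 (r j)"
    and "p = (\<Sum>j\<in>J. r j)"
  shows "L0_boundedly_invertible T n \<alpha> K N \<and>
    J \<subseteq> {..N} \<and> card (SIGMA j:J. {..<r j}) = p \<and>
    (\<exists>(X :: (nat \<times> nat \<Rightarrow> real) \<Rightarrow> nat \<Rightarrow> real poly) (u :: (nat \<times> nat \<Rightarrow> real) \<Rightarrow> real \<Rightarrow> real).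
      let params = (SIGMA j:J. {..<r j}) \<rightarrow>\<^sub>E (UNIV :: real set);
          x = (\<lambda>c t. log_asymp N (X c) t + t ^ N * u c t)
      in (\<forall>c\<in>params.
            (\<forall>j\<in>J. \<forall>l<r j. coeff (X c j) l = c (j, l)) \<and>
            u c \<in> cont_space T \<and>
            continuous_on {0<..T} (x c) \<and>
            solves_equation T n \<alpha> K f (x c) \<and>
            (let h = rhs_h T n \<alpha> K f N (log_asymp N (X c))
             in h \<in> cont_space T \<and>
                (\<forall>us. successive_approximations T n \<alpha> K K' N h us \<longrightarrow>
                   (\<forall>m. us m \<in> cont_space T) \<and>
                   uniform_limit {0..T} us (u c) sequentially))) \<and>
         inj_on (\<lambda>c. restrict (x c) {0<..T}) params)"
proof -
  obtain f1 where f1: "continuous_on {0..T} f1"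
    "\<And>t. t \<in> {0..T} \<Longrightarrow> (f has_real_derivative f1 t) (at t within {0..T})"
    using assms(7) unfolding C1_on_def by blast
  interpret smooth_equation T n N \<alpha> K K' f f1
    by unfold_locales (use assms(1-6,8-10) f1 in auto)
  have root: "has_root_multiplicity (char_P n \<alpha> K j) 1 (r j)" if "char_L n \<alpha> K j = 0" for j
    using assms(11,14) that by blast
  have J: "J \<subseteq> {..N}" using char_L_root_less assms(11) by force
  have card: "card (SIGMA j:J. {..<r j}) = p"
    using assms(12,15) by simp
  define params where "params = (SIGMA j:J. {..<r j}) \<rightarrow>\<^sub>E (UNIV :: real set)"
  define good where "good c X u \<longleftrightarrow> (\<forall>j\<in>J. \<forall>l<r j. coeff (X j) l = c (j, l)) \<and>
    u \<in> cont_space T \<and>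
    continuous_on {0<..T} (\<lambda>t. log_asymp N X t + t ^ N * u t) \<and>
    solves_equation T n \<alpha> K f (\<lambda>t. log_asymp N X t + t ^ N * u t) \<and>
    rhs_h T n \<alpha> K f N (log_asymp N X) \<in> cont_space T \<and>
    (\<forall>us. successive_approximations T n \<alpha> K K' N (rhs_h T n \<alpha> K f N (log_asymp N X)) us \<longrightarrow>
       (\<forall>m. us m \<in> cont_space T) \<and> uniform_limit {0..T} us u sequentially)" for c X u
  have "\<forall>c. \<exists>X u. good c X u"
    using solution_with_prescribed_coefficients[OF root] assms(11) unfolding good_def by simp
  from choice[OF this] obtain X where "\<forall>c. \<exists>u. good c (X c) u" ..
  from choice[OF this] obtain u where good: "\<forall>c. good c (X c) (u c)" ..
  have "inj_on (\<lambda>c. restrict (\<lambda>t. log_asymp N (X c) t + t ^ N * u c t) {0<..T}) params"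
  proof (rule inj_onI)
    fix c d assume cd: "c \<in> params" "d \<in> params"
      and eq: "restrict (\<lambda>t. log_asymp N (X c) t + t ^ N * u c t) {0<..T}
        = restrict (\<lambda>t. log_asymp N (X d) t + t ^ N * u d t) {0<..T}"
    have gc: "good c (X c) (u c)" and gd: "good d (X d) (u d)" using good by auto
    have "log_asymp N (X c) t + t ^ N * u c t = log_asymp N (X d) t + t ^ N * u d t" if "t \<in> {0<..T}" for t
      using fun_cong[OF eq, of t] that by simp
    moreover have "u c \<in> cont_space T" "u d \<in> cont_space T"
      using gc gd unfolding good_def by blast+
    ultimately have "X c j = X d j" if "j \<in> J" for j
      using that assms(11) char_L_root_less
      by (intro log_asymp_determined_by_solution[of "u c" "u d"]) auto
    then have "c (j, l) = d (j, l)" if "j \<in> J" "l < r j" for j l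
      using gc gd that unfolding good_def by metis
    then show "c = d"
      using cd unfolding params_def by (intro PiE_ext) auto
  qed
  with good L0_inv_bounded J card show ?thesis
    unfolding Let_def params_def[symmetric] good_def
    by (intro conjI exI[of _ X] exI[of _ u]) blast+
qed

end
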